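(* Let $F$ be an algebraically closed field of characteristic $p > 0$. Fix integers $d, e > 1$ such that $d \equiv 0$ or $1 \pmod p$ and $p \mid e \leq d$, and fix a point $c \in \mathbb{P}^1(F)$. Let $U_{d,e}^{(c)}$ be the space of rational functions of degree $d$ over $F$ that are ramified at $c$ with ramification index $e$ and unramified elsewhere. Then \[ \dim\left(\mathrm{SL}_2 \backslash U_{d,e}^{(c)}\right) = \begin{cases} (2d - e)/p & \text{if } p \mid d, \\ 1 + (2d - 2 - e)/p & \text{if } p \mid (d-1). \end{cases} \] In particular, $U_{d,e}^{(c)}$ is nonempty under these hypotheses.
   Context: Rational functions of degree $d$ are regarded as points of $\mathrm{Rat}_d \subset \mathbb{P}^{2d+1}$, the open set of $(a_d : \cdots : a_0 : b_d : \cdots : b_0)$ with nonvanishing resultant of $a_d z^d + \cdots + a_0$ and $b_d z^d + \cdots + b_0$. A rational function is unramified at a point if its ramification index there is $1$. $\mathrm{SL}_2$ acts on $U_{d,e}^{(c)}$ by postcomposition $\phi \mapsto \sigma \circ \phi$ with fractional linear transformations, and $\mathrm{SL}_2 \backslash U_{d,e}^{(c)}$ denotes the space of postcomposition classes. *)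

theory Defs
  imports "HOL-Analysis.Analysis" "HOL-Computational_Algebra.Polynomial" "Subresultants.Resultant_Prelim"
begin

text \<open>A point of P^(2d+1) is represented by a (nonzero) coefficient list
  v = [a_d, ..., a_0, b_d, ..., b_0] of length 2d+2; projective equivalence
  (scalar multiples) is built into the orbit relation below.\<close>

definition polyA :: "nat \<Rightarrow> 'a::field list \<Rightarrow> 'a poly" where
  "polyA d v = (\<Sum>i\<le>d. monom (v ! (d - i)) i)"

definition polyB :: "nat \<Rightarrow> 'a::field list \<Rightarrow> 'a poly" where
  "polyB d v = (\<Sum>i\<le>d. monom (v ! (2 * d + 1 - i)) i)"

text \<open>Rat_d (affine cone over it): nonvanishing resultant of the two degree-d forms
  (determinant of the (2d) x (2d) Sylvester matrix).\<close>
definition Rat_cone :: "nat \<Rightarrow> 'a::field list set" where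
  "Rat_cone d = {v. length v = 2 * d + 2 \<and>
      resultant_sub d d (polyA d v) (polyB d v) \<noteq> 0}"

text \<open>Points of P^1(F): None is the point at infinity, Some z the finite point z.
  Ramification index of phi = A/B at a point c with value phi(c) = [alpha : beta]:
  the multiplicity of c as a zero of the degree-d binary form beta*A - alpha*B.\<close>
fun ram_index :: "nat \<Rightarrow> 'a::field list \<Rightarrow> 'a option \<Rightarrow> nat" where
  "ram_index d v (Some z) =
     (let A = polyA d v; B = polyB d v; \<alpha> = poly A z; \<beta> = poly B z
      in order z ([:\<beta>:] * A - [:\<alpha>:] * B))"
| "ram_index d v None =
     (let A = polyA d v; B = polyB d v; \<alpha> = coeff A d; \<beta> = coeff B d
      in d - degree ([:\<beta>:] * A - [:\<alpha>:] * B))"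

definition U_cone :: "nat \<Rightarrow> nat \<Rightarrow> 'a::field option \<Rightarrow> 'a list set" where
  "U_cone d e c = {v \<in> Rat_cone d. ram_index d v c = e \<and>
      (\<forall>x. x \<noteq> c \<longrightarrow> ram_index d v x = 1)}"

definition postcomp :: "nat \<Rightarrow> 'a::field \<Rightarrow> 'a \<Rightarrow> 'a \<Rightarrow> 'a \<Rightarrow> 'a list \<Rightarrow> 'a list" where
  "postcomp d \<alpha> \<beta> \<gamma> \<delta> v =
     (let as = take (d + 1) v; bs = drop (d + 1) v
      in map2 (\<lambda>a b. \<alpha> * a + \<beta> * b) as bs @ map2 (\<lambda>a b. \<gamma> * a + \<delta> * b) as bs)"

definition sl2_proj_equiv :: "nat \<Rightarrow> 'a::field list \<Rightarrow> 'a list \<Rightarrow> bool" where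
  "sl2_proj_equiv d v w \<longleftrightarrow> (\<exists>\<alpha> \<beta> \<gamma> \<delta> s. \<alpha> * \<delta> - \<beta> * \<gamma> = 1 \<and> s \<noteq> 0 \<and>
       w = map (\<lambda>x. s * x) (postcomp d \<alpha> \<beta> \<gamma> \<delta> v))"

definition poly_fun :: "nat \<Rightarrow> ('a::comm_ring_1 list \<Rightarrow> 'a) \<Rightarrow> bool" where
  "poly_fun N f \<longleftrightarrow> (\<exists>M c. finite M \<and> (\<forall>m\<in>M. length m = N) \<and>
      (\<forall>x. length x = N \<longrightarrow> f x = (\<Sum>m\<in>M. c m * (\<Prod>i<N. (x ! i) ^ (m ! i)))))"

definition zariski :: "nat \<Rightarrow> 'a::comm_ring_1 list topology" where
  "zariski N = topology_generated_by
     {{x. length x = N \<and> f x \<noteq> 0} | f. poly_fun N f}"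

definition orbit_space :: "'a topology \<Rightarrow> ('a \<Rightarrow> 'a \<Rightarrow> bool) \<Rightarrow> 'a set topology" where
  "orbit_space X R = topology (\<lambda>W. W \<subseteq> {{y \<in> topspace X. R x y} | x. x \<in> topspace X}
                                   \<and> openin X (\<Union>W))"

definition irreducible_closed :: "'a topology \<Rightarrow> 'a set \<Rightarrow> bool" where
  "irreducible_closed X Z \<longleftrightarrow> closedin X Z \<and> Z \<noteq> {} \<and>
     (\<forall>Z1 Z2. closedin X Z1 \<and> closedin X Z2 \<and> Z \<subseteq> Z1 \<union> Z2 \<longrightarrow> Z \<subseteq> Z1 \<or> Z \<subseteq> Z2)"

definition krull_dim :: "'a topology \<Rightarrow> enat" where
  "krull_dim X = Sup {enat n | n. \<exists>Z. (\<forall>i\<le>n. irreducible_closed X (Z i)) \<and>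
                                     (\<forall>i<n. Z i \<subset> Z (Suc i))}"

definition SL2_quot_U :: "nat \<Rightarrow> nat \<Rightarrow> 'a::field option \<Rightarrow> 'a list set topology" where
  "SL2_quot_U d e c = orbit_space (subtopology (zariski (2 * d + 2)) (U_cone d e c)) (sl2_proj_equiv d)"

end

theory Submission
  imports Defs
begin

text \<open>Moving \<open>c\<close> to infinity, a rational function \<open>A / B\<close> of degree \<open>d\<close> is
  unramified on the affine line iff the Wronskian \<open>A' B - A B'\<close> is a nonzero constant. Then \<open>A\<close>
  and \<open>B\<close> are coprime and \<open>A'' B = A B''\<close>, so comparing degrees gives \<open>A'' = B'' = 0\<close>: only
  exponents congruent to 0 or 1 modulo \<open>p\<close> occur, and the condition becomes that a 2 x 2
  matrix of polynomials in \<open>t = z^p\<close> has constant nonzero determinant. After postcomposition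
  the denominator corresponds to a coprime pair \<open>(u, w)\<close> with \<open>u\<close> monic, and the numerator
  is the unique reduced Bezout solution plus \<open>g\<close> times the denominator, where \<open>g\<close> is a
  polynomial in \<open>t\<close> of degree \<open>e / p\<close> without constant term. The coefficients of \<open>u\<close>, \<open>w\<close>, \<open>g\<close>
  identify the quotient with a nonempty open subset of an affine space, by rational maps in both
  directions.\<close>

section \<open>Polynomial functions and rational functions on affine space\<close>

text \<open>Dimension is taken in the quotient topology, so a mere bijection with parameters would
  not suffice: the parameter map must be continuous and have a continuous section. With
  \<open>d = p * (m + k) + \<epsilon>\<close> and \<open>e = p * k\<close>, the monic
  \<open>u\<close> has degree \<open>m\<close>, while \<open>w\<close> has
  \<open>m + \<epsilon>\<close> and \<open>g\<close> has \<open>k\<close> free coefficients; the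
  total \<open>2 * m + \<epsilon> + k\<close> is the claimed dimension in both cases. Coprimality of
  \<open>u\<close> and \<open>w\<close> and a nonzero top coefficient of \<open>g\<close> cut out
  the open set. Normalization divides by the coefficient of the numerator at degree
  \<open>d\<close>, which may vanish, so continuity is checked on two charts exchanged by
  \<open>(A, B) \<mapsto> (B, - A)\<close>. Bezout cofactors and polynomial quotients solve square
  linear systems and are therefore rational by Cramer's rule. For the Krull dimension of an open
  set, counting power products takes the place of transcendence degree.\<close>

definition exps :: "nat \<Rightarrow> nat \<Rightarrow> nat list set" where
  "exps N D = {m. set m \<subseteq> {..D} \<and> length m = N}"

definition power_prod :: "'a::comm_ring_1 list \<Rightarrow> nat list \<Rightarrow> 'a" where
  "power_prod x m = (\<Prod>i<length m. (x ! i) ^ (m ! i))"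

text \<open>\<open>D\<close> bounds the exponent of each variable separately, so the admissible
  monomials form a box with exactly \<open>(D + 1) ^ N\<close> elements; this count drives the upper
  bound on the dimension.\<close>

definition poly_fun_deg :: "nat \<Rightarrow> nat \<Rightarrow> ('a::comm_ring_1 list \<Rightarrow> 'a) \<Rightarrow> bool" where
  "poly_fun_deg N D f \<longleftrightarrow>
     (\<exists>c. \<forall>x. length x = N \<longrightarrow> f x = (\<Sum>m\<in>exps N D. c m * power_prod x m))"

lemma finite_exps [simp, intro]: "finite (exps N D)"
  unfolding exps_def by (rule finite_lists_length_eq) simp

lemma card_exps: "card (exps N D) = (D + 1) ^ N"
  unfolding exps_def by (subst card_lists_length_eq) auto

lemma exps_iff: "m \<in> exps N D \<longleftrightarrow> length m = N \<and> (\<forall>i<N. m ! i \<le> D)"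
  unfolding exps_def by (auto simp: set_conv_nth)

lemma poly_fun_deg_cong:
  "poly_fun_deg N D f \<Longrightarrow> (\<And>x. length x = N \<Longrightarrow> f x = g x) \<Longrightarrow> poly_fun_deg N D g"
  unfolding poly_fun_deg_def by (elim exE, rule_tac x = c in exI) auto

lemma poly_fun_deg_power_prod:
  assumes "m \<in> exps N D" shows "poly_fun_deg N D (\<lambda>x. power_prod x m)"
  unfolding poly_fun_deg_def
proof (intro exI[of _ "\<lambda>m'. if m' = m then 1 else 0"] allI impI)
  fix x :: "'a list"
  have "(\<Sum>m'\<in>exps N D. (if m' = m then 1 else 0) * power_prod x m')
      = (\<Sum>m'\<in>exps N D. if m' = m then power_prod x m' else 0)"
    by (rule sum.cong) auto
  then show "power_prod x m = (\<Sum>m'\<in>exps N D. (if m' = m then 1 else 0) * power_prod x m')"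
    using assms by (simp add: sum.delta)
qed

lemma poly_fun_deg_cmult:
  assumes "poly_fun_deg N D f" shows "poly_fun_deg N D (\<lambda>x. a * f x)"
proof -
  obtain c where "\<And>x. length x = N \<Longrightarrow> f x = (\<Sum>m\<in>exps N D. c m * power_prod x m)"
    using assms unfolding poly_fun_deg_def by blast
  then show ?thesis unfolding poly_fun_deg_def
    by (intro exI[of _ "\<lambda>m. a * c m"]) (auto simp: sum_distrib_left mult.assoc)
qed

lemma poly_fun_deg_sum:
  fixes f :: "'i \<Rightarrow> 'a::comm_ring_1 list \<Rightarrow> 'a"
  assumes "\<And>i. i \<in> I \<Longrightarrow> poly_fun_deg N D (f i)"
  shows "poly_fun_deg N D (\<lambda>x. \<Sum>i\<in>I. f i x)"
proof -
  obtain c where c: "\<And>i x. i \<in> I \<Longrightarrow> length x = N \<Longrightarrow>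
      f i x = (\<Sum>m\<in>exps N D. c i m * power_prod x m)"
    using assms unfolding poly_fun_deg_def by metis
  show ?thesis unfolding poly_fun_deg_def
  proof (intro exI[of _ "\<lambda>m. \<Sum>i\<in>I. c i m"] allI impI)
    fix x :: "'a list" assume x: "length x = N"
    have "(\<Sum>i\<in>I. f i x) = (\<Sum>i\<in>I. \<Sum>m\<in>exps N D. c i m * power_prod x m)"
      using c x by auto
    also have "\<dots> = (\<Sum>m\<in>exps N D. (\<Sum>i\<in>I. c i m) * power_prod x m)"
      by (subst sum.swap) (simp add: sum_distrib_right)
    finally show "(\<Sum>i\<in>I. f i x) = (\<Sum>m\<in>exps N D. (\<Sum>i\<in>I. c i m) * power_prod x m)" .
  qed
qed

lemma poly_fun_deg_add:
  assumes "poly_fun_deg N D f" "poly_fun_deg N D g" shows "poly_fun_deg N D (\<lambda>x. f x + g x)"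
proof -
  have "poly_fun_deg N D (\<lambda>x. \<Sum>i\<in>{True,False}. (if i then f else g) x)"
    by (rule poly_fun_deg_sum) (use assms in auto)
  then show ?thesis by (rule poly_fun_deg_cong) simp
qed

lemma poly_fun_deg_mono:
  assumes "poly_fun_deg N D f" "D \<le> D'" shows "poly_fun_deg N D' f"
proof -
  obtain c where c: "\<And>x. length x = N \<Longrightarrow> f x = (\<Sum>m\<in>exps N D. c m * power_prod x m)"
    using assms unfolding poly_fun_deg_def by blast
  have "poly_fun_deg N D' (\<lambda>x. \<Sum>m\<in>exps N D. c m * power_prod x m)"
    by (intro poly_fun_deg_sum poly_fun_deg_cmult poly_fun_deg_power_prod)
       (use assms(2) in \<open>auto simp: exps_def\<close>)
  then show ?thesis by (rule poly_fun_deg_cong) (use c in auto)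
qed

lemma power_prod_mult:
  assumes "length m = N" "length m' = N"
  shows "power_prod x m * power_prod x m' = power_prod x (map2 (+) m m')"
  using assms by (simp add: power_prod_def prod.distrib[symmetric] power_add)

lemma poly_fun_deg_mult:
  assumes "poly_fun_deg N D f" "poly_fun_deg N D' g"
  shows "poly_fun_deg N (D + D') (\<lambda>x. f x * g x)"
proof -
  obtain c where c: "\<And>x. length x = N \<Longrightarrow> f x = (\<Sum>m\<in>exps N D. c m * power_prod x m)"
    using assms(1) unfolding poly_fun_deg_def by blast
  obtain c' where c': "\<And>x. length x = N \<Longrightarrow> g x = (\<Sum>m\<in>exps N D'. c' m * power_prod x m)"
    using assms(2) unfolding poly_fun_deg_def by blast
  have "poly_fun_deg N (D + D') (\<lambda>x. \<Sum>m\<in>exps N D. \<Sum>m'\<in>exps N D'.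
      (c m * c' m') * power_prod x (map2 (+) m m'))"
    by (intro poly_fun_deg_sum poly_fun_deg_cmult poly_fun_deg_power_prod)
       (auto simp: exps_iff add_mono)
  then show ?thesis
  proof (rule poly_fun_deg_cong)
    fix x :: "'a list" assume x: "length x = N"
    show "(\<Sum>m\<in>exps N D. \<Sum>m'\<in>exps N D'. (c m * c' m') * power_prod x (map2 (+) m m')) = f x * g x"
      unfolding c[OF x] c'[OF x] sum_product
      by (intro sum.cong refl, subst power_prod_mult[symmetric, of _ N])
         (auto simp: exps_def mult_ac)
  qed
qed

lemma poly_fun_deg_const: "poly_fun_deg N 0 (\<lambda>x. a)"
proof -
  have "poly_fun_deg N 0 (\<lambda>x. a * power_prod x (replicate N 0))"
    by (intro poly_fun_deg_cmult poly_fun_deg_power_prod) (auto simp: exps_def)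
  then show ?thesis by (rule poly_fun_deg_cong) (simp add: power_prod_def)
qed

lemma poly_fun_deg_power:
  assumes "poly_fun_deg N D f" shows "poly_fun_deg N (s * D) (\<lambda>x. f x ^ s)"
proof (induction s)
  case 0 show ?case using poly_fun_deg_const[of N 1] by simp
next
  case (Suc s) then show ?case using poly_fun_deg_mult[OF assms Suc] by simp
qed

lemma poly_fun_deg_prod:
  fixes f :: "nat \<Rightarrow> 'a::comm_ring_1 list \<Rightarrow> 'a"
  assumes "\<And>i. i < n \<Longrightarrow> poly_fun_deg N D (f i)"
  shows "poly_fun_deg N (n * D) (\<lambda>x. \<Prod>i<n. f i x)"
  using assms
proof (induction n)
  case 0 show ?case using poly_fun_deg_const[of N 1] by simp
next
  case (Suc n)
  have "poly_fun_deg N (n * D + D) (\<lambda>x. (\<Prod>i<n. f i x) * f n x)"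
    by (rule poly_fun_deg_mult) (use Suc in auto)
  then show ?case by (simp add: add.commute)
qed

lemma poly_fun_iff_deg: "poly_fun N f \<longleftrightarrow> (\<exists>D. poly_fun_deg N D f)"
proof
  assume "poly_fun N f"
  then obtain M c where M: "finite M" "\<And>m. m \<in> M \<Longrightarrow> length m = N"
    "\<And>x. length x = N \<Longrightarrow> f x = (\<Sum>m\<in>M. c m * (\<Prod>i<N. (x ! i) ^ (m ! i)))"
    unfolding poly_fun_def by blast
  \<comment> \<open>The inserted 0 keeps \<open>Max\<close> meaningful when no exponent occurs, as
    for \<open>M = {}\<close> or \<open>N = 0\<close>.\<close>
  define D where "D = Max (insert 0 (\<Union>(set ` M)))"
  have "M \<subseteq> exps N D" using M unfolding exps_def D_def by (auto intro!: Max_ge)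
  then have "poly_fun_deg N D (\<lambda>x. \<Sum>m\<in>M. c m * power_prod x m)"
    by (intro poly_fun_deg_sum poly_fun_deg_cmult poly_fun_deg_power_prod) auto
  then have "poly_fun_deg N D f"
    by (rule poly_fun_deg_cong) (auto simp: M power_prod_def intro!: sum.cong)
  then show "\<exists>D. poly_fun_deg N D f" ..
next
  assume "\<exists>D. poly_fun_deg N D f"
  then obtain D c where "\<forall>x. length x = N \<longrightarrow> f x = (\<Sum>m\<in>exps N D. c m * power_prod x m)"
    unfolding poly_fun_deg_def by blast
  then show "poly_fun N f" unfolding poly_fun_def
    by (intro exI[of _ "exps N D"] exI[of _ c])
       (auto simp: exps_iff power_prod_def intro!: sum.cong)
qed

lemma poly_fun_const: "poly_fun N (\<lambda>x. a)"
  using poly_fun_deg_const poly_fun_iff_deg by blast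

lemma poly_fun_mult: "poly_fun N f \<Longrightarrow> poly_fun N g \<Longrightarrow> poly_fun N (\<lambda>x. f x * g x)"
  using poly_fun_deg_mult poly_fun_iff_deg by metis

lemma poly_fun_add:
  assumes "poly_fun N f" "poly_fun N g" shows "poly_fun N (\<lambda>x. f x + g x)"
proof -
  obtain D D' where "poly_fun_deg N D f" "poly_fun_deg N D' g"
    using assms poly_fun_iff_deg by blast
  then have "poly_fun_deg N (D + D') f" "poly_fun_deg N (D + D') g"
    by (auto intro: poly_fun_deg_mono)
  then show ?thesis using poly_fun_deg_add poly_fun_iff_deg by blast
qed

lemma poly_fun_nth: assumes "i < N" shows "poly_fun N (\<lambda>x. x ! i)"
proof -
  define m where "m = (replicate N 0)[i := Suc 0]"
  have "poly_fun_deg N 1 (\<lambda>x :: 'a list. power_prod x m)"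
    by (rule poly_fun_deg_power_prod) (use assms in \<open>auto simp: exps_iff m_def nth_list_update\<close>)
  moreover have "power_prod x m = x ! i" for x :: "'a list"
  proof -
    have "power_prod x m = (\<Prod>j<N. if j = i then x ! j else 1)"
      unfolding power_prod_def by (rule prod.cong) (auto simp: m_def nth_list_update)
    then show ?thesis using assms by simp
  qed
  ultimately show ?thesis unfolding poly_fun_iff_deg by auto
qed

lemma poly_fun_sum:
  "(\<And>i. i \<in> I \<Longrightarrow> poly_fun N (f i)) \<Longrightarrow> poly_fun N (\<lambda>x. \<Sum>i\<in>I. f i x)"
  by (induction I rule: infinite_finite_induct) (auto intro: poly_fun_const poly_fun_add)

lemma poly_fun_prod:
  "(\<And>i. i \<in> I \<Longrightarrow> poly_fun N (f i)) \<Longrightarrow> poly_fun N (\<lambda>x. \<Prod>i\<in>I. f i x)"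
  by (induction I rule: infinite_finite_induct) (auto intro: poly_fun_const poly_fun_mult)

text \<open>A single numerator and denominator must serve all of \<open>S\<close>, which is more
  than local regularity. Closure under field operations is then purely algebraic, at the price of
  covering a domain by charts where no global quotient is at hand.\<close>

definition rat_fun :: "nat \<Rightarrow> 'a::field list set \<Rightarrow> ('a list \<Rightarrow> 'a) \<Rightarrow> bool" where
  "rat_fun N S f \<longleftrightarrow>
     (\<exists>p q. poly_fun N p \<and> poly_fun N q \<and> (\<forall>x\<in>S. q x \<noteq> 0 \<and> f x = p x / q x))"

lemma rat_fun_poly_fun: assumes "poly_fun N f" shows "rat_fun N S f"
  unfolding rat_fun_def using assms by (intro exI[of _ f] exI[of _ "\<lambda>_. 1"]) (auto simp: poly_fun_const)

lemma rat_fun_const: "rat_fun N S (\<lambda>_. a)"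
  by (intro rat_fun_poly_fun poly_fun_const)

lemma rat_fun_nth: "i < N \<Longrightarrow> rat_fun N S (\<lambda>x. x ! i)"
  by (intro rat_fun_poly_fun poly_fun_nth)

lemma rat_fun_cong:
  "rat_fun N S f \<Longrightarrow> (\<And>x. x \<in> S \<Longrightarrow> f x = g x) \<Longrightarrow> rat_fun N S g"
  unfolding rat_fun_def by fastforce

lemma rat_fun_add:
  assumes "rat_fun N S f" "rat_fun N S g" shows "rat_fun N S (\<lambda>x. f x + g x)"
proof -
  obtain p q p' q' where "poly_fun N p" "poly_fun N q" "\<forall>x\<in>S. q x \<noteq> 0 \<and> f x = p x / q x"
    and "poly_fun N p'" "poly_fun N q'" "\<forall>x\<in>S. q' x \<noteq> 0 \<and> g x = p' x / q' x"
    using assms unfolding rat_fun_def by metis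
  then show ?thesis unfolding rat_fun_def
    by (intro exI[of _ "\<lambda>x. p x * q' x + p' x * q x"] exI[of _ "\<lambda>x. q x * q' x"]
          conjI poly_fun_add poly_fun_mult) (auto simp: add_frac_eq)
qed

lemma rat_fun_mult:
  assumes "rat_fun N S f" "rat_fun N S g" shows "rat_fun N S (\<lambda>x. f x * g x)"
proof -
  obtain p q p' q' where "poly_fun N p" "poly_fun N q" "\<forall>x\<in>S. q x \<noteq> 0 \<and> f x = p x / q x"
    and "poly_fun N p'" "poly_fun N q'" "\<forall>x\<in>S. q' x \<noteq> 0 \<and> g x = p' x / q' x"
    using assms unfolding rat_fun_def by metis
  then show ?thesis unfolding rat_fun_def
    by (intro exI[of _ "\<lambda>x. p x * p' x"] exI[of _ "\<lambda>x. q x * q' x"]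
          conjI poly_fun_mult) auto
qed

lemma rat_fun_inverse:
  assumes "rat_fun N S f" "\<And>x. x \<in> S \<Longrightarrow> f x \<noteq> 0" shows "rat_fun N S (\<lambda>x. inverse (f x))"
proof -
  obtain p q where pq: "poly_fun N p" "poly_fun N q" "\<forall>x\<in>S. q x \<noteq> 0 \<and> f x = p x / q x"
    using assms unfolding rat_fun_def by metis
  with assms(2) have "\<forall>x\<in>S. p x \<noteq> 0" by fastforce
  with pq show ?thesis unfolding rat_fun_def
    by (intro exI[of _ q] exI[of _ p]) auto
qed

lemma rat_fun_minus: "rat_fun N S f \<Longrightarrow> rat_fun N S (\<lambda>x. - f x)"
  using rat_fun_mult[OF rat_fun_const[of N S "- 1"]] by simp

lemma rat_fun_diff: "rat_fun N S f \<Longrightarrow> rat_fun N S g \<Longrightarrow> rat_fun N S (\<lambda>x. f x - g x)"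
  using rat_fun_add[OF _ rat_fun_minus] by fastforce

lemma rat_fun_divide:
  "rat_fun N S f \<Longrightarrow> rat_fun N S g \<Longrightarrow> (\<And>x. x \<in> S \<Longrightarrow> g x \<noteq> 0) \<Longrightarrow>
    rat_fun N S (\<lambda>x. f x / g x)"
  unfolding divide_inverse by (intro rat_fun_mult rat_fun_inverse)

lemma rat_fun_sum:
  "(\<And>i. i \<in> I \<Longrightarrow> rat_fun N S (f i)) \<Longrightarrow> rat_fun N S (\<lambda>x. \<Sum>i\<in>I. f i x)"
  by (induction I rule: infinite_finite_induct) (auto intro: rat_fun_const rat_fun_add)

lemma rat_fun_prod:
  "(\<And>i. i \<in> I \<Longrightarrow> rat_fun N S (f i)) \<Longrightarrow> rat_fun N S (\<lambda>x. \<Prod>i\<in>I. f i x)"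
  by (induction I rule: infinite_finite_induct) (auto intro: rat_fun_const rat_fun_mult)

lemma rat_fun_power: "rat_fun N S f \<Longrightarrow> rat_fun N S (\<lambda>x. f x ^ n)"
  by (induction n) (auto intro: rat_fun_const rat_fun_mult)

lemma rat_fun_comp:
  assumes h: "poly_fun M h" and F: "\<And>i. i < M \<Longrightarrow> rat_fun N S (\<lambda>x. F x ! i)"
    and len: "\<And>x. x \<in> S \<Longrightarrow> length (F x) = M"
  shows "rat_fun N S (\<lambda>x. h (F x))"
proof -
  obtain A c where A: "\<forall>x. length x = M \<longrightarrow> h x = (\<Sum>m\<in>A. c m * (\<Prod>i<M. (x ! i) ^ (m ! i)))"
    using h unfolding poly_fun_def by blast
  have "rat_fun N S (\<lambda>x. \<Sum>m\<in>A. c m * (\<Prod>i<M. (F x ! i) ^ (m ! i)))"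
    by (intro rat_fun_sum rat_fun_mult rat_fun_const rat_fun_prod rat_fun_power F) simp
  then show ?thesis by (rule rat_fun_cong) (use A len in simp)
qed

section \<open>The Zariski topology and continuity of rational maps\<close>

lemma topspace_zariski [simp]: "topspace (zariski N :: 'a::comm_ring_1 list topology) = {x. length x = N}"
proof -
  have "{x :: 'a list. length x = N} \<in> {{x. length x = N \<and> f x \<noteq> 0} | f. poly_fun N f}"
    by (rule CollectI, rule exI[of _ "\<lambda>_. 1"]) (simp add: poly_fun_const)
  then show ?thesis unfolding zariski_def topology_generated_by_topspace
    by blast
qed

lemma openin_zariski_basic:
  "poly_fun N f \<Longrightarrow> openin (zariski N) {x. length x = N \<and> f x \<noteq> 0}"
  unfolding zariski_def by (rule topology_generated_by_Basis) blast

text \<open>In a domain, \<open>f x * g x \<noteq> 0\<close> describes the intersection of two basic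
  open sets, so the generating sets already form a base.\<close>

lemma openin_zariski_nbhd:
  fixes G :: "'a::idom list set"
  assumes "openin (zariski N) G" "z \<in> G"
  obtains h where "poly_fun N h" "h z \<noteq> 0" "\<And>x. length x = N \<Longrightarrow> h x \<noteq> 0 \<Longrightarrow> x \<in> G"
proof -
  define \<B> where "\<B> = {{x. length x = N \<and> f x \<noteq> 0} | f :: 'a list \<Rightarrow> 'a. poly_fun N f}"
  have inter: "a \<inter> b \<in> \<B>" if ab: "a \<in> \<B>" "b \<in> \<B>" for a b
  proof -
    obtain f where f: "a = {x. length x = N \<and> f x \<noteq> 0}" "poly_fun N f"
      using ab(1) unfolding \<B>_def by (elim CollectE exE conjE)
    obtain g where g: "b = {x. length x = N \<and> g x \<noteq> 0}" "poly_fun N g"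
      using ab(2) unfolding \<B>_def by (elim CollectE exE conjE)
    show ?thesis unfolding \<B>_def
      by (rule CollectI, rule exI[of _ "\<lambda>x. f x * g x"]) (use f g in \<open>auto simp: poly_fun_mult\<close>)
  qed
  have "generate_topology_on \<B> G"
    using assms(1) unfolding zariski_def openin_topology_generated_by_iff \<B>_def .
  then have "\<forall>z\<in>G. \<exists>B\<in>\<B>. z \<in> B \<and> B \<subseteq> G"
  proof induction
    case Empty then show ?case by simp
  next
    case (Int a b)
    show ?case
    proof
      fix z assume z: "z \<in> a \<inter> b"
      obtain B1 where B1: "B1 \<in> \<B>" "z \<in> B1" "B1 \<subseteq> a" using Int.IH(1) z by blast
      obtain B2 where B2: "B2 \<in> \<B>" "z \<in> B2" "B2 \<subseteq> b" using Int.IH(2) z by blast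
      show "\<exists>B\<in>\<B>. z \<in> B \<and> B \<subseteq> a \<inter> b"
        using B1 B2 by (intro bexI[of _ "B1 \<inter> B2"] inter) auto
    qed
  next
    case (UN K) then show ?case by (meson UnionE Union_upper subset_trans)
  next
    case (Basis s) then show ?case by blast
  qed
  then obtain B where B: "B \<in> \<B>" "z \<in> B" "B \<subseteq> G" using assms(2) by blast
  obtain f where "B = {x. length x = N \<and> f x \<noteq> 0}" "poly_fun N f"
    using B(1) unfolding \<B>_def by (elim CollectE exE conjE)
  then show ?thesis using B by (intro that[of f]) auto
qed

lemma continuous_map_into_zariski:
  assumes "\<And>x. x \<in> topspace X \<Longrightarrow> length (F x) = M"
    and "\<And>h. poly_fun M h \<Longrightarrow> openin X {x \<in> topspace X. h (F x) \<noteq> 0}"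
  shows "continuous_map X (zariski M :: 'a::comm_ring_1 list topology) F"
  unfolding zariski_def
proof (rule continuous_on_generated_topo)
  fix W assume "W \<in> {{x. length x = M \<and> f x \<noteq> 0} | f :: 'a list \<Rightarrow> 'a. poly_fun M f}"
  then obtain f where f: "poly_fun M f" "W = {x. length x = M \<and> f x \<noteq> 0}" by blast
  have "F -` W \<inter> topspace X = {x \<in> topspace X. f (F x) \<noteq> 0}" using assms(1) f by auto
  then show "openin X (F -` W \<inter> topspace X)" using assms(2) f by simp
next
  have "{x :: 'a list. length x = M} \<in> {{x. length x = M \<and> f x \<noteq> 0} | f. poly_fun M f}"
    by (rule CollectI, rule exI[of _ "\<lambda>_. 1"]) (simp add: poly_fun_const)
  then show "F ` topspace X \<subseteq> \<Union> {{x. length x = M \<and> f x \<noteq> 0} |f :: 'a list \<Rightarrow> 'a. poly_fun M f}"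
    using assms(1) by blast
qed

text \<open>Composed with a polynomial function, \<open>F\<close> gives a quotient
  \<open>p / q\<close> with \<open>q\<close> nonvanishing on \<open>S\<close>; the preimage of a
  basic open set is therefore cut out by \<open>p\<close> alone.\<close>

lemma continuous_map_rat_fun:
  fixes F :: "'a::field list \<Rightarrow> 'a list"
  assumes S: "\<And>x. x \<in> S \<Longrightarrow> length x = N" and len: "\<And>x. x \<in> S \<Longrightarrow> length (F x) = M"
    and F: "\<And>i. i < M \<Longrightarrow> rat_fun N S (\<lambda>x. F x ! i)"
  shows "continuous_map (subtopology (zariski N) S) (zariski M) F"
proof (rule continuous_map_into_zariski)
  show "length (F x) = M" if "x \<in> topspace (subtopology (zariski N) S)" for x
    using that len by auto
next
  fix h :: "'a list \<Rightarrow> 'a" assume "poly_fun M h"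
  then have "rat_fun N S (\<lambda>x. h (F x))" using F len by (rule rat_fun_comp)
  then obtain p q where pq: "poly_fun N p" "\<forall>x\<in>S. q x \<noteq> 0 \<and> h (F x) = p x / q x"
    unfolding rat_fun_def by blast
  have "{x \<in> topspace (subtopology (zariski N) S). h (F x) \<noteq> 0} = {x. length x = N \<and> p x \<noteq> 0} \<inter> S"
  proof (rule Set.set_eqI)
    fix x show "x \<in> {x \<in> topspace (subtopology (zariski N) S). h (F x) \<noteq> 0} \<longleftrightarrow>
        x \<in> {x. length x = N \<and> p x \<noteq> 0} \<inter> S"
      using bspec[OF pq(2), of x] by (cases "x \<in> S") simp_all
  qed
  then show "openin (subtopology (zariski N) S) {x \<in> topspace (subtopology (zariski N) S). h (F x) \<noteq> 0}"
    using openin_zariski_basic[OF pq(1)] by (auto simp: openin_subtopology)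
qed

section \<open>Krull dimension of open subsets of affine space\<close>

text \<open>Over a finite field, the product of all \<open>[:- a, 1:]\<close> plus 1 would be a
  nonconstant polynomial without a root.\<close>

lemma infinite_alg_closed_UNIV: "infinite (UNIV :: 'a::alg_closed_field set)"
proof
  assume fin: "finite (UNIV :: 'a set)"
  define q :: "'a poly" where "q = (\<Prod>a\<in>UNIV. [:- a, 1:])"
  have "degree q = card (UNIV :: 'a set)"
    unfolding q_def by (subst degree_prod_eq_sum_degree) auto
  then have "degree q > 0" using fin by (simp add: card_gt_0_iff)
  then have "degree (q + 1) > 0" by (subst degree_add_eq_left) auto
  then obtain x where "poly (q + 1) x = 0" using alg_closed_imp_poly_has_root by blast
  moreover have "poly q x = 0"
    unfolding q_def poly_prod using fin by (subst prod_zero_iff) auto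
  ultimately show False by simp
qed

text \<open>The affine line from \<open>x\<close> (at \<open>s = 0\<close>) to \<open>y\<close> (at
  \<open>s = 1\<close>). Restriction to such lines turns polynomial functions into polynomials in
  one variable, which have finitely many roots.\<close>

definition line_point :: "'a::field list \<Rightarrow> 'a list \<Rightarrow> 'a \<Rightarrow> 'a list" where
  "line_point x y s = map2 (\<lambda>a b. a + s * (b - a)) x y"

lemma length_line_point [simp]: "length (line_point x y s) = min (length x) (length y)"
  by (simp add: line_point_def)

lemma nth_line_point:
  "i < length x \<Longrightarrow> i < length y \<Longrightarrow> line_point x y s ! i = x ! i + s * (y ! i - x ! i)"
  by (simp add: line_point_def)

lemma line_point_0: "length x = length y \<Longrightarrow> line_point x y 0 = x"
  by (rule nth_equalityI) (auto simp: nth_line_point)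

lemma line_point_1: "length x = length y \<Longrightarrow> line_point x y 1 = y"
  by (rule nth_equalityI) (auto simp: nth_line_point)

lemma poly_fun_line:
  assumes "poly_fun N f" "length x = N" "length y = N"
  obtains P where "\<And>s. f (line_point x y s) = poly P s"
proof -
  obtain M c where M: "\<forall>x. length x = N \<longrightarrow> f x = (\<Sum>m\<in>M. c m * (\<Prod>i<N. (x ! i) ^ (m ! i)))"
    using assms(1) unfolding poly_fun_def by blast
  show ?thesis
  proof (rule that[of "\<Sum>m\<in>M. Polynomial.smult (c m) (\<Prod>i<N. [:x ! i, y ! i - x ! i:] ^ (m ! i))"])
    fix s
    show "f (line_point x y s) =
        poly (\<Sum>m\<in>M. Polynomial.smult (c m) (\<Prod>i<N. [:x ! i, y ! i - x ! i:] ^ (m ! i))) s"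
      using assms(2,3) by (simp add: M poly_sum poly_prod nth_line_point)
  qed
qed

lemma poly_fun_line_common_nonzero:
  fixes f g :: "'a::field list \<Rightarrow> 'a"
  assumes inf: "infinite (UNIV :: 'a set)"
    and f: "poly_fun N f" "f x \<noteq> 0" and g: "poly_fun N g" "g y \<noteq> 0"
    and len: "length x = N" "length y = N"
  obtains s :: 'a where "f (line_point x y s) \<noteq> 0" "g (line_point x y s) \<noteq> 0" "s \<noteq> 0"
proof -
  obtain P where P: "\<And>s. f (line_point x y s) = poly P s"
    using poly_fun_line[OF f(1) len] by blast
  obtain Q where Q: "\<And>s. g (line_point x y s) = poly Q s"
    using poly_fun_line[OF g(1) len] by blast
  have "P \<noteq> 0" using P[of 0] f(2) len by (auto simp: line_point_0)
  moreover have "Q \<noteq> 0" using Q[of 1] g(2) len by (auto simp: line_point_1)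
  \<comment> \<open>The factor \<open>[:0, 1:]\<close> forces the chosen parameter to differ from 0
    as well.\<close>
  ultimately have "[:0, 1:] * P * Q \<noteq> 0" by simp
  then have "finite {s. poly ([:0, 1:] * P * Q) s = 0}" by (rule poly_roots_finite)
  then obtain s where "poly ([:0, 1:] * P * Q) s \<noteq> 0"
    using inf by (metis (mono_tags, lifting) UNIV_eq_I mem_Collect_eq)
  then show ?thesis using P Q by (intro that[of s]) auto
qed

text \<open>A point of the flat outside \<open>Z1\<close> and one outside \<open>Z2\<close> span a
  line in \<open>L\<close>; all but finitely many of its points lie in \<open>V\<close> and avoid
  both closed sets, so \<open>Z1\<close> and \<open>Z2\<close> cannot cover
  \<open>L \<inter> V\<close>.\<close>

lemma irreducible_closed_flat:
  fixes V :: "'a::field list set"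
  assumes inf: "infinite (UNIV :: 'a set)"
    and V: "openin (zariski N) V" and L: "closedin (zariski N) L" and v: "v \<in> L \<inter> V"
    and line: "\<And>x y s. x \<in> L \<Longrightarrow> y \<in> L \<Longrightarrow> line_point x y s \<in> L"
  shows "irreducible_closed (subtopology (zariski N) V) (L \<inter> V)"
  unfolding irreducible_closed_def
proof (intro conjI allI impI)
  show "closedin (subtopology (zariski N) V) (L \<inter> V)"
    using L by (auto simp: closedin_subtopology)
  show "L \<inter> V \<noteq> {}" using v by blast
  fix Z1 Z2
  assume *: "closedin (subtopology (zariski N) V) Z1 \<and> closedin (subtopology (zariski N) V) Z2 \<and>
    L \<inter> V \<subseteq> Z1 \<union> Z2"
  have tops: "topspace (subtopology (zariski N) V) = V"
    using openin_subset[OF V] by auto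
  have op: "openin (zariski N) (V - Z)" if "closedin (subtopology (zariski N) V) Z" for Z
    using openin_trans_full[OF openin_diff[OF openin_topspace that] V] tops by simp
  show "L \<inter> V \<subseteq> Z1 \<or> L \<inter> V \<subseteq> Z2"
  proof (rule ccontr)
    assume "\<not> (L \<inter> V \<subseteq> Z1 \<or> L \<inter> V \<subseteq> Z2)"
    then obtain x y where x: "x \<in> L" "x \<in> V - Z1" and y: "y \<in> L" "y \<in> V - Z2" by blast
    have len: "length x = N" "length y = N" using x y openin_subset[OF V] by auto
    obtain f where f: "poly_fun N f" "f x \<noteq> 0"
      "\<And>x. length x = N \<Longrightarrow> f x \<noteq> 0 \<Longrightarrow> x \<in> V - Z1"
      using openin_zariski_nbhd[OF op x(2)] * by blast
    obtain g where g: "poly_fun N g" "g y \<noteq> 0"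
      "\<And>x. length x = N \<Longrightarrow> g x \<noteq> 0 \<Longrightarrow> x \<in> V - Z2"
      using openin_zariski_nbhd[OF op y(2)] * by blast
    obtain s where s: "f (line_point x y s) \<noteq> 0" "g (line_point x y s) \<noteq> 0"
      using poly_fun_line_common_nonzero[OF inf f(1,2) g(1,2) len] by blast
    have "line_point x y s \<in> V - Z1" by (rule f(3)) (use s len in auto)
    moreover have "line_point x y s \<in> V - Z2" by (rule g(3)) (use s len in auto)
    moreover have "line_point x y s \<in> L" using x y line by blast
    ultimately show False using * by blast
  qed
qed

lemma closedin_zariski_zero:
  assumes "poly_fun N f"
  shows "closedin (zariski N) {x. length x = N \<and> f x = 0}"
proof -
  have "topspace (zariski N) - {x. length x = N \<and> f x = 0} = {x. length x = N \<and> f x \<noteq> 0}"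
    by auto
  then show ?thesis using openin_zariski_basic[OF assms] unfolding closedin_def by auto
qed

text \<open>The chain consists of the flats through \<open>v\<close> on which the coordinates from
  index \<open>i\<close> on are frozen, for \<open>i\<close> from 0 to \<open>N\<close>, cut with
  \<open>V\<close>.\<close>

lemma krull_dim_open_ge:
  fixes V :: "'a::field list set"
  assumes inf: "infinite (UNIV :: 'a set)" and V: "openin (zariski N) V" "v \<in> V"
  shows "enat N \<le> krull_dim (subtopology (zariski N) V)"
proof -
  define L where "L i = {x. length x = N \<and> (\<forall>j<N. i \<le> j \<longrightarrow> x ! j = v ! j)}" for i
  have lenv: "length v = N" using openin_subset[OF V(1)] V(2) by auto
  have vL: "v \<in> L i" for i using lenv by (auto simp: L_def)
  have cl: "closedin (zariski N) (L i)" for i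
  proof -
    have eq: "L i = topspace (zariski N) \<inter>
        (\<Inter>j\<in>{j. j < N \<and> i \<le> j}. {x. length x = N \<and> x ! j + (- (v ! j)) = 0})"
      by (auto simp: L_def)
    show ?thesis
    proof (cases "{j. j < N \<and> i \<le> j} = {}")
      case True then show ?thesis unfolding eq True using closedin_topspace[of "zariski N"] by simp
    next
      case False
      then show ?thesis unfolding eq
        by (intro closedin_Int closedin_topspace closedin_INT closedin_zariski_zero
            poly_fun_add poly_fun_nth poly_fun_const) auto
    qed
  qed
  have irr: "irreducible_closed (subtopology (zariski N) V) (L i \<inter> V)" for i
  proof (rule irreducible_closed_flat[OF inf V(1) cl])
    show "v \<in> L i \<inter> V" using vL V(2) by simp
  next
    fix x y :: "'a list" and s assume "x \<in> L i" "y \<in> L i"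
    then show "line_point x y s \<in> L i" by (auto simp: L_def nth_line_point)
  qed
  have strict: "L i \<inter> V \<subset> L (Suc i) \<inter> V" if i: "i < N" for i
  proof -
    \<comment> \<open>The line from \<open>v\<close> in direction \<open>i\<close> leaves
      \<open>L i\<close> as soon as \<open>s \<noteq> 0\<close>, and a generic \<open>s\<close>
      keeps the point in \<open>V\<close>.\<close>
    define u where "u = v[i := v ! i + 1]"
    have lenu: "length u = N" by (simp add: u_def lenv)
    obtain h where h: "poly_fun N h" "h v \<noteq> 0" "\<And>x. length x = N \<Longrightarrow> h x \<noteq> 0 \<Longrightarrow> x \<in> V"
      using openin_zariski_nbhd[OF V] by blast
    obtain s where s: "h (line_point v u s) \<noteq> 0" "s \<noteq> 0"
      by (rule poly_fun_line_common_nonzero[OF inf h(1,2) poly_fun_const[of N 1] _ lenv lenu]) auto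
    define w where "w = line_point v u s"
    have w: "length w = N" "\<And>j. j < N \<Longrightarrow> w ! j = (if j = i then v ! i + s else v ! j)"
      using lenv lenu i by (auto simp: w_def nth_line_point u_def)
    have "w \<in> V" using h(3) s w by (simp add: w_def)
    moreover have "w \<in> L (Suc i)" "w \<notin> L i" using w i s by (auto simp: L_def)
    moreover have "L i \<subseteq> L (Suc i)" by (auto simp: L_def)
    ultimately show ?thesis by blast
  qed
  show ?thesis unfolding krull_dim_def
    by (rule Sup_upper, rule CollectI, rule exI[of _ N], rule conjI[OF refl],
        rule exI[of _ "\<lambda>i. L i \<inter> V"]) (use irr strict in auto)
qed

text \<open>Gaussian elimination by induction on the equations: a pivot \<open>M k j\<close> removes
  unknown \<open>k\<close> from the other equations, and \<open>t\<close> recovers it from equation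
  \<open>j\<close>.\<close>

lemma homogeneous_system_nontrivial_solution:
  fixes M :: "'i \<Rightarrow> 'j \<Rightarrow> 'a::field"
  assumes "finite J" "finite I" "card J < card I"
  shows "\<exists>c. (\<exists>i\<in>I. c i \<noteq> 0) \<and> (\<forall>j\<in>J. (\<Sum>i\<in>I. c i * M i j) = 0)"
  using assms
proof (induction J arbitrary: I M rule: finite_induct)
  case empty
  then obtain i where "i \<in> I" by fastforce
  then show ?case by (intro exI[of _ "\<lambda>_. 1"]) auto
next
  case (insert j J)
  show ?case
  proof (cases "\<forall>i\<in>I. M i j = 0")
    case True
    have "card J < card I" using insert by simp
    then obtain c where "\<exists>i\<in>I. c i \<noteq> 0" "\<forall>j\<in>J. (\<Sum>i\<in>I. c i * M i j) = 0"
      using insert.IH[OF insert.prems(1)] by blast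
    then show ?thesis using True by (intro exI[of _ c]) auto
  next
    case False
    then obtain k where k: "k \<in> I" "M k j \<noteq> 0" by blast
    define M' where "M' i l = M i l - M i j / M k j * M k l" for i l
    have "card J < card (I - {k})" using insert k by simp
    then obtain c where c: "\<exists>i\<in>I - {k}. c i \<noteq> 0" "\<forall>l\<in>J. (\<Sum>i\<in>I - {k}. c i * M' i l) = 0"
      using insert.IH[of "I - {k}" M'] insert.prems by blast
    define t where "t = - (\<Sum>i\<in>I - {k}. c i * (M i j / M k j))"
    define c' where "c' i = (if i = k then t else c i)" for i
    have sum: "(\<Sum>i\<in>I. c' i * M i l) = (\<Sum>i\<in>I - {k}. c i * M' i l)" for l
    proof -
      have "(\<Sum>i\<in>I. c' i * M i l) = t * M k l + (\<Sum>i\<in>I - {k}. c i * M i l)"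
        using insert.prems k
        by (subst sum.remove[of I k]) (auto simp: c'_def intro!: sum.cong)
      also have "t * M k l = - (\<Sum>i\<in>I - {k}. c i * (M i j / M k j * M k l))"
        by (simp add: t_def sum_distrib_right mult.assoc)
      finally show ?thesis
        by (simp add: M'_def right_diff_distrib sum_subtractf)
    qed
    have "M' i j = 0" for i using k by (simp add: M'_def)
    then show ?thesis
      by (intro exI[of _ c'] conjI) (use c sum in \<open>auto simp: c'_def\<close>)
  qed
qed

text \<open>The vanishing ideal of an irreducible closed set is prime, since the zero sets of
  \<open>f\<close> and \<open>g\<close> are closed and together cover \<open>Z\<close>.\<close>

lemma irreducible_closed_mult_zero:
  fixes f g :: "'a::field list \<Rightarrow> 'a"
  assumes Z: "irreducible_closed (subtopology (zariski N) V) Z"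
    and f: "poly_fun N f" and g: "poly_fun N g" and "\<And>z. z \<in> Z \<Longrightarrow> f z * g z = 0"
  shows "(\<forall>z\<in>Z. f z = 0) \<or> (\<forall>z\<in>Z. g z = 0)"
proof -
  have sub: "Z \<subseteq> {x. length x = N} \<inter> V"
    using Z closedin_subset unfolding irreducible_closed_def by fastforce
  define A where "A h = {x. length x = N \<and> h x = 0} \<inter> V" for h :: "'a list \<Rightarrow> 'a"
  have "closedin (subtopology (zariski N) V) (A h)" if "poly_fun N h" for h
    using closedin_zariski_zero[OF that] by (auto simp: A_def closedin_subtopology)
  then have "closedin (subtopology (zariski N) V) (A f)" "closedin (subtopology (zariski N) V) (A g)"
    using f g by auto
  moreover have "Z \<subseteq> A f \<union> A g" using assms(4) sub by (fastforce simp: A_def)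
  ultimately have "Z \<subseteq> A f \<or> Z \<subseteq> A g" using Z unfolding irreducible_closed_def by blast
  then show ?thesis by (auto simp: A_def)
qed

lemma exps_SucD:
  "\<beta> \<in> exps (Suc k) s \<Longrightarrow> \<beta> \<noteq> [] \<and> butlast \<beta> \<in> exps k s \<and> last \<beta> \<le> s"
  by (cases \<beta> rule: rev_cases) (auto simp: exps_def)

text \<open>Splits off the exponent of the last function, so that a relation becomes a polynomial in
  that function with coefficients in the earlier ones.\<close>

lemma exps_Suc_sum:
  "(\<Sum>\<alpha>\<in>exps (Suc k) s. F \<alpha>) = (\<Sum>j\<le>s. \<Sum>\<alpha>\<in>exps k s. F (\<alpha> @ [j]))"
proof -
  have "bij_betw (\<lambda>(j, \<alpha>). \<alpha> @ [j]) ({..s} \<times> exps k s) (exps (Suc k) s)"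
  proof (rule bij_betwI')
    fix \<beta> assume "\<beta> \<in> exps (Suc k) s"
    then have "\<beta> \<noteq> []" "butlast \<beta> \<in> exps k s" "last \<beta> \<le> s"
      by (auto dest: exps_SucD)
    then show "\<exists>x\<in>{..s} \<times> exps k s. \<beta> = (case x of (j, \<alpha>) \<Rightarrow> \<alpha> @ [j])"
      by (intro bexI[of _ "(last \<beta>, butlast \<beta>)"]) auto
  qed (auto simp: exps_def)
  from sum.reindex_bij_betw[OF this, of F] show ?thesis
    by (simp add: sum.cartesian_product split_def)
qed

text \<open>Factor the lowest power of \<open>f k\<close> out of a relation on \<open>Z (Suc k)\<close>; irreducibility
  cancels it, and restricting to \<open>Z k\<close>, where \<open>f k\<close> vanishes, leaves a relation among the
  earlier functions.\<close>

lemma chain_power_products_independent: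
  fixes f :: "nat \<Rightarrow> 'a::field list \<Rightarrow> 'a"
  assumes irr: "\<And>i. i \<le> k \<Longrightarrow> irreducible_closed (subtopology (zariski N) V) (Z i)"
    and sub: "\<And>i. i < k \<Longrightarrow> Z i \<subseteq> Z (Suc i)"
    and f: "\<And>i. i < k \<Longrightarrow> poly_fun N (f i)"
    and f0: "\<And>i z. i < k \<Longrightarrow> z \<in> Z i \<Longrightarrow> f i z = 0"
    and f1: "\<And>i. i < k \<Longrightarrow> \<exists>z\<in>Z (Suc i). f i z \<noteq> 0"
    and c: "\<And>z. z \<in> Z k \<Longrightarrow> (\<Sum>\<alpha>\<in>exps k s. c \<alpha> * (\<Prod>i<k. f i z ^ (\<alpha> ! i))) = 0"
  shows "\<forall>\<alpha>\<in>exps k s. c \<alpha> = 0"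
  using assms
proof (induction k arbitrary: c)
  case 0
  have "exps 0 s = {[]}" by (auto simp: exps_def)
  moreover have "Z 0 \<noteq> {}" using 0(1)[of 0] by (simp add: irreducible_closed_def)
  ultimately show ?case using 0(6) by auto
next
  case (Suc k)
  define g where "g j z = (\<Sum>\<alpha>\<in>exps k s. c (\<alpha> @ [j]) * (\<Prod>i<k. f i z ^ (\<alpha> ! i)))" for j z
  have g: "poly_fun N (g j)" for j
  proof -
    have "poly_fun N (\<lambda>z. f i z ^ n)" if "i < k" for i n
      using poly_fun_deg_power Suc.prems(3)[of i] that unfolding poly_fun_iff_deg by fastforce
    then show ?thesis unfolding g_def
      by (intro poly_fun_sum poly_fun_mult poly_fun_const poly_fun_prod) auto
  qed
  have fk: "poly_fun N (\<lambda>z. f k z ^ n)" for n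
    using poly_fun_deg_power Suc.prems(3)[of k] unfolding poly_fun_iff_deg by fastforce
  have rel: "(\<Sum>j\<le>s. f k z ^ j * g j z) = 0" if "z \<in> Z (Suc k)" for z
  proof -
    have "(\<Sum>\<alpha>\<in>exps (Suc k) s. c \<alpha> * (\<Prod>i<Suc k. f i z ^ (\<alpha> ! i))) =
      (\<Sum>j\<le>s. \<Sum>\<alpha>\<in>exps k s. c (\<alpha> @ [j]) * ((\<Prod>i<k. f i z ^ (\<alpha> ! i)) * f k z ^ j))"
      unfolding exps_Suc_sum by (intro sum.cong refl) (auto simp: exps_def nth_append intro!: prod.cong)
    also have "\<dots> = (\<Sum>j\<le>s. f k z ^ j * g j z)"
      unfolding g_def sum_distrib_left by (intro sum.cong refl) (simp add: mult_ac)
    finally show ?thesis using Suc.prems(6)[OF that] by simp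
  qed
  have zero: "\<forall>\<alpha>\<in>exps k s. c (\<alpha> @ [j]) = 0" if "j \<le> s" for j
    using that
  proof (induction j rule: less_induct)
    case (less j)
    have g0: "g l z = 0" if "l < j" for l z using less that by (simp add: g_def)
    define H where "H z = (\<Sum>l\<in>{j..s}. f k z ^ (l - j) * g l z)" for z
    have "f k z ^ j * H z = 0" if "z \<in> Z (Suc k)" for z
    proof -
      have "(\<Sum>l\<le>s. f k z ^ l * g l z) = (\<Sum>l\<in>{j..s}. f k z ^ l * g l z)"
        by (rule sum.mono_neutral_right) (auto simp: g0 not_le)
      also have "\<dots> = f k z ^ j * H z"
        unfolding H_def sum_distrib_left
        by (intro sum.cong refl) (simp add: mult.assoc[symmetric] power_add[symmetric])
      finally show ?thesis using rel[OF that] by simp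
    qed
    moreover have "poly_fun N H" unfolding H_def by (intro poly_fun_sum poly_fun_mult fk g)
    ultimately have "(\<forall>z\<in>Z (Suc k). f k z ^ j = 0) \<or> (\<forall>z\<in>Z (Suc k). H z = 0)"
      using irreducible_closed_mult_zero[OF Suc.prems(1)[of "Suc k"] fk] by blast
    moreover have "\<not> (\<forall>z\<in>Z (Suc k). f k z ^ j = 0)" using Suc.prems(5)[of k] by auto
    ultimately have H0: "H z = 0" if "z \<in> Z k" for z
      using Suc.prems(2)[of k] that by blast
    have "H z = g j z" if "z \<in> Z k" for z
    proof -
      have "f k z = 0" using Suc.prems(4) that by simp
      then have "H z = (\<Sum>l\<in>{j..s}. if l = j then g l z else 0)"
        unfolding H_def by (intro sum.cong refl) (simp add: power_0_left)
      then show ?thesis using less.prems by simp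
    qed
    then have "g j z = 0" if "z \<in> Z k" for z using H0 that by simp
    then show ?case unfolding g_def
      by (intro Suc.IH[of "\<lambda>\<alpha>. c (\<alpha> @ [j])"]) (use Suc.prems in auto)
  qed
  show ?case
  proof
    fix \<beta> assume "\<beta> \<in> exps (Suc k) s"
    then have "\<beta> \<noteq> []" "butlast \<beta> \<in> exps k s" "last \<beta> \<le> s"
      by (auto dest: exps_SucD)
    then show "c \<beta> = 0" using zero[of "last \<beta>"] by force
  qed
qed

text \<open>If \<open>f i\<close> vanishes on \<open>Z i\<close> but not on \<open>Z (Suc i)\<close>, the \<open>(s + 1) ^ n\<close> power products
  with exponents at most \<open>s\<close> are independent, but they lie in a space of dimension at most
  \<open>(n * (s * D) + 1) ^ N\<close>.\<close>

lemma chain_length_le: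
  fixes Z :: "nat \<Rightarrow> 'a::field list set"
  assumes irr: "\<And>i. i \<le> n \<Longrightarrow> irreducible_closed (subtopology (zariski N) V) (Z i)"
    and strict: "\<And>i. i < n \<Longrightarrow> Z i \<subset> Z (Suc i)"
  shows "n \<le> N"
proof -
  \<comment> \<open>A basic neighbourhood of a point of \<open>Z (Suc i)\<close> that misses the
    closed set \<open>T\<close> is given by a function vanishing on \<open>Z i\<close> but not at
    that point.\<close>
  have "\<exists>f. poly_fun N f \<and> (\<forall>z\<in>Z i. f z = 0) \<and> (\<exists>z\<in>Z (Suc i). f z \<noteq> 0)" if i: "i < n" for i
  proof -
    obtain z where z: "z \<in> Z (Suc i)" "z \<notin> Z i" using strict i by blast
    have cl: "closedin (subtopology (zariski N) V) (Z j)" if "j \<le> n" for j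
      using irr that by (simp add: irreducible_closed_def)
    obtain T where T: "closedin (zariski N) T" "Z i = T \<inter> V"
      using cl[of i] i unfolding closedin_subtopology by auto
    have zT: "z \<in> topspace (zariski N) - T"
      using closedin_subset[OF cl[of "Suc i"]] z T i by auto
    obtain h where h: "poly_fun N h" "h z \<noteq> 0"
      "\<And>x. length x = N \<Longrightarrow> h x \<noteq> 0 \<Longrightarrow> x \<in> topspace (zariski N) - T"
      using openin_zariski_nbhd[OF openin_diff[OF openin_topspace T(1)] zT] by blast
    have "h x = 0" if "x \<in> Z i" for x
      using h(3)[of x] that T closedin_subset[OF T(1)] by auto
    then show ?thesis using h z by (intro exI[of _ h] conjI) auto
  qed
  then obtain f where f: "\<And>i. i < n \<Longrightarrow> poly_fun N (f i)"
    "\<And>i z. i < n \<Longrightarrow> z \<in> Z i \<Longrightarrow> f i z = 0" "\<And>i. i < n \<Longrightarrow> \<exists>z\<in>Z (Suc i). f i z \<noteq> 0"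
    by metis
  have "\<forall>i\<in>{..<n}. \<exists>D. poly_fun_deg N D (f i)" using f(1) poly_fun_iff_deg by blast
  then obtain D0 where D0: "\<And>i. i < n \<Longrightarrow> poly_fun_deg N (D0 i) (f i)"
    by (metis lessThan_iff)
  define D where "D = (\<Sum>i<n. D0 i)"
  have D: "poly_fun_deg N D (f i)" if "i < n" for i
    by (rule poly_fun_deg_mono[OF D0[OF that]]) (use that in \<open>auto simp: D_def intro: member_le_sum\<close>)
  have bound: "(s + 1) ^ n \<le> (n * (s * D) + 1) ^ N" for s
  proof (rule ccontr)
    assume "\<not> ?thesis"
    then have card: "card (exps N (n * (s * D))) < card (exps n s)" by (simp add: card_exps)
    have "poly_fun_deg N (n * (s * D)) (\<lambda>z. \<Prod>i<n. f i z ^ (\<alpha> ! i))" if "\<alpha> \<in> exps n s" for \<alpha>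
    proof (rule poly_fun_deg_prod)
      fix i assume i: "i < n"
      then have "\<alpha> ! i * D \<le> s * D" using that by (simp add: exps_iff)
      then show "poly_fun_deg N (s * D) (\<lambda>z. f i z ^ (\<alpha> ! i))"
        using poly_fun_deg_mono poly_fun_deg_power D i by metis
    qed
    then obtain M where M: "\<And>\<alpha> x. \<alpha> \<in> exps n s \<Longrightarrow> length x = N \<Longrightarrow>
        (\<Prod>i<n. f i x ^ (\<alpha> ! i)) = (\<Sum>m\<in>exps N (n * (s * D)). M \<alpha> m * power_prod x m)"
      unfolding poly_fun_deg_def by metis
    \<comment> \<open>With more power products than monomials to express them, their coefficient
      vectors are linearly dependent, against the independence along the chain.\<close>
    obtain c where c: "\<exists>\<alpha>\<in>exps n s. c \<alpha> \<noteq> 0"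
      "\<forall>m\<in>exps N (n * (s * D)). (\<Sum>\<alpha>\<in>exps n s. c \<alpha> * M \<alpha> m) = 0"
      using homogeneous_system_nontrivial_solution[OF finite_exps finite_exps card] by blast
    have "\<forall>\<alpha>\<in>exps n s. c \<alpha> = 0"
    proof (rule chain_power_products_independent[where k = n and Z = Z and f = f and N = N and V = V])
      fix z assume "z \<in> Z n"
      then have z: "length z = N"
        using irr[of n] closedin_subset unfolding irreducible_closed_def by fastforce
      have "(\<Sum>\<alpha>\<in>exps n s. c \<alpha> * (\<Prod>i<n. f i z ^ (\<alpha> ! i))) =
          (\<Sum>\<alpha>\<in>exps n s. \<Sum>m\<in>exps N (n * (s * D)). c \<alpha> * M \<alpha> m * power_prod z m)"
        using M z by (simp add: sum_distrib_left mult.assoc)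
      also have "\<dots> = (\<Sum>m\<in>exps N (n * (s * D)). (\<Sum>\<alpha>\<in>exps n s. c \<alpha> * M \<alpha> m) * power_prod z m)"
        by (subst sum.swap) (simp add: sum_distrib_right)
      also have "\<dots> = 0" using c(2) by simp
      finally show "(\<Sum>\<alpha>\<in>exps n s. c \<alpha> * (\<Prod>i<n. f i z ^ (\<alpha> ! i))) = 0" .
    qed (use strict irr f in blast)+
    then show False using c(1) by blast
  qed
  show ?thesis
  proof (rule ccontr)
    assume "\<not> n \<le> N"
    then have n: "Suc N \<le> n" by simp
    define K where "K = n * D + 1"
    \<comment> \<open>For \<open>n > N\<close> the bound forces \<open>s + 1 \<le> K ^ N\<close>
      after cancelling \<open>(s + 1) ^ N\<close>; this value of \<open>s\<close> violates
      it.\<close>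
    define s where "s = K ^ N"
    have "(s + 1) ^ Suc N \<le> (s + 1) ^ n" using n by (intro power_increasing) auto
    also have "\<dots> \<le> (n * (s * D) + 1) ^ N" by (rule bound)
    also have "\<dots> \<le> (K * (s + 1)) ^ N" by (rule power_mono) (auto simp: K_def algebra_simps)
    also have "\<dots> = K ^ N * (s + 1) ^ N" by (rule power_mult_distrib)
    finally have "(s + 1) * (s + 1) ^ N \<le> K ^ N * (s + 1) ^ N" by simp
    then have "s + 1 \<le> K ^ N" by (subst (asm) mult_le_cancel2) simp
    then show False by (simp add: s_def)
  qed
qed

lemma krull_dim_open:
  fixes V :: "'a::field list set"
  assumes "infinite (UNIV :: 'a set)" "openin (zariski N) V" "v \<in> V"
  shows "krull_dim (subtopology (zariski N) V) = enat N"
proof (rule antisym)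
  show "krull_dim (subtopology (zariski N) V) \<le> enat N"
    unfolding krull_dim_def
  proof (rule Sup_least, clarify)
    fix n Z assume Z: "\<forall>i\<le>n. irreducible_closed (subtopology (zariski N) V) (Z i)"
      "\<forall>i<n. Z i \<subset> Z (Suc i)"
    have "n \<le> N" by (rule chain_length_le[of n N V Z]) (use Z in blast)+
    then show "enat n \<le> enat N" by simp
  qed
qed (rule krull_dim_open_ge[OF assms])

section \<open>Topological invariance of the dimension, and orbit spaces\<close>

lemma irreducible_closed_homeomorphic_image:
  assumes FG: "homeomorphic_maps X Y F G" and Z: "irreducible_closed X Z"
  shows "irreducible_closed Y (F ` Z)"
  unfolding irreducible_closed_def
proof (intro conjI allI impI)
  have F: "homeomorphic_map X Y F" using FG homeomorphic_map_maps by blast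
  have cl: "closedin X Z" and ne: "Z \<noteq> {}" using Z by (auto simp: irreducible_closed_def)
  show "closedin Y (F ` Z)"
    using homeomorphic_imp_closed_map[OF F] cl by (simp add: closed_map_def)
  show "F ` Z \<noteq> {}" using ne by simp
  fix Z1 Z2 assume *: "closedin Y Z1 \<and> closedin Y Z2 \<and> F ` Z \<subseteq> Z1 \<union> Z2"
  have cont: "continuous_map X Y F" using FG by (simp add: homeomorphic_maps_def)
  have "closedin X {x \<in> topspace X. F x \<in> Z1}" "closedin X {x \<in> topspace X. F x \<in> Z2}"
    using * closedin_continuous_map_preimage[OF cont] by auto
  moreover have "Z \<subseteq> {x \<in> topspace X. F x \<in> Z1} \<union> {x \<in> topspace X. F x \<in> Z2}"
    using * closedin_subset[OF cl] by blast
  ultimately have "Z \<subseteq> {x \<in> topspace X. F x \<in> Z1} \<or> Z \<subseteq> {x \<in> topspace X. F x \<in> Z2}"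
    using Z unfolding irreducible_closed_def by blast
  then show "F ` Z \<subseteq> Z1 \<or> F ` Z \<subseteq> Z2" by blast
qed

lemma krull_dim_le_homeomorphic:
  assumes "homeomorphic_maps X Y F G" shows "krull_dim X \<le> krull_dim Y"
  unfolding krull_dim_def
proof (rule Sup_mono, clarify)
  fix n Z assume Z: "\<forall>i\<le>n. irreducible_closed X (Z i)" "\<forall>i<n. Z i \<subset> Z (Suc i)"
  have inj: "inj_on F (topspace X)"
    using assms unfolding homeomorphic_maps_def by (metis inj_on_inverseI)
  have sub: "Z i \<subseteq> topspace X" if "i \<le> n" for i
    using Z(1) that closedin_subset unfolding irreducible_closed_def by blast
  have "F ` Z i \<subset> F ` Z (Suc i)" if "i < n" for i
    using Z(2) that sub[of i] sub[of "Suc i"] inj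
    by (intro psubsetI) (auto simp: inj_on_image_eq_iff)
  then show "\<exists>a\<in>{enat n |n. \<exists>Z. (\<forall>i\<le>n. irreducible_closed Y (Z i)) \<and> (\<forall>i<n. Z i \<subset> Z (Suc i))}.
      enat n \<le> a"
    using Z(1) irreducible_closed_homeomorphic_image[OF assms]
    by (intro bexI[of _ "enat n"] CollectI exI[of _ n] conjI exI[of _ "\<lambda>i. F ` Z i"]) auto
qed

lemma krull_dim_homeomorphic_space:
  assumes "X homeomorphic_space Y" shows "krull_dim X = krull_dim Y"
proof -
  obtain F G where "homeomorphic_maps X Y F G" using assms unfolding homeomorphic_space_def by blast
  then show ?thesis
    using krull_dim_le_homeomorphic homeomorphic_maps_sym by (metis antisym)
qed

text \<open>A continuous map with a continuous section is a quotient map. As the fibres of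
  \<open>g\<close> are the \<open>R\<close>-classes, sending \<open>y\<close> to its fibre
  identifies \<open>Y\<close> with the orbit space.\<close>

lemma orbit_space_homeomorphic:
  fixes f :: "'b \<Rightarrow> 'a" and g :: "'a \<Rightarrow> 'b"
  assumes g: "continuous_map X Y g" and f: "continuous_map Y X f"
    and gf: "\<And>y. y \<in> topspace Y \<Longrightarrow> g (f y) = y"
    and R: "\<And>x x'. x \<in> topspace X \<Longrightarrow> x' \<in> topspace X \<Longrightarrow> R x x' \<longleftrightarrow> g x = g x'"
  shows "Y homeomorphic_space orbit_space X R"
proof -
  define F where "F y = {x \<in> topspace X. g x = y}" for y
  have gY: "g x \<in> topspace Y" if "x \<in> topspace X" for x
    using g that by (auto simp: continuous_map_def)
  have fX: "f y \<in> topspace X" if "y \<in> topspace Y" for y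
    using f that by (auto simp: continuous_map_def)
  have cls: "{y \<in> topspace X. R x y} = F (g x)" if "x \<in> topspace X" for x
    using R that by (auto simp: F_def)
  have classes: "{{y \<in> topspace X. R x y} |x. x \<in> topspace X} = F ` topspace Y"
  proof (intro equalityI subsetI)
    fix c assume "c \<in> {{y \<in> topspace X. R x y} |x. x \<in> topspace X}"
    then show "c \<in> F ` topspace Y" using cls gY by auto
  next
    fix c assume "c \<in> F ` topspace Y"
    then obtain y where y: "y \<in> topspace Y" "c = F y" by blast
    then have "c = {x \<in> topspace X. R (f y) x}" using cls[OF fX] gf by simp
    then show "c \<in> {{y \<in> topspace X. R x y} |x. x \<in> topspace X}" using fX y by blast
  qed
  \<comment> \<open>Distinct fibres are disjoint, so taking unions commutes with intersecting
    families of classes; this makes the prescribed open sets a topology.\<close>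
  have disj: "\<Union>(S \<inter> T) = \<Union>S \<inter> \<Union>T" if "S \<subseteq> F ` topspace Y" "T \<subseteq> F ` topspace Y" for S T
  proof (intro equalityI subsetI)
    fix x assume "x \<in> \<Union>S \<inter> \<Union>T"
    then obtain s t where st: "s \<in> S" "t \<in> T" "x \<in> s" "x \<in> t" by blast
    then have "s = F (g x)" "t = F (g x)" using that by (auto simp: F_def)
    then show "x \<in> \<Union>(S \<inter> T)" using st by blast
  qed blast
  have op: "openin (orbit_space X R) W \<longleftrightarrow> W \<subseteq> F ` topspace Y \<and> openin X (\<Union>W)" for W
    unfolding orbit_space_def classes
  proof (subst topology_inverse')
    show "istopology (\<lambda>W. W \<subseteq> F ` topspace Y \<and> openin X (\<Union>W))"
      unfolding istopology_def
    proof (intro conjI allI impI)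
      fix S T assume "S \<subseteq> F ` topspace Y \<and> openin X (\<Union>S)" "T \<subseteq> F ` topspace Y \<and> openin X (\<Union>T)"
      then show "openin X (\<Union>(S \<inter> T))" using disj[of S T] by (simp add: openin_Int)
    next
      fix K assume K: "\<forall>S\<in>K. S \<subseteq> F ` topspace Y \<and> openin X (\<Union>S)"
      have "\<Union>(\<Union>K) = \<Union>(Union ` K)" by blast
      then show "openin X (\<Union>(\<Union>K))" using K by (metis (mono_tags, lifting) imageE openin_Union)
    qed blast+
  qed simp
  have FX: "\<Union>(F ` topspace Y) = topspace X" using gY by (auto simp: F_def)
  have tops: "topspace (orbit_space X R) = F ` topspace Y"
    using op FX unfolding topspace_def[of "orbit_space X R"] by (auto intro!: exI[of _ "F ` topspace Y"])
  have "quotient_map Y (orbit_space X R) F"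
    unfolding quotient_map_def
  proof (intro conjI allI impI)
    show "F ` topspace Y = topspace (orbit_space X R)" using tops by simp
    fix U assume U: "U \<subseteq> topspace (orbit_space X R)"
    \<comment> \<open>The section \<open>f\<close> transports openness from the orbit space to
      \<open>Y\<close> through \<open>1\<close>, and \<open>g\<close> transports it back through
      \<open>2\<close>.\<close>
    have 1: "{y \<in> topspace Y. F y \<in> U} = {y \<in> topspace Y. f y \<in> \<Union>U}"
    proof (intro equalityI subsetI)
      fix y assume "y \<in> {y \<in> topspace Y. F y \<in> U}"
      moreover from this have "f y \<in> F y" using fX gf by (simp add: F_def)
      ultimately show "y \<in> {y \<in> topspace Y. f y \<in> \<Union>U}" by blast
    next
      fix y assume "y \<in> {y \<in> topspace Y. f y \<in> \<Union>U}"
      then obtain W where W: "y \<in> topspace Y" "W \<in> U" "f y \<in> W" by blast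
      then obtain y' where "W = F y'" using U tops by auto
      then have "W = F y" using W gf by (auto simp: F_def)
      then show "y \<in> {y \<in> topspace Y. F y \<in> U}" using W by simp
    qed
    have 2: "\<Union>U = {x \<in> topspace X. g x \<in> {y \<in> topspace Y. F y \<in> U}}"
      using U gY unfolding tops by (auto simp: F_def)
    show "openin Y {x \<in> topspace Y. F x \<in> U} = openin (orbit_space X R) U"
    proof
      assume "openin Y {x \<in> topspace Y. F x \<in> U}"
      then have "openin X (\<Union>U)"
        unfolding 2 by (rule openin_continuous_map_preimage[OF g])
      then show "openin (orbit_space X R) U" using op U tops by simp
    next
      assume "openin (orbit_space X R) U"
      then show "openin Y {x \<in> topspace Y. F x \<in> U}"
        unfolding 1 using openin_continuous_map_preimage[OF f] op by blast
    qed
  qed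
  moreover have "inj_on F (topspace Y)"
    by (rule inj_onI) (use fX gf in \<open>force simp: F_def\<close>)
  ultimately have "homeomorphic_map Y (orbit_space X R) F"
    by (simp add: homeomorphic_map_def)
  then show ?thesis using homeomorphic_map_imp_homeomorphic_space by blast
qed

section \<open>Linear systems and coefficient lists\<close>

hide_const (open) Module.smult Determinants.det

lemma rat_fun_det:
  assumes "\<And>i j. i < n \<Longrightarrow> j < n \<Longrightarrow> rat_fun N S (E i j)"
  shows "rat_fun N S (\<lambda>v. det (mat n n (\<lambda>(i, j). E i j v)))"
proof -
  have "rat_fun N S (\<lambda>v. \<Sum>p\<in>{p. p permutes {0..<n}}. signof p * (\<Prod>i=0..<n. E i (p i) v))"
    by (intro rat_fun_sum rat_fun_mult rat_fun_const rat_fun_prod assms)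
       (auto dest: permutes_in_image)
  then show ?thesis
  proof (rule rat_fun_cong)
    fix v
    have "p i < n" if "p permutes {0..<n}" "i < n" for p i
      using permutes_in_image[OF that(1), of i] that(2) by simp
    then show "(\<Sum>p\<in>{p. p permutes {0..<n}}. signof p * (\<Prod>i=0..<n. E i (p i) v)) =
        det (mat n n (\<lambda>(i, j). E i j v))"
      by (subst det_def'[of _ n]) (auto intro!: sum.cong prod.cong)
  qed
qed

text \<open>Column \<open>i\<close> lists the coefficients of \<open>P i\<close>, highest degree
  first; this order makes the transposed Sylvester matrix an instance.\<close>

definition coeff_mat :: "nat \<Rightarrow> (nat \<Rightarrow> 'a::field poly) \<Rightarrow> 'a mat" where
  "coeff_mat n P = mat n n (\<lambda>(j, i). coeff (P i) (n - 1 - j))"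

lemma coeff_mat_carrier [simp]: "coeff_mat n P \<in> carrier_mat n n"
  by (simp add: coeff_mat_def)

lemma coeff_mat_mult_vec:
  assumes "x \<in> carrier_vec n"
  shows "coeff_mat n P *\<^sub>v x = vec n (\<lambda>j. coeff (\<Sum>i<n. smult (vec_index x i) (P i)) (n - 1 - j))"
proof (rule eq_vecI)
  fix j assume "j < dim_vec (vec n (\<lambda>j. coeff (\<Sum>i<n. smult (vec_index x i) (P i)) (n - 1 - j)))"
  then show "vec_index (coeff_mat n P *\<^sub>v x) j =
      vec_index (vec n (\<lambda>j. coeff (\<Sum>i<n. smult (vec_index x i) (P i)) (n - 1 - j))) j"
    using assms by (auto simp: coeff_mat_def scalar_prod_def coeff_sum mult.commute
      atLeast0LessThan intro!: sum.cong)
qed (simp add: coeff_mat_def)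

text \<open>By the degree hypothesis \<open>n\<close> coefficients determine each polynomial, so a
  kernel vector of the matrix is the same as a linear relation among the \<open>P i\<close>.\<close>

lemma det_coeff_mat_nonzero_iff:
  assumes deg: "\<And>i k. i < n \<Longrightarrow> n \<le> k \<Longrightarrow> coeff (P i) k = 0"
  shows "det (coeff_mat n P) \<noteq> 0 \<longleftrightarrow>
    (\<forall>a. (\<Sum>i<n. smult (a i) (P i)) = 0 \<longrightarrow> (\<forall>i<n. a i = 0))"
proof -
  have zero: "coeff_mat n P *\<^sub>v x = 0\<^sub>v n \<longleftrightarrow> (\<Sum>i<n. smult (vec_index x i) (P i)) = 0"
    if "x \<in> carrier_vec n" for x
  proof
    assume *: "coeff_mat n P *\<^sub>v x = 0\<^sub>v n"
    show "(\<Sum>i<n. smult (vec_index x i) (P i)) = 0"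
    proof (rule poly_eqI)
      fix k
      show "coeff (\<Sum>i<n. smult (vec_index x i) (P i)) k = coeff 0 k"
      proof (cases "k < n")
        case True
        then have "coeff (\<Sum>i<n. smult (vec_index x i) (P i)) (n - 1 - (n - 1 - k)) = 0"
          using arg_cong[OF *[unfolded coeff_mat_mult_vec[OF that]], of "\<lambda>v. vec_index v (n - 1 - k)"]
          by simp
        then show ?thesis using True by simp
      next
        case False then show ?thesis using deg by (simp add: coeff_sum)
      qed
    qed
  next
    assume "(\<Sum>i<n. smult (vec_index x i) (P i)) = 0"
    then show "coeff_mat n P *\<^sub>v x = 0\<^sub>v n"
      unfolding coeff_mat_mult_vec[OF that] by (auto intro!: eq_vecI)
  qed
  show ?thesis
  proof
    assume *: "det (coeff_mat n P) \<noteq> 0"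
    show "\<forall>a. (\<Sum>i<n. smult (a i) (P i)) = 0 \<longrightarrow> (\<forall>i<n. a i = 0)"
    proof (intro allI impI)
      fix a i assume a: "(\<Sum>i<n. smult (a i) (P i)) = 0" and i: "i < n"
      have "coeff_mat n P *\<^sub>v vec n a = 0\<^sub>v n"
        using zero[of "vec n a"] a by simp
      then have "vec n a = 0\<^sub>v n"
        using * det_0_iff_vec_prod_zero_field[OF coeff_mat_carrier, of n P] vec_carrier[of n a] by metis
      then show "a i = 0" using i by (metis index_vec index_zero_vec(1))
    qed
  next
    assume *: "\<forall>a. (\<Sum>i<n. smult (a i) (P i)) = 0 \<longrightarrow> (\<forall>i<n. a i = 0)"
    show "det (coeff_mat n P) \<noteq> 0"
    proof
      assume "det (coeff_mat n P) = 0"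
      then obtain x where x: "x \<in> carrier_vec n" "x \<noteq> 0\<^sub>v n" "coeff_mat n P *\<^sub>v x = 0\<^sub>v n"
        using det_0_iff_vec_prod_zero_field[OF coeff_mat_carrier] by blast
      then have "\<forall>i<n. vec_index x i = 0" using * zero by blast
      then have "x = 0\<^sub>v n" using x(1) by (intro eq_vecI) auto
      then show False using x(2) by simp
    qed
  qed
qed

lemma rat_fun_det_coeff_mat:
  assumes "\<And>i j. i < n \<Longrightarrow> j < n \<Longrightarrow> rat_fun N S (\<lambda>v. coeff (P v i) j)"
  shows "rat_fun N S (\<lambda>v. det (coeff_mat n (P v)))"
  unfolding coeff_mat_def by (rule rat_fun_det) (use assms in auto)

text \<open>Cramer's rule, with the unknowns as coordinates with respect to a basis of polynomials.\<close>

lemma rat_fun_basis_coordinates: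
  fixes P :: "'a::field list \<Rightarrow> nat \<Rightarrow> 'a poly"
  assumes deg: "\<And>v i k. v \<in> S \<Longrightarrow> i < n \<Longrightarrow> n \<le> k \<Longrightarrow> coeff (P v i) k = 0"
    and P: "\<And>i j. i < n \<Longrightarrow> j < n \<Longrightarrow> rat_fun N S (\<lambda>v. coeff (P v i) j)"
    and Q: "\<And>j. j < n \<Longrightarrow> rat_fun N S (\<lambda>v. coeff (Q v) j)"
    and eq: "\<And>v. v \<in> S \<Longrightarrow> (\<Sum>i<n. smult (c v i) (P v i)) = Q v"
    and indep: "\<And>v a i. v \<in> S \<Longrightarrow> (\<Sum>i<n. smult (a i) (P v i)) = 0 \<Longrightarrow> i < n \<Longrightarrow> a i = 0"
    and k: "k < n"
  shows "rat_fun N S (\<lambda>v. c v k)"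
proof -
  define R where "R v = mat n n (\<lambda>(j, i). if i = k then coeff (Q v) (n - 1 - j)
    else coeff (P v i) (n - 1 - j))" for v
  have det0: "det (coeff_mat n (P v)) \<noteq> 0" if "v \<in> S" for v
    using det_coeff_mat_nonzero_iff[of n "P v"] deg indep that by blast
  have "rat_fun N S (\<lambda>v. det (R v) / det (coeff_mat n (P v)))"
  proof (rule rat_fun_divide)
    have "rat_fun N S (\<lambda>v. if i = k then coeff (Q v) (n - 1 - j) else coeff (P v i) (n - 1 - j))"
      if "i < n" "j < n" for i j using P Q that by (cases "i = k") auto
    then show "rat_fun N S (\<lambda>v. det (R v))" unfolding R_def by (rule rat_fun_det)
    show "rat_fun N S (\<lambda>v. det (coeff_mat n (P v)))" using P by (rule rat_fun_det_coeff_mat)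
  qed (rule det0)
  then show ?thesis
  proof (rule rat_fun_cong)
    fix v assume v: "v \<in> S"
    define x where "x = vec n (c v)"
    have x: "x \<in> carrier_vec n" by (simp add: x_def)
    have "(\<Sum>i<n. smult (vec_index x i) (P v i)) = Q v"
      unfolding eq[OF v, symmetric] by (rule sum.cong) (auto simp: x_def)
    then have "coeff_mat n (P v) *\<^sub>v x = vec n (\<lambda>j. coeff (Q v) (n - 1 - j))"
      unfolding coeff_mat_mult_vec[OF x] by simp
    then have "replace_col (coeff_mat n (P v)) (coeff_mat n (P v) *\<^sub>v x) k = R v"
      unfolding replace_col_def R_def coeff_mat_def by (auto intro!: eq_matI)
    then have "det (R v) = vec_index x k * det (coeff_mat n (P v))"
      using cramer_lemma_mat[OF coeff_mat_carrier x k, of "P v"] by simp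
    then show "det (R v) / det (coeff_mat n (P v)) = c v k"
      using det0[OF v] k by (simp add: x_def)
  qed
qed

lemma openin_rat_fun_nonzero:
  assumes "rat_fun N {x. length x = N} f"
  shows "openin (zariski N) {x. length x = N \<and> f x \<noteq> 0}"
proof -
  obtain p q where pq: "poly_fun N p" "\<forall>x\<in>{x. length x = N}. q x \<noteq> 0 \<and> f x = p x / q x"
    using assms unfolding rat_fun_def by blast
  have "{x. length x = N \<and> f x \<noteq> 0} = {x. length x = N \<and> p x \<noteq> 0}"
    using pq(2) by auto
  then show ?thesis using openin_zariski_basic[OF pq(1)] by simp
qed

section \<open>Coefficient lists, and postcomposition as an action of GL2\<close>

lemma coeff_polyA: "coeff (polyA d v) i = (if i \<le> d then v ! (d - i) else 0)"
  by (simp add: polyA_def coeff_sum coeff_monom)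

lemma coeff_polyB: "coeff (polyB d v) i = (if i \<le> d then v ! (2 * d + 1 - i) else 0)"
  by (simp add: polyB_def coeff_sum coeff_monom)

lemma degree_polyA: "degree (polyA d v) \<le> d"
  by (rule degree_le) (simp add: coeff_polyA)

lemma degree_polyB: "degree (polyB d v) \<le> d"
  by (rule degree_le) (simp add: coeff_polyB)

definition coeff_list :: "nat \<Rightarrow> 'a::field poly \<Rightarrow> 'a poly \<Rightarrow> 'a list" where
  "coeff_list d A B = map (\<lambda>i. coeff A (d - i)) [0..<d + 1] @ map (\<lambda>i. coeff B (d - i)) [0..<d + 1]"

lemma length_coeff_list [simp]: "length (coeff_list d A B) = 2 * d + 2"
  by (simp add: coeff_list_def)

lemma nth_coeff_list:
  "i < 2 * d + 2 \<Longrightarrow>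
    coeff_list d A B ! i = (if i \<le> d then coeff A (d - i) else coeff B (2 * d + 1 - i))"
  by (auto simp: coeff_list_def nth_append simp del: upt_Suc intro!: arg_cong[of _ _ "coeff B"])

lemma polyA_coeff_list [simp]: "degree A \<le> d \<Longrightarrow> polyA d (coeff_list d A B) = A"
  by (rule poly_eqI) (auto simp: coeff_polyA nth_coeff_list coeff_eq_0)

lemma polyB_coeff_list [simp]: "degree B \<le> d \<Longrightarrow> polyB d (coeff_list d A B) = B"
  by (rule poly_eqI) (auto simp: coeff_polyB nth_coeff_list coeff_eq_0)

lemma coeff_list_polyA_polyB:
  "length v = 2 * d + 2 \<Longrightarrow> coeff_list d (polyA d v) (polyB d v) = v"
  by (rule nth_equalityI) (auto simp: nth_coeff_list coeff_polyA coeff_polyB)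

lemma coeff_list_eqI:
  "length v = 2 * d + 2 \<Longrightarrow> length w = 2 * d + 2 \<Longrightarrow> polyA d v = polyA d w \<Longrightarrow>
    polyB d v = polyB d w \<Longrightarrow> v = w"
  using coeff_list_polyA_polyB by metis

lemma length_postcomp: "length v = 2 * d + 2 \<Longrightarrow> length (postcomp d a b c e v) = 2 * d + 2"
  by (simp add: postcomp_def Let_def)

lemma polyA_map_postcomp:
  "length v = 2 * d + 2 \<Longrightarrow> polyA d (map ((*) s) (postcomp d a b c e v)) =
    smult s (smult a (polyA d v) + smult b (polyB d v))"
  by (rule poly_eqI) (auto simp: coeff_polyA coeff_polyB postcomp_def Let_def nth_append Suc_diff_le mult_2)

lemma polyB_map_postcomp:
  "length v = 2 * d + 2 \<Longrightarrow> polyB d (map ((*) s) (postcomp d a b c e v)) =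
    smult s (smult c (polyA d v) + smult e (polyB d v))"
  by (rule poly_eqI) (auto simp: coeff_polyA coeff_polyB postcomp_def Let_def nth_append Suc_diff_le mult_2)

definition gl2_equiv :: "'a::field poly \<times> 'a poly \<Rightarrow> 'a poly \<times> 'a poly \<Rightarrow> bool" where
  "gl2_equiv P Q \<longleftrightarrow> (\<exists>a b c e. a * e - b * c \<noteq> 0 \<and>
     fst Q = smult a (fst P) + smult b (snd P) \<and> snd Q = smult c (fst P) + smult e (snd P))"

text \<open>An invertible matrix is \<open>s\<close> times a matrix of determinant 1, where
  \<open>s\<close> is a square root of its determinant; algebraic closedness supplies
  \<open>s\<close>. Hence scalars and SL2 together act as GL2.\<close>

lemma sl2_proj_equiv_iff:
  fixes v w :: "'a::alg_closed_field list"
  assumes v: "length v = 2 * d + 2" and w: "length w = 2 * d + 2"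
  shows "sl2_proj_equiv d v w \<longleftrightarrow> gl2_equiv (polyA d v, polyB d v) (polyA d w, polyB d w)"
proof
  assume "sl2_proj_equiv d v w"
  then obtain a b c e s where *: "a * e - b * c = 1" "s \<noteq> 0"
    "w = map ((*) s) (postcomp d a b c e v)"
    unfolding sl2_proj_equiv_def by blast
  have "s * a * (s * e) - s * b * (s * c) = s * s * (a * e - b * c)" by (simp add: algebra_simps)
  then have "s * a * (s * e) - s * b * (s * c) \<noteq> 0" using * by simp
  then show "gl2_equiv (polyA d v, polyB d v) (polyA d w, polyB d w)"
    unfolding gl2_equiv_def *(3) polyA_map_postcomp[OF v] polyB_map_postcomp[OF v]
    by (intro exI[of _ "s * a"] exI[of _ "s * b"] exI[of _ "s * c"] exI[of _ "s * e"])
       (simp add: smult_add_right)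
next
  assume "gl2_equiv (polyA d v, polyB d v) (polyA d w, polyB d w)"
  then obtain a b c e where *: "a * e - b * c \<noteq> 0"
    "polyA d w = smult a (polyA d v) + smult b (polyB d v)"
    "polyB d w = smult c (polyA d v) + smult e (polyB d v)"
    unfolding gl2_equiv_def by auto
  obtain s where s: "s ^ 2 = a * e - b * c" using nth_root_exists[of 2 "a * e - b * c"] by auto
  then have s0: "s \<noteq> 0" using *(1) by auto
  have "a / s * (e / s) - b / s * (c / s) = (a * e - b * c) / s ^ 2"
    by (simp add: power2_eq_square diff_divide_distrib)
  then have 1: "a / s * (e / s) - b / s * (c / s) = 1" using s *(1) by simp
  have "w = map ((*) s) (postcomp d (a / s) (b / s) (c / s) (e / s) v)"
    by (rule coeff_list_eqI[OF w])
       (use s0 in \<open>simp_all add: length_postcomp v polyA_map_postcomp polyB_map_postcomp * smult_add_right\<close>)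
  then show "sl2_proj_equiv d v w" unfolding sl2_proj_equiv_def using 1 s0 by blast
qed

lemma gl2_equiv_sym: assumes "gl2_equiv P Q" shows "gl2_equiv Q P"
proof -
  obtain a b c e where *: "a * e - b * c \<noteq> 0" "fst Q = smult a (fst P) + smult b (snd P)"
    "snd Q = smult c (fst P) + smult e (snd P)" using assms unfolding gl2_equiv_def by blast
  define D where "D = a * e - b * c"
  have D: "D \<noteq> 0" using * by (simp add: D_def)
  have "e / D * (a / D) - (- b / D) * (- c / D) = D / (D * D)"
    unfolding D_def by (simp add: divide_simps)
  then have 0: "e / D * (a / D) - (- b / D) * (- c / D) \<noteq> 0" using D by simp
  have "smult D (fst P) = smult e (fst Q) + smult (- b) (snd Q)"
    unfolding * D_def by (simp add: smult_add_right smult_diff_left algebra_simps)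
  then have 1: "fst P = smult (e / D) (fst Q) + smult (- b / D) (snd Q)"
    using D smult_smult[of "inverse D" D "fst P"]
    by (simp add: smult_diff_right divide_inverse mult.commute)
  have "smult D (snd P) = smult (- c) (fst Q) + smult a (snd Q)"
    unfolding * D_def by (simp add: smult_add_right smult_diff_left algebra_simps)
  then have 2: "snd P = smult (- c / D) (fst Q) + smult (a / D) (snd Q)"
    using D smult_smult[of "inverse D" D "snd P"]
    by (simp add: smult_diff_right divide_inverse mult.commute)
  show ?thesis unfolding gl2_equiv_def using 0 1 2 by blast
qed

lemma gl2_equiv_trans: assumes "gl2_equiv P Q" "gl2_equiv Q R" shows "gl2_equiv P R"
proof -
  obtain a b c e where *: "a * e - b * c \<noteq> 0" "fst Q = smult a (fst P) + smult b (snd P)"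
    "snd Q = smult c (fst P) + smult e (snd P)" using assms(1) unfolding gl2_equiv_def by blast
  obtain a' b' c' e' where **: "a' * e' - b' * c' \<noteq> 0" "fst R = smult a' (fst Q) + smult b' (snd Q)"
    "snd R = smult c' (fst Q) + smult e' (snd Q)" using assms(2) unfolding gl2_equiv_def by blast
  have "(a' * a + b' * c) * (c' * b + e' * e) - (a' * b + b' * e) * (c' * a + e' * c) =
      (a' * e' - b' * c') * (a * e - b * c)" by (simp add: algebra_simps)
  then have "(a' * a + b' * c) * (c' * b + e' * e) - (a' * b + b' * e) * (c' * a + e' * c) \<noteq> 0"
    using * ** by simp
  moreover have "fst R = smult (a' * a + b' * c) (fst P) + smult (a' * b + b' * e) (snd P)"
    "snd R = smult (c' * a + e' * c) (fst P) + smult (c' * b + e' * e) (snd P)"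
    unfolding * ** by (simp_all add: smult_add_right smult_add_left algebra_simps)
  ultimately show ?thesis unfolding gl2_equiv_def by blast
qed

text \<open>For \<open>0 < d\<close> this is coprimality of binary forms of degree \<open>d\<close>,
  not just of polynomials: if both degrees are below \<open>d\<close>, the forms share a zero at
  infinity and \<open>(B, - A)\<close>, or \<open>(1, 0)\<close> when \<open>A\<close> and
  \<open>B\<close> vanish, is a syzygy.\<close>

definition no_syzygy :: "nat \<Rightarrow> 'a::field poly \<Rightarrow> 'a poly \<Rightarrow> bool" where
  "no_syzygy d A B \<longleftrightarrow> (\<forall>u w. (\<forall>k\<ge>d. coeff u k = 0) \<longrightarrow> (\<forall>k\<ge>d. coeff w k = 0) \<longrightarrow>
     u * A + w * B = 0 \<longrightarrow> u = 0 \<and> w = 0)"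

lemma sum_monom_reverse:
  fixes u :: "'a::comm_monoid_add poly"
  assumes "\<forall>k\<ge>d. coeff u k = 0"
  shows "(\<Sum>i<d. monom (coeff u (d - 1 - i)) (d - 1 - i)) = u"
proof (rule poly_eqI)
  fix k
  have "(\<Sum>i<d. monom (coeff u (d - 1 - i)) (d - 1 - i)) = (\<Sum>i<d. monom (coeff u i) i)"
    by (subst sum.nat_diff_reindex[symmetric]) simp
  then show "coeff (\<Sum>i<d. monom (coeff u (d - 1 - i)) (d - 1 - i)) k = coeff u k"
    using assms by (simp add: coeff_sum coeff_monom)
qed

lemma sum_lessThan_add: "(\<Sum>i<m + n. f i) = (\<Sum>i<m. f i) + (\<Sum>i<n. f (m + i))"
  for f :: "nat \<Rightarrow> 'a::comm_monoid_add"
  by (induction n) (auto simp: add.assoc)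

text \<open>The Sylvester matrix represents \<open>(u, w) \<mapsto> u * A + w * B\<close> on pairs
  of polynomials of degree below \<open>d\<close>, so its determinant is nonzero exactly when this
  map is injective.\<close>

lemma resultant_sub_nonzero_iff:
  fixes A B :: "'a::field poly"
  assumes A: "degree A \<le> d" and B: "degree B \<le> d" and d: "0 < d"
  shows "resultant_sub d d A B \<noteq> 0 \<longleftrightarrow> no_syzygy d A B"
proof -
  \<comment> \<open>The rows of the Sylvester matrix: shifts of \<open>A\<close>, then of
    \<open>B\<close>, by \<open>d - 1\<close> down to 0. For \<open>i \<ge> d\<close> the shift
    \<open>d - 1 - (i - d)\<close> is written \<open>2 * d - 1 - i\<close>.\<close>
  define P where "P i = (if i < d then monom 1 (d - 1 - i) * A else monom 1 (2 * d - 1 - i) * B)" for i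
  have "transpose_mat (sylvester_mat_sub d d A B) = coeff_mat (2 * d) P"
  proof (rule eq_matI)
    fix j i assume "j < dim_row (coeff_mat (2 * d) P)" "i < dim_col (coeff_mat (2 * d) P)"
    then have ij: "i < 2 * d" "j < 2 * d" by (simp_all add: coeff_mat_def)
    have lhs: "transpose_mat (sylvester_mat_sub d d A B) $$ (j, i) = sylvester_mat_sub d d A B $$ (i, j)"
      using ij by simp
    have rhs: "coeff_mat (2 * d) P $$ (j, i) = coeff (P i) (2 * d - 1 - j)"
      using ij by (simp add: coeff_mat_def)
    show "transpose_mat (sylvester_mat_sub d d A B) $$ (j, i) = coeff_mat (2 * d) P $$ (j, i)"
    proof (cases "i < d")
      case True
      have *: "coeff (P i) (2 * d - 1 - j) =
          (if d - 1 - i \<le> 2 * d - 1 - j then coeff A (2 * d - 1 - j - (d - 1 - i)) else 0)"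
        using True by (simp add: P_def coeff_monom_mult)
      have **: "coeff A (d + i - j) = 0" if "j < i" using that A by (intro coeff_eq_0) auto
      have "d - 1 - i \<le> 2 * d - 1 - j \<longleftrightarrow> j \<le> d + i" "2 * d - 1 - j - (d - 1 - i) = d + i - j"
        using True ij by auto
      then show ?thesis
        unfolding lhs rhs * using True ij ** by (auto simp: sylvester_mat_sub_index)
    next
      case False
      have *: "coeff (P i) (2 * d - 1 - j) =
          (if 2 * d - 1 - i \<le> 2 * d - 1 - j then coeff B (2 * d - 1 - j - (2 * d - 1 - i)) else 0)"
        using False by (simp add: P_def coeff_monom_mult)
      have **: "coeff B (i - j) = 0" if "j < i - d" using that B by (intro coeff_eq_0) auto
      have "2 * d - 1 - i \<le> 2 * d - 1 - j \<longleftrightarrow> j \<le> i" "2 * d - 1 - j - (2 * d - 1 - i) = i - j"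
        using ij by auto
      then show ?thesis
        unfolding lhs rhs * using False ij ** by (auto simp: sylvester_mat_sub_index)
    qed
  qed (simp_all add: coeff_mat_def)
  then have "resultant_sub d d A B = det (coeff_mat (2 * d) P)"
    unfolding resultant_sub_def
    using det_transpose[OF sylvester_mat_sub_carrier[of d d A B]] by simp
  moreover have "det (coeff_mat (2 * d) P) \<noteq> 0 \<longleftrightarrow>
      (\<forall>a. (\<Sum>i<2 * d. smult (a i) (P i)) = 0 \<longrightarrow> (\<forall>i<2 * d. a i = 0))"
  proof (rule det_coeff_mat_nonzero_iff)
    fix i k assume "i < 2 * d" "2 * d \<le> k"
    then show "coeff (P i) k = 0" using A B
      by (auto simp: P_def coeff_monom_mult intro!: coeff_eq_0)
  qed
  moreover have split: "(\<Sum>i<2 * d. smult (a i) (P i)) =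
      (\<Sum>i<d. monom (a i) (d - 1 - i)) * A + (\<Sum>i<d. monom (a (d + i)) (d - 1 - i)) * B" for a
  proof -
    have "(\<Sum>i<2 * d. smult (a i) (P i)) =
        (\<Sum>i<d. smult (a i) (P i)) + (\<Sum>i<d. smult (a (d + i)) (P (d + i)))"
      unfolding mult_2 by (rule sum_lessThan_add)
    also have "(\<Sum>i<d. smult (a i) (P i)) = (\<Sum>i<d. monom (a i) (d - 1 - i)) * A"
      unfolding sum_distrib_right by (rule sum.cong) (auto simp: P_def smult_monom_mult smult_monom)
    also have "(\<Sum>i<d. smult (a (d + i)) (P (d + i))) = (\<Sum>i<d. monom (a (d + i)) (d - 1 - i)) * B"
      unfolding sum_distrib_right
      by (rule sum.cong) (auto simp: P_def smult_monom_mult smult_monom)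
    finally show ?thesis .
  qed
  moreover have "(\<forall>a. (\<Sum>i<2 * d. smult (a i) (P i)) = 0 \<longrightarrow> (\<forall>i<2 * d. a i = 0)) \<longleftrightarrow> no_syzygy d A B"
  proof
    assume *: "\<forall>a. (\<Sum>i<2 * d. smult (a i) (P i)) = 0 \<longrightarrow> (\<forall>i<2 * d. a i = 0)"
    show "no_syzygy d A B" unfolding no_syzygy_def
    proof (intro allI impI)
      fix u w assume u: "\<forall>k\<ge>d. coeff u k = 0" and w: "\<forall>k\<ge>d. coeff w k = 0" and 0: "u * A + w * B = 0"
      define a where "a i = (if i < d then coeff u (d - 1 - i) else coeff w (2 * d - 1 - i))" for i
      have "(\<Sum>i<d. monom (a i) (d - 1 - i)) = u"
        using sum_monom_reverse[OF u] by (simp add: a_def)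
      moreover have "(\<Sum>i<d. monom (a (d + i)) (d - 1 - i)) = w"
        using sum_monom_reverse[OF w] by (simp add: a_def)
      ultimately have a: "a i = 0" if "i < 2 * d" for i using * split[of a] 0 that by simp
      have "coeff u k = 0" for k
        using a[of "d - 1 - k"] u by (cases "k < d") (auto simp: a_def)
      moreover have "coeff w k = 0" for k
        using a[of "2 * d - 1 - k"] w by (cases "k < d") (auto simp: a_def split: if_splits)
      ultimately show "u = 0 \<and> w = 0" by (auto intro: poly_eqI)
    qed
  next
    assume ns: "no_syzygy d A B"
    show "\<forall>a. (\<Sum>i<2 * d. smult (a i) (P i)) = 0 \<longrightarrow> (\<forall>i<2 * d. a i = 0)"
    proof (intro allI impI)
      fix a i assume 0: "(\<Sum>i<2 * d. smult (a i) (P i)) = 0" and i: "i < 2 * d"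
      define S where "S b = (\<Sum>i<d. monom (b i) (d - 1 - i))" for b :: "nat \<Rightarrow> 'a"
      have S1: "coeff (S b) k = 0" if "k \<ge> d" for b k
        using that d by (auto simp: S_def coeff_sum coeff_monom intro!: sum.neutral)
      have S2: "coeff (S b) (d - 1 - j) = b j" if "j < d" for b j
      proof -
        have "coeff (S b) (d - 1 - j) = (\<Sum>i<d. if i = j then b i else 0)"
          unfolding S_def coeff_sum by (rule sum.cong) (use that in \<open>auto simp: coeff_monom\<close>)
        then show ?thesis using that by simp
      qed
      have "S a * A + S (\<lambda>i. a (d + i)) * B = 0" using 0 split[of a] by (simp add: S_def)
      then have "S a = 0" "S (\<lambda>i. a (d + i)) = 0"
        using ns S1 unfolding no_syzygy_def by blast+
      then have "a j = 0 \<and> a (d + j) = 0" if "j < d" for j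
        using S2[OF that, of a] S2[OF that, of "\<lambda>i. a (d + i)"] by simp
      from this[of i] this[of "i - d"] show "a i = 0" using i by (cases "i < d") auto
    qed
  qed
  ultimately show ?thesis by simp
qed

section \<open>Ramification in terms of binary forms of degree \<open>d\<close>\<close>

definition zero_mult :: "nat \<Rightarrow> 'a::field poly \<Rightarrow> 'a option \<Rightarrow> nat" where
  "zero_mult d C x = (case x of Some z \<Rightarrow> order z C | None \<Rightarrow> d - degree C)"

text \<open>The value of the binary form of degree \<open>d\<close> at the representative
  \<open>(z, 1)\<close> or \<open>(1, 0)\<close> of the point.\<close>

definition eval_pt :: "nat \<Rightarrow> 'a::field poly \<Rightarrow> 'a option \<Rightarrow> 'a" where
  "eval_pt d A x = (case x of Some z \<Rightarrow> poly A z | None \<Rightarrow> coeff A d)"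

text \<open>The form whose zeros are the points with the same value as \<open>x\<close>; its
  multiplicity at \<open>x\<close> is the ramification index there.\<close>

definition fibre_poly :: "nat \<Rightarrow> 'a::field poly \<Rightarrow> 'a poly \<Rightarrow> 'a option \<Rightarrow> 'a poly" where
  "fibre_poly d A B x = smult (eval_pt d B x) A - smult (eval_pt d A x) B"

definition ram_pair :: "nat \<Rightarrow> nat \<Rightarrow> 'a::field option \<Rightarrow> 'a poly \<Rightarrow> 'a poly \<Rightarrow> bool" where
  "ram_pair d e c A B \<longleftrightarrow> degree A \<le> d \<and> degree B \<le> d \<and> no_syzygy d A B \<and>
     (\<forall>x. zero_mult d (fibre_poly d A B x) x = (if x = c then e else 1))"

lemma ram_index_eq:
  "ram_index d v x = zero_mult d (fibre_poly d (polyA d v) (polyB d v) x) x"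
  by (cases x) (simp_all add: zero_mult_def fibre_poly_def eval_pt_def Let_def)

lemma U_cone_iff:
  assumes "0 < d"
  shows "v \<in> U_cone d e c \<longleftrightarrow> length v = 2 * d + 2 \<and> ram_pair d e c (polyA d v) (polyB d v)"
  using resultant_sub_nonzero_iff[OF degree_polyA degree_polyB assms, of v v]
  by (auto simp: U_cone_def Rat_cone_def ram_index_eq ram_pair_def degree_polyA degree_polyB)

section \<open>Moving the ramification point to infinity\<close>

lemma degree_power_linear:
  fixes P :: "'a::field poly"
  assumes "degree P \<le> 1" shows "degree (P ^ k) \<le> k"
  using le_trans[OF degree_power_le[of P k] mult_le_mono1[OF assms, of k]] by simp

text \<open>Substitution of \<open>(L, M)\<close> into the binary form of degree \<open>d\<close>
  attached to \<open>P\<close>. The explicit \<open>d\<close> keeps the powers of \<open>M\<close>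
  that come from zeros at infinity.\<close>

definition hom_subst :: "nat \<Rightarrow> 'a::field poly \<Rightarrow> 'a poly \<Rightarrow> 'a poly \<Rightarrow> 'a poly" where
  "hom_subst d L M P = (\<Sum>i\<le>d. smult (coeff P i) (L ^ i * M ^ (d - i)))"

lemma hom_subst_add: "hom_subst d L M (P + Q) = hom_subst d L M P + hom_subst d L M Q"
  by (simp add: hom_subst_def smult_add_left sum.distrib)

lemma hom_subst_smult: "hom_subst d L M (smult a P) = smult a (hom_subst d L M P)"
  by (simp add: hom_subst_def smult_sum2)

lemma hom_subst_diff: "hom_subst d L M (P - Q) = hom_subst d L M P - hom_subst d L M Q"
  by (simp add: hom_subst_def smult_diff_left sum_subtractf)

lemma hom_subst_0 [simp]: "hom_subst d L M 0 = 0"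
  by (simp add: hom_subst_def)

lemma hom_subst_sum: "hom_subst d L M (\<Sum>i\<in>I. f i) = (\<Sum>i\<in>I. hom_subst d L M (f i))"
  by (induction I rule: infinite_finite_induct) (auto simp: hom_subst_add)

lemma hom_subst_pCons:
  "hom_subst (Suc n) L M (pCons a P) = smult a (M ^ Suc n) + L * hom_subst n L M P"
  unfolding hom_subst_def
  by (subst sum.atMost_Suc_shift) (simp add: sum_distrib_left mult.assoc)

lemma hom_subst_Suc:
  assumes "degree P \<le> n" shows "hom_subst (Suc n) L M P = M * hom_subst n L M P"
proof -
  have "hom_subst (Suc n) L M P = (\<Sum>i\<le>n. smult (coeff P i) (L ^ i * M ^ (Suc n - i)))"
    using assms by (simp add: hom_subst_def coeff_eq_0)
  also have "\<dots> = (\<Sum>i\<le>n. M * smult (coeff P i) (L ^ i * M ^ (n - i)))"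
    by (rule sum.cong) (auto simp: Suc_diff_le mult.left_commute)
  finally show ?thesis by (simp add: hom_subst_def sum_distrib_left)
qed

text \<open>Raising the nominal degree by \<open>k\<close> adds a zero of order \<open>k\<close> at
  infinity, which the substitution turns into \<open>M ^ k\<close>.\<close>

lemma hom_subst_raise:
  assumes "degree P \<le> n" shows "hom_subst (k + n) L M P = M ^ k * hom_subst n L M P"
  using assms by (induction k) (auto simp: hom_subst_Suc mult.assoc)

lemma hom_subst_mult:
  assumes "degree P \<le> i" "degree Q \<le> j"
  shows "hom_subst (i + j) L M (P * Q) = hom_subst i L M P * hom_subst j L M Q"
  using assms(1)
proof (induction i arbitrary: P)
  case 0
  then obtain a where "P = [:a:]" using degree_eq_zeroE by blast
  then show ?case by (simp add: hom_subst_smult) (simp add: hom_subst_def)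
next
  case (Suc i)
  obtain a P' where P: "P = pCons a P'" by (cases P)
  have deg: "degree P' \<le> i" using Suc.prems P by (cases "P' = 0") auto
  have "hom_subst (Suc i + j) L M (P * Q) =
      smult a (hom_subst (Suc i + j) L M Q) + hom_subst (Suc (i + j)) L M (pCons 0 (P' * Q))"
    by (simp add: P hom_subst_add hom_subst_smult)
  also have "\<dots> = smult a (M ^ Suc i * hom_subst j L M Q) + L * (hom_subst i L M P' * hom_subst j L M Q)"
    unfolding hom_subst_raise[OF assms(2)] hom_subst_pCons using Suc.IH[OF deg] by simp
  also have "\<dots> = hom_subst (Suc i) L M P * hom_subst j L M Q"
    unfolding P hom_subst_pCons by (simp add: algebra_simps)
  finally show ?case .
qed

lemma hom_subst_power:
  assumes "degree P \<le> 1" shows "hom_subst k L M (P ^ k) = hom_subst 1 L M P ^ k"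
proof (induction k)
  case 0 show ?case by (simp add: hom_subst_def)
next
  case (Suc k)
  have "degree (P ^ k) \<le> k" using assms by (rule degree_power_linear)
  then show ?case using hom_subst_mult[OF assms, of "P ^ k" k] Suc by simp
qed

lemma degree_hom_subst:
  assumes "degree L \<le> 1" "degree M \<le> 1" shows "degree (hom_subst d L M P) \<le> d"
  unfolding hom_subst_def
proof (rule degree_sum_le)
  fix i assume i: "i \<in> {..d}"
  have "degree (L ^ i) \<le> i" using assms(1) by (rule degree_power_linear)
  moreover have "degree (M ^ (d - i)) \<le> d - i"
    using assms(2) by (rule degree_power_linear)
  ultimately have "degree (L ^ i * M ^ (d - i)) \<le> d"
    using degree_mult_le[of "L ^ i" "M ^ (d - i)"] i by simp
  then show "degree (smult (coeff P i) (L ^ i * M ^ (d - i))) \<le> d"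
    using degree_smult_le le_trans by blast
qed simp

lemma hom_subst_id:
  assumes "degree P \<le> d" shows "hom_subst d [:0, 1:] 1 P = P"
proof -
  have "hom_subst d [:0, 1:] 1 P = (\<Sum>i\<le>d. monom (coeff P i) i)"
    by (simp add: hom_subst_def monom_altdef)
  then show ?thesis using poly_as_sum_of_monoms'[OF assms] by simp
qed

text \<open>The hypotheses say that the two linear substitutions are inverse to each other on linear
  forms; multiplicativity of \<open>hom_subst\<close> extends this to all products of powers of
  \<open>L'\<close> and \<open>M'\<close>.\<close>

lemma hom_subst_hom_subst:
  assumes "degree L' \<le> 1" "degree M' \<le> 1"
    and "hom_subst 1 L M L' = [:0, 1:]" "hom_subst 1 L M M' = 1" and "degree P \<le> d"
  shows "hom_subst d L M (hom_subst d L' M' P) = P"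
proof -
  have "hom_subst d L M (L' ^ i * M' ^ (d - i)) = [:0, 1:] ^ i * 1 ^ (d - i)" if "i \<le> d" for i
  proof -
    have "degree (L' ^ i) \<le> i" using assms(1) by (rule degree_power_linear)
    moreover have "degree (M' ^ (d - i)) \<le> d - i"
      using assms(2) by (rule degree_power_linear)
    ultimately have "hom_subst (i + (d - i)) L M (L' ^ i * M' ^ (d - i)) = [:0, 1:] ^ i * 1 ^ (d - i)"
      using assms(1-4) by (simp add: hom_subst_mult hom_subst_power)
    then show ?thesis using that by simp
  qed
  then have "hom_subst d L M (hom_subst d L' M' P) = hom_subst d [:0, 1:] 1 P"
    unfolding hom_subst_def[of d L' M'] hom_subst_sum hom_subst_smult
    by (simp add: hom_subst_def[of d "[:0, 1:]"])
  then show ?thesis using hom_subst_id[OF assms(5)] by simp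
qed

lemma rat_fun_hom_subst:
  assumes "\<And>i. i \<le> d \<Longrightarrow> rat_fun N S (\<lambda>v. coeff (P v) i)"
  shows "rat_fun N S (\<lambda>v. coeff (hom_subst d L M (P v)) j)"
  unfolding hom_subst_def coeff_sum coeff_smult
  by (intro rat_fun_sum rat_fun_mult rat_fun_const assms) simp

text \<open>The linear form vanishing at \<open>x\<close>. At infinity it is the second homogeneous
  coordinate, which dehomogenizes to 1, so there the factor is recorded only by degree
  bounds.\<close>

definition point_form :: "'a::field option \<Rightarrow> 'a poly" where
  "point_form x = (case x of Some z \<Rightarrow> [:- z, 1:] | None \<Rightarrow> 1)"

lemma zero_mult_factor:
  assumes "C \<noteq> 0" "degree C \<le> d"
  obtains Q where "C = point_form x ^ zero_mult d C x * Q"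
    "degree Q \<le> d - zero_mult d C x" "zero_mult d C x \<le> d"
proof (cases x)
  case None
  show ?thesis
    by (rule that[of C]) (use None assms in \<open>auto simp: zero_mult_def point_form_def\<close>)
next
  case (Some z)
  obtain Q where Q: "C = [:- z, 1:] ^ order z C * Q" using order_1[of z C] unfolding dvd_def by blast
  have "Q \<noteq> 0" using Q assms by auto
  then have "degree C = order z C + degree Q"
    by (subst Q, subst degree_mult_eq) (auto simp: degree_power_eq)
  then show ?thesis
    by (intro that[of Q]) (use Q Some assms in \<open>auto simp: zero_mult_def point_form_def\<close>)
qed

lemma zero_mult_ge:
  assumes "C = point_form x ^ k * Q" "degree Q \<le> d - k" "C \<noteq> 0" "k \<le> d"
  shows "k \<le> zero_mult d C x"
proof (cases x)
  case None then show ?thesis using assms by (auto simp: zero_mult_def point_form_def)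
next
  case (Some z)
  then have "[:- z, 1:] ^ k dvd C" using assms by (simp add: point_form_def)
  then show ?thesis using assms(3) Some by (simp add: zero_mult_def order_divides)
qed

lemma eval_pt_zero_factor:
  assumes "eval_pt d A x = 0" "degree A \<le> d" "0 < d"
  obtains A' where "A = point_form x * A'" "degree A' < d"
proof (cases x)
  case None
  have "degree A < d"
    using assms None by (metis eval_pt_def le_neq_implies_less leading_coeff_0_iff degree_0 option.simps(4))
  then show ?thesis by (intro that[of A]) (use None in \<open>auto simp: point_form_def\<close>)
next
  case (Some z)
  then obtain Q where Q: "A = [:- z, 1:] * Q"
    using assms(1) by (auto simp: eval_pt_def poly_eq_0_iff_dvd)
  have "degree Q < d"
  proof (cases "Q = 0")
    case False
    then have "degree A = Suc (degree Q)" by (subst Q, subst degree_mult_eq) auto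
    then show ?thesis using assms by simp
  qed (use assms in simp)
  then show ?thesis by (intro that[of Q]) (use Q Some in \<open>auto simp: point_form_def\<close>)
qed

lemma no_syzygyD:
  "no_syzygy d A B \<Longrightarrow> degree u < d \<Longrightarrow> degree w < d \<Longrightarrow> u * A + w * B = 0 \<Longrightarrow> u = 0 \<and> w = 0"
  unfolding no_syzygy_def using coeff_eq_0 by (metis order_less_le_trans)

text \<open>If the fibre form vanished, constants would give a syzygy unless both values at
  \<open>x\<close> are 0. In that case \<open>point_form x\<close> divides both forms, and the
  cofactors \<open>B'\<close> and \<open>- A'\<close> give one.\<close>

lemma fibre_poly_nonzero:
  assumes ns: "no_syzygy d A B" and deg: "degree A \<le> d" "degree B \<le> d" and d: "0 < d"
  shows "fibre_poly d A B x \<noteq> 0"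
proof
  assume "fibre_poly d A B x = 0"
  then have "[:eval_pt d B x:] * A + [:- eval_pt d A x:] * B = 0" by (simp add: fibre_poly_def)
  then have "[:eval_pt d B x:] = 0 \<and> [:- eval_pt d A x:] = 0"
    by (intro no_syzygyD[OF ns]) (use d in auto)
  then have 0: "eval_pt d A x = 0" "eval_pt d B x = 0" by auto
  obtain A' where A': "A = point_form x * A'" "degree A' < d"
    using eval_pt_zero_factor[OF 0(1) deg(1) d] by blast
  obtain B' where B': "B = point_form x * B'" "degree B' < d"
    using eval_pt_zero_factor[OF 0(2) deg(2) d] by blast
  have "B' * A + (- A') * B = 0" by (simp add: A' B')
  then have "B' = 0 \<and> - A' = 0" by (intro no_syzygyD[OF ns]) (use A' B' in auto)
  then have "1 * A + 0 * B = 0" using A' by simp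
  then show False using no_syzygyD[OF ns, of 1 0] d by auto
qed

lemma degree_fibre_poly: "degree A \<le> d \<Longrightarrow> degree B \<le> d \<Longrightarrow> degree (fibre_poly d A B x) \<le> d"
  unfolding fibre_poly_def by (intro degree_diff_le) (auto intro: le_trans[OF degree_smult_le])

text \<open>The pair \<open>L, M\<close> of linear forms represents the fractional linear map \<open>\<Phi>\<close>.\<close>

definition moebius :: "'a::field poly \<Rightarrow> 'a poly \<Rightarrow> ('a option \<Rightarrow> 'a option) \<Rightarrow> bool" where
  "moebius L M \<Phi> \<longleftrightarrow> degree L \<le> 1 \<and> degree M \<le> 1 \<and>
     (\<forall>x. \<exists>l. l \<noteq> 0 \<and> eval_pt 1 L x = l * (case \<Phi> x of Some z \<Rightarrow> z | None \<Rightarrow> 1) \<and>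
        eval_pt 1 M x = l * (case \<Phi> x of Some z \<Rightarrow> 1 | None \<Rightarrow> 0)) \<and>
     (\<forall>x. \<exists>k. k \<noteq> 0 \<and> hom_subst 1 L M (point_form (\<Phi> x)) = smult k (point_form x))"

lemma eval_pt_smult: "eval_pt d (smult a P) x = a * eval_pt d P x"
  by (simp add: eval_pt_def split: option.split)

lemma eval_pt_sum: "eval_pt d (\<Sum>i\<in>I. f i) x = (\<Sum>i\<in>I. eval_pt d (f i) x)"
  by (cases x) (simp_all add: eval_pt_def coeff_sum poly_sum)

lemma eval_pt_mult:
  assumes "degree P \<le> i" "degree Q \<le> j"
  shows "eval_pt (i + j) (P * Q) x = eval_pt i P x * eval_pt j Q x"
proof (cases x)
  case None
  have "coeff (P * Q) (i + j) = (\<Sum>k\<le>i + j. if k = i then coeff P k * coeff Q j else 0)"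
    unfolding coeff_mult
  proof (rule sum.cong[OF refl])
    fix k assume "k \<in> {..i + j}"
    show "coeff P k * coeff Q (i + j - k) = (if k = i then coeff P k * coeff Q j else 0)"
    proof (cases k i rule: linorder_cases)
      case less
      then have "coeff Q (i + j - k) = 0" using assms(2) by (intro coeff_eq_0) auto
      then show ?thesis using less by simp
    next
      case greater
      then have "coeff P k = 0" using assms(1) by (intro coeff_eq_0) auto
      then show ?thesis using greater by simp
    qed simp
  qed
  then show ?thesis using None by (simp add: eval_pt_def)
qed (simp add: eval_pt_def)

lemma eval_pt_power:
  assumes "degree P \<le> 1" shows "eval_pt k (P ^ k) x = eval_pt 1 P x ^ k"
proof (induction k)
  case 0 show ?case by (simp add: eval_pt_def split: option.split)
next
  case (Suc k)
  have "degree (P ^ k) \<le> k" using assms by (rule degree_power_linear)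
  then show ?case using eval_pt_mult[OF assms, of "P ^ k" k x] Suc by simp
qed

text \<open>The factor \<open>l\<close> depends on the point but not on \<open>P\<close>, so
  numerator and denominator are rescaled alike and fibre forms correspond.\<close>

lemma eval_pt_hom_subst:
  assumes "moebius L M \<Phi>"
  obtains l where "l \<noteq> 0" "\<And>P. degree P \<le> d \<Longrightarrow> eval_pt d (hom_subst d L M P) x = l * eval_pt d P (\<Phi> x)"
proof -
  have deg: "degree L \<le> 1" "degree M \<le> 1" using assms by (auto simp: moebius_def)
  obtain l where l: "l \<noteq> 0" "eval_pt 1 L x = l * (case \<Phi> x of Some z \<Rightarrow> z | None \<Rightarrow> 1)"
    "eval_pt 1 M x = l * (case \<Phi> x of Some z \<Rightarrow> 1 | None \<Rightarrow> 0)"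
    using assms unfolding moebius_def by blast
  have "eval_pt d (hom_subst d L M P) x = l ^ d * eval_pt d P (\<Phi> x)" if P: "degree P \<le> d" for P
  proof -
    have "eval_pt d (L ^ i * M ^ (d - i)) x = eval_pt 1 L x ^ i * eval_pt 1 M x ^ (d - i)"
      if "i \<le> d" for i
    proof -
      have "degree (L ^ i) \<le> i" using deg(1) by (rule degree_power_linear)
      moreover have "degree (M ^ (d - i)) \<le> d - i"
        using deg(2) by (rule degree_power_linear)
      ultimately have "eval_pt (i + (d - i)) (L ^ i * M ^ (d - i)) x =
          eval_pt 1 L x ^ i * eval_pt 1 M x ^ (d - i)"
        using deg by (simp only: eval_pt_mult eval_pt_power)
      then show ?thesis using that by simp
    qed
    then have "eval_pt d (hom_subst d L M P) x =
        (\<Sum>i\<le>d. coeff P i * (eval_pt 1 L x ^ i * eval_pt 1 M x ^ (d - i)))"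
      unfolding hom_subst_def eval_pt_sum eval_pt_smult by (intro sum.cong refl) simp
    also have "\<dots> = l ^ d * eval_pt d P (\<Phi> x)"
    proof (cases "\<Phi> x")
      case None
      have "(\<Sum>i\<le>d. coeff P i * (eval_pt 1 L x ^ i * eval_pt 1 M x ^ (d - i))) =
          (\<Sum>i\<le>d. if i = d then coeff P i * l ^ d else 0)"
        using l None by (intro sum.cong refl) (auto simp: power_0_left)
      then show ?thesis using None by (simp add: eval_pt_def)
    next
      case (Some z)
      have "(\<Sum>i\<le>d. coeff P i * (eval_pt 1 L x ^ i * eval_pt 1 M x ^ (d - i))) =
          (\<Sum>i\<le>d. l ^ d * (coeff P i * z ^ i))"
      proof (intro sum.cong refl)
        fix i assume "i \<in> {..d}"
        then have "l ^ d = l ^ i * l ^ (d - i)" by (simp add: power_add[symmetric])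
        then show "coeff P i * (eval_pt 1 L x ^ i * eval_pt 1 M x ^ (d - i)) = l ^ d * (coeff P i * z ^ i)"
          using l Some by (simp add: power_mult_distrib)
      qed
      also have "\<dots> = l ^ d * poly P z"
        using arg_cong[OF poly_as_sum_of_monoms'[OF P], of "\<lambda>Q. poly Q z"] by (simp add: sum_distrib_left[symmetric] poly_sum poly_monom)
      finally show ?thesis using Some by (simp add: eval_pt_def)
    qed
    finally show ?thesis .
  qed
  then show ?thesis using l(1) by (intro that[of "l ^ d"]) auto
qed

lemma zero_mult_hom_subst_le:
  assumes "moebius L M \<Phi>" "C \<noteq> 0" "degree C \<le> d" "hom_subst d L M C \<noteq> 0"
  shows "zero_mult d C (\<Phi> x) \<le> zero_mult d (hom_subst d L M C) x"
proof -
  define k where "k = zero_mult d C (\<Phi> x)"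
  obtain Q where Q: "C = point_form (\<Phi> x) ^ k * Q" "degree Q \<le> d - k" "k \<le> d"
    using zero_mult_factor[OF assms(2,3)] unfolding k_def by blast
  obtain \<kappa> where \<kappa>: "\<kappa> \<noteq> 0" "hom_subst 1 L M (point_form (\<Phi> x)) = smult \<kappa> (point_form x)"
    using assms(1) unfolding moebius_def by blast
  have p1: "degree (point_form (\<Phi> x)) \<le> 1" by (simp add: point_form_def split: option.split)
  have "degree (point_form (\<Phi> x) ^ k) \<le> k"
    using p1 by (rule degree_power_linear)
  then have "hom_subst (k + (d - k)) L M C = smult \<kappa> (point_form x) ^ k * hom_subst (d - k) L M Q"
    unfolding Q(1) using Q(2) p1 \<kappa>(2) by (simp only: hom_subst_mult hom_subst_power)
  then have "hom_subst d L M C = point_form x ^ k * smult (\<kappa> ^ k) (hom_subst (d - k) L M Q)"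
    using Q(3) by (simp add: smult_power)
  moreover have "degree (smult (\<kappa> ^ k) (hom_subst (d - k) L M Q)) \<le> d - k"
    using degree_hom_subst assms(1) unfolding moebius_def by (meson degree_smult_le le_trans)
  ultimately show ?thesis unfolding k_def[symmetric] using zero_mult_ge assms(4) Q(3) by blast
qed

text \<open>The inverse substitution, taken in degree \<open>d - 1 + d\<close>, carries a syzygy of
  the transformed pair to one of \<open>A\<close> and \<open>B\<close>.\<close>

lemma no_syzygy_hom_subst:
  assumes deg: "degree L \<le> 1" "degree M \<le> 1" "degree L' \<le> 1" "degree M' \<le> 1"
    and inv: "hom_subst 1 L M L' = [:0, 1:]" "hom_subst 1 L M M' = 1"
    and inv': "hom_subst 1 L' M' L = [:0, 1:]" "hom_subst 1 L' M' M = 1"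
    and AB: "degree A \<le> d" "degree B \<le> d" "no_syzygy d A B" and d: "0 < d"
  shows "no_syzygy d (hom_subst d L M A) (hom_subst d L M B)"
  unfolding no_syzygy_def
proof (intro allI impI)
  fix u w assume "\<forall>k\<ge>d. coeff u k = 0" "\<forall>k\<ge>d. coeff w k = 0"
    and 0: "u * hom_subst d L M A + w * hom_subst d L M B = 0"
  then have uw: "degree u \<le> d - 1" "degree w \<le> d - 1" by (auto intro!: degree_le)
  let ?h = "hom_subst (d - 1) L' M'"
  have "?h q * P = hom_subst (d - 1 + d) L' M' (q * hom_subst d L M P)"
    if "degree q \<le> d - 1" "degree P \<le> d" for q P
    using hom_subst_mult[OF that(1) degree_hom_subst[OF deg(1,2)]]
      hom_subst_hom_subst[OF deg(1,2) inv' that(2)] by simp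
  then have "?h u * A + ?h w * B =
      hom_subst (d - 1 + d) L' M' (u * hom_subst d L M A + w * hom_subst d L M B)"
    using uw AB by (simp add: hom_subst_add)
  then have "?h u * A + ?h w * B = 0" using 0 by simp
  moreover have "degree (?h q) < d" for q using degree_hom_subst[OF deg(3,4), of "d - 1" q] d by simp
  ultimately have "?h u = 0 \<and> ?h w = 0" using no_syzygyD[OF AB(3)] by blast
  then show "u = 0 \<and> w = 0"
    using hom_subst_hom_subst[OF deg(3,4) inv uw(1)] hom_subst_hom_subst[OF deg(3,4) inv uw(2)] by auto
qed

lemma ram_pair_hom_subst:
  assumes m: "moebius L M \<Phi>" "moebius L' M' \<Phi>'"
    and inv: "hom_subst 1 L M L' = [:0, 1:]" "hom_subst 1 L M M' = 1"
    and inv': "hom_subst 1 L' M' L = [:0, 1:]" "hom_subst 1 L' M' M = 1"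
    and \<Phi>: "\<And>x. \<Phi>' (\<Phi> x) = x" "\<And>x. \<Phi> x = c \<longleftrightarrow> x = c'"
    and ram: "ram_pair d e c A B" and d: "0 < d"
  shows "ram_pair d e c' (hom_subst d L M A) (hom_subst d L M B)"
  unfolding ram_pair_def
proof (intro conjI allI)
  have deg: "degree L \<le> 1" "degree M \<le> 1" "degree L' \<le> 1" "degree M' \<le> 1"
    using m by (auto simp: moebius_def)
  have AB: "degree A \<le> d" "degree B \<le> d" "no_syzygy d A B" using ram by (auto simp: ram_pair_def)
  show "degree (hom_subst d L M A) \<le> d" "degree (hom_subst d L M B) \<le> d"
    using degree_hom_subst deg by auto
  show "no_syzygy d (hom_subst d L M A) (hom_subst d L M B)"
    by (rule no_syzygy_hom_subst[OF deg inv inv' AB d])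
  fix x
  define C where "C = fibre_poly d A B (\<Phi> x)"
  have C: "C \<noteq> 0" "degree C \<le> d"
    unfolding C_def using fibre_poly_nonzero[OF AB(3,1,2) d] degree_fibre_poly AB by auto
  have invC: "hom_subst d L' M' (hom_subst d L M C) = C"
    by (rule hom_subst_hom_subst[OF deg(1,2) inv' C(2)])
  then have hC: "hom_subst d L M C \<noteq> 0" using C(1) by auto
  obtain l where l: "l \<noteq> 0"
    "\<And>P. degree P \<le> d \<Longrightarrow> eval_pt d (hom_subst d L M P) x = l * eval_pt d P (\<Phi> x)"
    using eval_pt_hom_subst[OF m(1)] by blast
  have "fibre_poly d (hom_subst d L M A) (hom_subst d L M B) x = smult l (hom_subst d L M C)"
    using AB by (simp add: C_def fibre_poly_def l hom_subst_diff hom_subst_smult smult_diff_right)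
  then have "zero_mult d (fibre_poly d (hom_subst d L M A) (hom_subst d L M B) x) x =
      zero_mult d (hom_subst d L M C) x"
    using l(1) by (simp add: zero_mult_def order_smult split: option.split)
  also have "\<dots> = zero_mult d C (\<Phi> x)"
  proof (rule antisym)
    show "zero_mult d C (\<Phi> x) \<le> zero_mult d (hom_subst d L M C) x"
      by (rule zero_mult_hom_subst_le[OF m(1) C hC])
    \<comment> \<open>Multiplicities cannot drop under a substitution; applied to the inverse one,
      this is the reverse inequality.\<close>
    have "zero_mult d (hom_subst d L M C) (\<Phi>' (\<Phi> x)) \<le>
        zero_mult d (hom_subst d L' M' (hom_subst d L M C)) (\<Phi> x)"
      by (rule zero_mult_hom_subst_le[OF m(2) hC degree_hom_subst[OF deg(1,2)]]) (use invC C in simp)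
    then show "zero_mult d (hom_subst d L M C) x \<le> zero_mult d C (\<Phi> x)"
      using invC \<Phi>(1) by simp
  qed
  also have "\<dots> = (if x = c' then e else 1)"
    using ram \<Phi>(2)[of x] unfolding C_def ram_pair_def by simp
  finally show "zero_mult d (fibre_poly d (hom_subst d L M A) (hom_subst d L M B) x) x =
      (if x = c' then e else 1)" .
qed

text \<open>For finite \<open>c\<close> this substitutes \<open>z + 1 / w\<close> in homogeneous
  form, so that the result behaves at infinity as \<open>P\<close> does at \<open>c\<close>.\<close>

definition to_infinity :: "nat \<Rightarrow> 'a::field option \<Rightarrow> 'a poly \<Rightarrow> 'a poly" where
  "to_infinity d c P = (case c of None \<Rightarrow> P | Some z \<Rightarrow> hom_subst d [:1, z:] [:0, 1:] P)"

definition from_infinity :: "nat \<Rightarrow> 'a::field option \<Rightarrow> 'a poly \<Rightarrow> 'a poly" where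
  "from_infinity d c P = (case c of None \<Rightarrow> P | Some z \<Rightarrow> hom_subst d 1 [:- z, 1:] P)"

lemma hom_subst_1: "hom_subst 1 L M P = smult (coeff P 0) M + smult (coeff P 1) L"
  by (simp add: hom_subst_def)

lemma to_from_infinity_inverse:
  fixes z :: "'a::field"
  shows "hom_subst 1 [:1, z:] [:0, 1:] 1 = [:0, 1:]" "hom_subst 1 [:1, z:] [:0, 1:] [:- z, 1:] = 1"
    "hom_subst 1 1 [:- z, 1:] [:1, z:] = [:0, 1:]" "hom_subst 1 1 [:- z, 1:] [:0, 1:] = 1"
  unfolding hom_subst_1 by (simp_all add: one_pCons)

lemma degree_to_infinity: "degree P \<le> d \<Longrightarrow> degree (to_infinity d c P) \<le> d"
  by (auto simp: to_infinity_def degree_hom_subst split: option.split)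

lemma degree_from_infinity: "degree P \<le> d \<Longrightarrow> degree (from_infinity d c P) \<le> d"
  by (auto simp: from_infinity_def degree_hom_subst split: option.split)

lemma to_from_infinity: "degree P \<le> d \<Longrightarrow> to_infinity d c (from_infinity d c P) = P"
  by (auto simp: to_infinity_def from_infinity_def to_from_infinity_inverse[unfolded One_nat_def]
      split: option.split
      intro!: hom_subst_hom_subst)

lemma from_to_infinity: "degree P \<le> d \<Longrightarrow> from_infinity d c (to_infinity d c P) = P"
  by (auto simp: to_infinity_def from_infinity_def to_from_infinity_inverse[unfolded One_nat_def]
      split: option.split
      intro!: hom_subst_hom_subst)

lemma to_infinity_linear:
  "to_infinity d c (smult a P + smult b Q) = smult a (to_infinity d c P) + smult b (to_infinity d c Q)"
  by (auto simp: to_infinity_def hom_subst_add hom_subst_smult split: option.split)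

lemma from_infinity_linear:
  "from_infinity d c (smult a P + smult b Q) =
    smult a (from_infinity d c P) + smult b (from_infinity d c Q)"
  by (auto simp: from_infinity_def hom_subst_add hom_subst_smult split: option.split)

lemma rat_fun_to_infinity:
  assumes "\<And>i. i \<le> d \<Longrightarrow> rat_fun N S (\<lambda>v. coeff (P v) i)" "j \<le> d"
  shows "rat_fun N S (\<lambda>v. coeff (to_infinity d c (P v)) j)"
  using assms by (cases c) (auto simp: to_infinity_def intro!: rat_fun_hom_subst)

lemma rat_fun_from_infinity:
  assumes "\<And>i. i \<le> d \<Longrightarrow> rat_fun N S (\<lambda>v. coeff (P v) i)" "j \<le> d"
  shows "rat_fun N S (\<lambda>v. coeff (from_infinity d c (P v)) j)"
  using assms by (cases c) (auto simp: from_infinity_def intro!: rat_fun_hom_subst)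

lemma moebius_to_infinity:
  "moebius [:1, z:] [:0, 1:] (\<lambda>x. case x of None \<Rightarrow> Some z
     | Some w \<Rightarrow> if w = 0 then None else Some (z + 1 / w))"
  unfolding moebius_def
proof (intro conjI allI)
  fix x
  let ?\<Phi> = "case x of None \<Rightarrow> Some z | Some w \<Rightarrow> if w = 0 then None else Some (z + 1 / w)"
  show "\<exists>l. l \<noteq> 0 \<and> eval_pt 1 [:1, z:] x = l * (case ?\<Phi> of Some z \<Rightarrow> z | None \<Rightarrow> 1) \<and>
      eval_pt 1 [:0, 1:] x = l * (case ?\<Phi> of Some z \<Rightarrow> 1 | None \<Rightarrow> 0)"
  proof (cases x)
    case None then show ?thesis by (intro exI[of _ 1]) (simp add: eval_pt_def)
  next
    case (Some w)
    \<comment> \<open>For \<open>w \<noteq> 0\<close> the values of the two forms are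
      \<open>(1 + z * w, w)\<close>, which is \<open>w\<close> times \<open>(z + 1 / w, 1)\<close>;
      for \<open>w = 0\<close> they are \<open>(1, 0)\<close>.\<close>
    then show ?thesis
      by (intro exI[of _ "if w = 0 then 1 else w"]) (auto simp: eval_pt_def field_simps)
  qed
  show "\<exists>k. k \<noteq> 0 \<and> hom_subst 1 [:1, z:] [:0, 1:] (point_form ?\<Phi>) = smult k (point_form x)"
  proof (cases x)
    case None
    then show ?thesis unfolding hom_subst_1 by (intro exI[of _ 1]) (simp add: point_form_def one_pCons)
  next
    case (Some w)
    then show ?thesis unfolding hom_subst_1
      by (intro exI[of _ "if w = 0 then 1 else - 1 / w"])
         (auto simp: point_form_def field_simps)
  qed
qed simp_all

lemma moebius_from_infinity:
  "moebius 1 [:- z, 1:] (\<lambda>x. case x of None \<Rightarrow> Some 0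
     | Some w \<Rightarrow> if w = z then None else Some (1 / (w - z)))"
  unfolding moebius_def
proof (intro conjI allI)
  fix x
  let ?\<Phi> = "case x of None \<Rightarrow> Some 0 | Some w \<Rightarrow> if w = z then None else Some (1 / (w - z))"
  show "\<exists>l. l \<noteq> 0 \<and> eval_pt 1 1 x = l * (case ?\<Phi> of Some z \<Rightarrow> z | None \<Rightarrow> 1) \<and>
      eval_pt 1 [:- z, 1:] x = l * (case ?\<Phi> of Some z \<Rightarrow> 1 | None \<Rightarrow> 0)"
  proof (cases x)
    case None then show ?thesis by (intro exI[of _ 1]) (simp add: eval_pt_def)
  next
    case (Some w)
    then show ?thesis
      by (intro exI[of _ "if w = z then 1 else w - z"]) (auto simp: eval_pt_def)
  qed
  show "\<exists>k. k \<noteq> 0 \<and> hom_subst 1 1 [:- z, 1:] (point_form ?\<Phi>) = smult k (point_form x)"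
  proof (cases x)
    case None
    then show ?thesis unfolding hom_subst_1 by (intro exI[of _ 1]) (simp add: point_form_def one_pCons)
  next
    case (Some w)
    then show ?thesis unfolding hom_subst_1
      by (intro exI[of _ "if w = z then 1 else - 1 / (w - z)"])
         (auto simp: point_form_def one_pCons field_simps)
  qed
qed simp_all

lemma ram_pair_to_infinity:
  assumes "ram_pair d e c A B" "0 < d"
  shows "ram_pair d e None (to_infinity d c A) (to_infinity d c B)"
proof (cases c)
  case None then show ?thesis using assms by (simp add: to_infinity_def)
next
  case (Some z)
  show ?thesis unfolding to_infinity_def Some option.simps
    by (rule ram_pair_hom_subst[OF moebius_to_infinity moebius_from_infinity
          to_from_infinity_inverse _ _ assms(1)[unfolded Some] assms(2)])
       (auto split: option.split)
qed

lemma ram_pair_from_infinity: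
  assumes "ram_pair d e None A B" "0 < d"
  shows "ram_pair d e c (from_infinity d c A) (from_infinity d c B)"
proof (cases c)
  case None then show ?thesis using assms by (simp add: from_infinity_def)
next
  case (Some z)
  show ?thesis unfolding from_infinity_def Some option.simps
    by (rule ram_pair_hom_subst[OF moebius_from_infinity moebius_to_infinity
          to_from_infinity_inverse(3,4,1,2) _ _ assms])
       (auto split: option.split)
qed

section \<open>Constant Wronskians in characteristic p\<close>

lemma det_coeff_mat_solvable:
  assumes det: "det (coeff_mat n P) \<noteq> 0"
    and deg: "\<And>i k. i < n \<Longrightarrow> n \<le> k \<Longrightarrow> coeff (P i) k = 0" "\<And>k. n \<le> k \<Longrightarrow> coeff Q k = 0"
  obtains a where "(\<Sum>i<n. smult (a i) (P i)) = Q"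
proof -
  define M where "M = coeff_mat n P"
  have M: "M \<in> carrier_mat n n" by (simp add: M_def)
  define b where "b = vec n (\<lambda>j. coeff Q (n - 1 - j))"
  have b: "b \<in> carrier_vec n" by (simp add: b_def)
  define x where "x = adj_mat M *\<^sub>v (inverse (det M) \<cdot>\<^sub>v b)"
  have x: "x \<in> carrier_vec n"
    unfolding x_def by (rule mult_mat_vec_carrier[OF adj_mat(1)[OF M]]) (use b in simp)
  have "M *\<^sub>v x = (M * adj_mat M) *\<^sub>v (inverse (det M) \<cdot>\<^sub>v b)"
    unfolding x_def by (rule assoc_mult_mat_vec[symmetric]) (use M adj_mat(1)[OF M] b in auto)
  also have "\<dots> = b"
    unfolding adj_mat(2)[OF M] using det b by (auto simp: M_def intro!: eq_vecI)
  finally have eq: "vec n (\<lambda>j. coeff (\<Sum>i<n. smult (vec_index x i) (P i)) (n - 1 - j)) = b"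
    unfolding M_def coeff_mat_mult_vec[OF x] .
  have "(\<Sum>i<n. smult (vec_index x i) (P i)) = Q"
  proof (rule poly_eqI)
    fix k show "coeff (\<Sum>i<n. smult (vec_index x i) (P i)) k = coeff Q k"
    proof (cases "k < n")
      case True
      then have "coeff (\<Sum>i<n. smult (vec_index x i) (P i)) (n - 1 - (n - 1 - k)) =
          coeff Q (n - 1 - (n - 1 - k))"
        using arg_cong[OF eq, of "\<lambda>v. vec_index v (n - 1 - k)"] by (simp add: b_def)
      then show ?thesis using True by simp
    next
      case False then show ?thesis using deg by (simp add: coeff_sum)
    qed
  qed
  then show ?thesis by (rule that)
qed

section \<open>Polynomials whose exponents are 0 or 1 modulo p\<close>

definition expand :: "nat \<Rightarrow> 'a::field poly \<Rightarrow> 'a poly" where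
  "expand p q = pcompose q (monom 1 p)"

lemma coeff_expand:
  assumes "0 < p" shows "coeff (expand p q) i = (if p dvd i then coeff q (i div p) else 0)"
proof (induction q arbitrary: i)
  case 0 show ?case by (simp add: expand_def)
next
  case (pCons a q)
  have eq: "expand p (pCons a q) = [:a:] + monom 1 p * expand p q"
    by (simp add: expand_def pcompose_pCons)
  show ?case
  proof (cases "p \<le> i")
    case True
    have "i div p = Suc ((i - p) div p)" using True assms by (simp add: le_div_geq)
    moreover have "p dvd i \<longleftrightarrow> p dvd (i - p)" using True by (simp add: dvd_minus_self)
    moreover have "coeff [:a:] i = 0" using True assms by (simp add: coeff_pCons split: nat.split)
    ultimately show ?thesis using True by (simp add: eq coeff_monom_mult pCons.IH)
  next
    case False
    then have "p dvd i \<longleftrightarrow> i = 0" using dvd_imp_le by fastforce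
    then show ?thesis using False by (auto simp: eq coeff_monom_mult coeff_pCons split: nat.split)
  qed
qed

lemma expand_mult: "expand p (q * r) = expand p q * expand p r"
  by (simp add: expand_def pcompose_mult)

lemma expand_diff: "expand p (q - r) = expand p q - expand p r"
  by (simp add: expand_def pcompose_diff)

lemma expand_add: "expand p (q + r) = expand p q + expand p r"
  by (simp add: expand_def pcompose_add)

lemma expand_smult: "expand p (smult a q) = smult a (expand p q)"
  by (simp add: expand_def pcompose_smult)

lemma expand_const [simp]: "expand p [:a:] = [:a:]"
  by (simp add: expand_def pcompose_const)

lemma expand_inj: assumes "0 < p" "expand p q = expand p r" shows "q = r"
proof (rule poly_eqI)
  fix i show "coeff q i = coeff r i"
    using arg_cong[OF assms(2), of "\<lambda>s. coeff s (p * i)"] assms(1) by (simp add: coeff_expand)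
qed

lemma pderiv_expand:
  fixes q :: "'a::field poly"
  assumes "CHAR('a) = p" "0 < p" shows "pderiv (expand p q) = 0"
proof (rule poly_eqI)
  fix n
  show "coeff (pderiv (expand p q)) n = coeff 0 n"
    using of_nat_eq_0_iff_char_dvd[where ?'a = 'a, of "Suc n"] assms
    by (auto simp: coeff_pderiv coeff_expand simp del: of_nat_Suc)
qed

definition wronskian :: "'a::idom poly \<Rightarrow> 'a poly \<Rightarrow> 'a poly" where
  "wronskian A B = pderiv A * B - A * pderiv B"

text \<open>The first argument occupies the residue class \<open>\<epsilon>\<close>, which will be
  that of \<open>d\<close>. It therefore carries the leading coefficients, and the cases
  \<open>p dvd d\<close> and \<open>p dvd (d - 1)\<close> are handled together.\<close>

definition interleave :: "nat \<Rightarrow> nat \<Rightarrow> 'a::field poly \<Rightarrow> 'a poly \<Rightarrow> 'a poly" where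
  "interleave p \<epsilon> u w = monom 1 \<epsilon> * expand p u + monom 1 (1 - \<epsilon>) * expand p w"

definition residue_part :: "nat \<Rightarrow> nat \<Rightarrow> 'a::field poly \<Rightarrow> 'a poly" where
  "residue_part p r A = (\<Sum>i\<le>degree A. monom (coeff A (p * i + r)) i)"

lemma coeff_residue_part:
  assumes "0 < p" shows "coeff (residue_part p r A) i = coeff A (p * i + r)"
proof -
  have "i \<le> p * i + r" using assms by (metis le_add1 mult_le_mono1 nat_mult_1 less_eq_Suc_le One_nat_def le_trans)
  then have "coeff A (p * i + r) = 0" if "\<not> i \<le> degree A" using that by (intro coeff_eq_0) simp
  then show ?thesis by (auto simp: residue_part_def coeff_sum coeff_monom)
qed

lemma coeff_interleave:
  assumes "2 \<le> p" "\<epsilon> \<le> 1"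
  shows "coeff (interleave p \<epsilon> u w) k = (if k mod p = \<epsilon> then coeff u (k div p) else 0) +
    (if k mod p = 1 - \<epsilon> then coeff w (k div p) else 0)"
proof -
  have main: "coeff (monom 1 r * expand p q) k = (if k mod p = r then coeff q (k div p) else 0)"
    if r: "r \<le> 1" for r and q :: "'a poly"
  proof (cases "r \<le> k")
    case True
    have "p dvd (k - r) \<longleftrightarrow> k mod p = r"
      using True r assms(1) by (metis le_add_diff_inverse2 mod_eq_dvd_iff_nat mod_less nat_less_le
          One_nat_def le_trans numeral_2_eq_2 less_eq_Suc_le Suc_le_eq)
    moreover have "(k - r) div p = k div p" if "k mod p = r"
      using that by (metis minus_mod_eq_mult_div div_mult_self_is_m nonzero_mult_div_cancel_left mult.commute
          minus_mod_eq_div_mult nonzero_mult_div_cancel_right assms(1) not_numeral_le_zero)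
    ultimately show ?thesis using True assms(1) by (simp add: coeff_monom_mult coeff_expand)
  next
    case False
    then have "k = 0" "r = 1" using r by auto
    then show ?thesis by (simp add: coeff_monom_mult)
  qed
  show ?thesis unfolding interleave_def coeff_add using main[of \<epsilon> u] main[of "1 - \<epsilon>" w] assms by simp
qed

lemma residue_part_interleave:
  assumes "2 \<le> p" "\<epsilon> \<le> 1"
  shows "residue_part p \<epsilon> (interleave p \<epsilon> u w) = u"
    "residue_part p (1 - \<epsilon>) (interleave p \<epsilon> u w) = w"
proof -
  have "\<epsilon> = 0 \<or> \<epsilon> = 1" using assms by auto
  moreover have "(1 + p * n) mod p = 1" "(1 + p * n) div p = n" for n
    using assms(1) mod_mult_self2[of 1 p n] div_mult_self2[of p 1 n] by simp_all
  moreover have "\<not> p dvd (1 + p * n)" for n using calculation(2)[of n] by (simp add: dvd_eq_mod_eq_0)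
  ultimately show "residue_part p \<epsilon> (interleave p \<epsilon> u w) = u"
    "residue_part p (1 - \<epsilon>) (interleave p \<epsilon> u w) = w"
    using assms by (auto intro!: poly_eqI simp: coeff_residue_part coeff_interleave)
qed

text \<open>A vanishing second derivative means \<open>k * (k - 1) * coeff A k = 0\<close> for
  \<open>k \<ge> 2\<close>; if \<open>k mod p > 1\<close>, neither \<open>k\<close> nor
  \<open>k - 1\<close> is divisible by \<open>p\<close>, so the coefficient is 0.\<close>

lemma interleave_residue_parts:
  fixes A :: "'a::field poly"
  assumes p: "CHAR('a) = p" "prime p" and \<epsilon>: "\<epsilon> \<le> 1" and A: "pderiv (pderiv A) = 0"
  shows "interleave p \<epsilon> (residue_part p \<epsilon> A) (residue_part p (1 - \<epsilon>) A) = A"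
proof (rule poly_eqI)
  fix k
  have p2: "2 \<le> p" using p(2) prime_ge_2_nat by blast
  have e: "\<epsilon> = 0 \<or> \<epsilon> = 1" using \<epsilon> by auto
  show "coeff (interleave p \<epsilon> (residue_part p \<epsilon> A) (residue_part p (1 - \<epsilon>) A)) k = coeff A k"
  proof (cases "k mod p \<le> 1")
    case True
    have "p * (k div p) + k mod p = k" by simp
    then have "k mod p = 0 \<Longrightarrow> p * (k div p) = k" "k mod p = 1 \<Longrightarrow> Suc (p * (k div p)) = k"
      by linarith+
    then show ?thesis using True e p2 by (auto simp: coeff_interleave[OF p2 \<epsilon>] coeff_residue_part)
  next
    case False
    then have k: "2 \<le> k" using mod_less_eq_dividend[of k p] by linarith
    have "of_nat (Suc (k - 2)) * (of_nat (Suc (Suc (k - 2))) * coeff A (Suc (Suc (k - 2)))) = 0"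
      using arg_cong[OF A, of "\<lambda>q. coeff q (k - 2)"] by (simp only: coeff_pderiv coeff_0)
    then have "of_nat (k - 1) * (of_nat k * coeff A k) = 0"
      using k by (simp add: Suc_diff_le[symmetric] numeral_2_eq_2 del: of_nat_Suc)
    moreover have "\<not> p dvd k" using False by (auto simp: dvd_eq_mod_eq_0)
    moreover have "\<not> p dvd (k - 1)"
    proof
      assume "p dvd (k - 1)"
      then have "(k - 1 + 1) mod p = 1 mod p" by (metis mod_add_left_eq dvd_imp_mod_0 add_0)
      then show False using False k p2 by simp
    qed
    ultimately have "coeff A k = 0"
      using of_nat_eq_0_iff_char_dvd[where ?'a = 'a] p(1) by auto
    then show ?thesis using False e by (auto simp: coeff_interleave[OF p2 \<epsilon>])
  qed
qed

lemma interleave_add: "interleave p \<epsilon> (u + u') (w + w') = interleave p \<epsilon> u w + interleave p \<epsilon> u' w'"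
  by (simp add: interleave_def expand_add algebra_simps)

lemma interleave_smult: "interleave p \<epsilon> (smult a u) (smult a w) = smult a (interleave p \<epsilon> u w)"
  by (simp add: interleave_def expand_smult smult_add_right)

lemma pderiv_interleave:
  fixes u w :: "'a::field poly"
  assumes "CHAR('a) = p" "0 < p"
  shows "pderiv (interleave p 0 u w) = expand p w" "pderiv (interleave p 1 u w) = expand p u"
  by (simp_all add: interleave_def pderiv_add pderiv_mult pderiv_expand[OF assms] pderiv_pCons monom_altdef)

text \<open>Derivatives kill polynomials in \<open>z^p\<close>, so differentiating leaves only the
  part with exponents 1 modulo \<open>p\<close>, and the Wronskian collapses to a 2 x 2 determinant.
  Exchanging the two residue classes flips its sign.\<close>

lemma wronskian_interleave:
  fixes u w :: "'a::field poly"
  assumes "CHAR('a) = p" "0 < p" "\<epsilon> \<le> 1"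
  shows "wronskian (interleave p \<epsilon> x y) (interleave p \<epsilon> u w) = smult ((- 1) ^ \<epsilon>) (expand p (y * u - x * w))"
proof -
  have "\<epsilon> = 0 \<or> \<epsilon> = 1" using assms(3) by auto
  then show ?thesis
  proof
    assume "\<epsilon> = 0"
    then show ?thesis using pderiv_interleave(1)[OF assms(1,2)]
      by (simp add: wronskian_def expand_diff expand_mult)
         (simp add: interleave_def algebra_simps)
  next
    assume "\<epsilon> = 1"
    then show ?thesis using pderiv_interleave(2)[OF assms(1,2)]
      by (simp add: wronskian_def expand_diff expand_mult)
         (simp add: interleave_def algebra_simps)
  qed
qed

text \<open>The bound \<open>m + \<epsilon>\<close> says precisely that the \<open>w\<close> part
  stays below degree \<open>p * m + \<epsilon>\<close>: its terms have degree
  \<open>p * k + 1\<close> with \<open>k < m\<close> if \<open>\<epsilon> = 0\<close>, and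
  \<open>p * k\<close> with \<open>k \<le> m\<close> if \<open>\<epsilon> = 1\<close>.\<close>

lemma degree_interleave:
  assumes p: "2 \<le> p" "\<epsilon> \<le> 1" and u: "degree u = m" "u \<noteq> 0" and w: "\<And>k. m + \<epsilon> \<le> k \<Longrightarrow> coeff w k = 0"
  shows "degree (interleave p \<epsilon> u w) = p * m + \<epsilon>"
    "coeff (interleave p \<epsilon> u w) (p * m + \<epsilon>) = lead_coeff u"
proof -
  have e: "\<epsilon> = 0 \<or> \<epsilon> = 1" using p by auto
  then show lc: "coeff (interleave p \<epsilon> u w) (p * m + \<epsilon>) = lead_coeff u"
    using p u by (auto simp: coeff_interleave)
  show "degree (interleave p \<epsilon> u w) = p * m + \<epsilon>"
  proof (rule antisym)
    show "degree (interleave p \<epsilon> u w) \<le> p * m + \<epsilon>"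
    proof (rule degree_le, intro allI impI)
      fix k assume k: "p * m + \<epsilon> < k"
      have kd: "k = p * (k div p) + k mod p" by simp
      have "coeff u (k div p) = 0" if "k mod p = \<epsilon>"
      proof (rule coeff_eq_0)
        have "p * m < p * (k div p)" using k kd that by linarith
        then show "degree u < k div p" using u by simp
      qed
      moreover have "coeff w (k div p) = 0" if "k mod p = 1 - \<epsilon>"
      proof (rule w, rule ccontr)
        assume "\<not> m + \<epsilon> \<le> k div p"
        then have 1: "k div p + 1 \<le> m + \<epsilon>" by simp
        show False
        proof (cases "\<epsilon> = 0")
          case True
          then have "p * (k div p) + p \<le> p * m" using mult_le_mono2[OF 1, of p] by simp
          then show False using k kd that True p by linarith
        next
          case False
          then have "p * (k div p) \<le> p * m" using 1 e by simp
          then show False using k kd that False e by linarith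
        qed
      qed
      ultimately show "coeff (interleave p \<epsilon> u w) k = 0" by (simp add: coeff_interleave[OF p])
    qed
    show "p * m + \<epsilon> \<le> degree (interleave p \<epsilon> u w)" by (rule le_degree) (use lc u in auto)
  qed
qed

lemma coeff_residue_part_eq_0:
  assumes p: "2 \<le> p" "\<epsilon> \<le> 1" and A: "degree A \<le> p * m + \<epsilon>"
  shows "m < k \<Longrightarrow> coeff (residue_part p \<epsilon> A) k = 0"
    "m + \<epsilon> \<le> k \<Longrightarrow> coeff (residue_part p (1 - \<epsilon>) A) k = 0"
proof -
  have p0: "0 < p" using p by simp
  show "coeff (residue_part p \<epsilon> A) k = 0" if "m < k"
  proof -
    have "p * m + p \<le> p * k" using mult_le_mono2[of "m + 1" k p] that by simp
    then show ?thesis unfolding coeff_residue_part[OF p0] using A p by (intro coeff_eq_0) simp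
  qed
  show "coeff (residue_part p (1 - \<epsilon>) A) k = 0" if k: "m + \<epsilon> \<le> k"
  proof (cases "\<epsilon> = 0")
    case True
    then have "p * m \<le> p * k" using k by simp
    then have "degree A < p * k + (1 - \<epsilon>)" using A True by linarith
    then show ?thesis unfolding coeff_residue_part[OF p0] by (rule coeff_eq_0)
  next
    case False
    then have "\<epsilon> = 1" using p by simp
    then have "p * m + p \<le> p * k" using mult_le_mono2[of "m + 1" k p] k by simp
    then show ?thesis unfolding coeff_residue_part[OF p0] using A p by (intro coeff_eq_0) simp
  qed
qed

section \<open>Ramification read off from the Wronskian\<close>

lemma order_eq_1_iff:
  fixes C :: "'a::field poly"
  assumes "C \<noteq> 0" "poly C z = 0"
  shows "order z C = 1 \<longleftrightarrow> poly (pderiv C) z \<noteq> 0"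
proof -
  obtain Q where Q: "C = [:- z, 1:] * Q" using assms(2) by (auto simp: poly_eq_0_iff_dvd)
  have "poly (pderiv C) z = poly Q z" unfolding Q pderiv_mult by (simp add: pderiv_pCons)
  moreover have "order z C = 1 \<longleftrightarrow> \<not> [:- z, 1:] ^ 2 dvd C"
    using assms order_root[of C z] order_divides[of z 2 C] by auto
  moreover have "[:- z, 1:] ^ 2 dvd C \<longleftrightarrow> [:- z, 1:] dvd Q"
    unfolding Q power2_eq_square by (subst dvd_mult_cancel_left) auto
  ultimately show ?thesis by (simp add: poly_eq_0_iff_dvd)
qed

text \<open>The link to ramification: the fibre form through \<open>z\<close> has a simple zero at
  \<open>z\<close> iff the Wronskian does not vanish there.\<close>

lemma poly_wronskian:
  "poly (pderiv (fibre_poly d A B (Some z))) z = poly (wronskian A B) z"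
  by (simp add: fibre_poly_def eval_pt_def wronskian_def pderiv_diff pderiv_smult)

lemma fibre_poly_root: "poly (fibre_poly d A B (Some z)) z = 0"
  by (simp add: fibre_poly_def eval_pt_def)

text \<open>Unramified at every finite point, the pair has a Wronskian without roots, and over an
  algebraically closed field such a polynomial is a nonzero constant.\<close>

lemma wronskian_of_ram_pair:
  fixes A B :: "'a::alg_closed_field poly"
  assumes "ram_pair d e None A B" "0 < d"
  obtains w where "w \<noteq> 0" "wronskian A B = [:w:]"
proof -
  have "poly (wronskian A B) z \<noteq> 0" for z
  proof -
    have "order z (fibre_poly d A B (Some z)) = 1"
      using assms(1) by (auto simp: ram_pair_def zero_mult_def dest!: spec[of _ "Some z"])
    moreover have "fibre_poly d A B (Some z) \<noteq> 0"
      using fibre_poly_nonzero assms unfolding ram_pair_def by blast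
    ultimately show ?thesis using order_eq_1_iff[OF _ fibre_poly_root] poly_wronskian by metis
  qed
  then have "degree (wronskian A B) = 0" using alg_closed_imp_poly_has_root by blast
  then obtain w where "wronskian A B = [:w:]" using degree_eq_zeroE by blast
  moreover have "w \<noteq> 0" using \<open>poly (wronskian A B) 0 \<noteq> 0\<close> calculation by simp
  ultimately show ?thesis using that by blast
qed

text \<open>A nonzero constant Wronskian is itself a Bezout identity for \<open>A\<close> and
  \<open>B\<close>, with the derivatives as cofactors.\<close>

lemma wronskian_const_dvd:
  fixes A B :: "'a::field poly"
  assumes W: "wronskian A B = [:w:]" "w \<noteq> 0"
  shows "B dvd A * Q \<Longrightarrow> B dvd Q" "A dvd B * Q \<Longrightarrow> A dvd Q"
proof -
  have Q: "smult w Q = pderiv A * (B * Q) - pderiv B * (A * Q)"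
    using arg_cong[OF W(1), of "\<lambda>P. P * Q"] by (simp add: wronskian_def algebra_simps)
  show "B dvd Q" if "B dvd A * Q"
  proof -
    have "B dvd smult w Q" unfolding Q by (rule dvd_diff[OF dvd_mult[OF dvd_triv_left] dvd_mult[OF that]])
    then show ?thesis using W(2) by (rule dvd_smult_cancel)
  qed
  show "A dvd Q" if "A dvd B * Q"
  proof -
    have "A dvd smult w Q" unfolding Q by (rule dvd_diff[OF dvd_mult[OF that] dvd_mult[OF dvd_triv_left]])
    then show ?thesis using W(2) by (rule dvd_smult_cancel)
  qed
qed

lemma dvd_degree_less_imp_0:
  fixes A Q :: "'a::field poly"
  assumes "A dvd Q" "degree Q < degree A" shows "Q = 0"
  using dvd_imp_degree_le[OF assms(1)] assms(2) by (meson not_le)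

text \<open>Differentiating \<open>A' B - A B' = w\<close> gives \<open>A'' B = A B''\<close>; since \<open>A\<close> and \<open>B\<close> are
  coprime, \<open>A\<close> divides \<open>A''\<close>, which has smaller degree.\<close>

lemma wronskian_const_imp_second_deriv_0:
  fixes A B :: "'a::field poly"
  assumes W: "wronskian A B = [:w:]" "w \<noteq> 0"
  shows "pderiv (pderiv A) = 0" "pderiv (pderiv B) = 0"
proof -
  have "pderiv (wronskian A B) = 0" using W by (simp add: pderiv_pCons)
  then have eq: "B * pderiv (pderiv A) = A * pderiv (pderiv B)"
    by (simp add: wronskian_def pderiv_diff pderiv_mult algebra_simps)
  have less: "pderiv (pderiv C) = 0" if "C dvd pderiv (pderiv C)" for C :: "'a poly"
  proof (cases "degree C = 0")
    \<comment> \<open>For constant \<open>C\<close> the degree cannot drop, but the derivative is 0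
      anyway.\<close>
    case True
    then obtain a where "C = [:a:]" using degree_eq_zeroE by blast
    then show ?thesis by (simp add: pderiv_pCons)
  next
    case False
    have le: "degree (pderiv P) \<le> degree P - 1" for P :: "'a poly"
      by (rule degree_le) (auto simp: coeff_pderiv coeff_eq_0)
    have "degree (pderiv (pderiv C)) < degree C"
      using le[of C] le[of "pderiv C"] False by linarith
    then show ?thesis using dvd_degree_less_imp_0 that by blast
  qed
  have "A dvd B * pderiv (pderiv A)" unfolding eq by simp
  then show "pderiv (pderiv A) = 0" using less wronskian_const_dvd(2)[OF W] by blast
  have "B dvd A * pderiv (pderiv B)" unfolding eq[symmetric] by simp
  then show "pderiv (pderiv B) = 0" using less wronskian_const_dvd(1)[OF W] by blast
qed

text \<open>At infinity the value is infinity because \<open>degree B < d\<close>; the fibre form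
  there is a multiple of \<open>B\<close>, so its multiplicity is the degree deficit
  \<open>e\<close>.\<close>

lemma ram_pair_of_wronskian:
  fixes A B :: "'a::field poly"
  assumes W: "wronskian A B = [:w:]" "w \<noteq> 0" and A: "degree A = d" and B: "degree B = d - e"
    and de: "0 < e" "e \<le> d"
  shows "ram_pair d e None A B"
  unfolding ram_pair_def
proof (intro conjI allI)
  show "degree A \<le> d" "degree B \<le> d" using A B by auto
  show ns: "no_syzygy d A B"
    unfolding no_syzygy_def
  proof (intro allI impI)
    fix u q assume u: "\<forall>k\<ge>d. coeff u k = 0" and q: "\<forall>k\<ge>d. coeff q k = 0" and 0: "u * A + q * B = 0"
    have "B * q - A * (- u) = u * A + q * B" by (simp add: mult.commute)
    then have "B * q = A * (- u)" unfolding 0 by (simp only: right_minus_eq)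
    then have "A dvd B * q" by (rule dvdI)
    then have "A dvd q" using wronskian_const_dvd(2)[OF W] by blast
    moreover have "q = 0 \<or> degree q < d" using q by (metis leading_coeff_0_iff not_le)
    ultimately have q0: "q = 0" using dvd_degree_less_imp_0 A by blast
    then show "u = 0 \<and> q = 0" using 0 A de by auto
  qed
  fix x
  show "zero_mult d (fibre_poly d A B x) x = (if x = None then e else 1)"
  proof (cases x)
    case None
    have "coeff A d \<noteq> 0" using A de by (metis degree_0 leading_coeff_0_iff not_gr_zero order_less_le_trans)
    moreover have "coeff B d = 0" using B de by (intro coeff_eq_0) simp
    ultimately show ?thesis using None B de by (simp add: zero_mult_def fibre_poly_def eval_pt_def)
  next
    case (Some z)
    have ne: "fibre_poly d A B (Some z) \<noteq> 0"
      using fibre_poly_nonzero[OF ns] A B de by simp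
    have "poly (pderiv (fibre_poly d A B (Some z))) z \<noteq> 0"
      unfolding poly_wronskian using W by simp
    then have "order z (fibre_poly d A B (Some z)) = 1"
      using order_eq_1_iff[OF ne fibre_poly_root] by blast
    then show ?thesis using Some by (simp add: zero_mult_def)
  qed
qed

section \<open>Normal forms\<close>

definition rat_poly :: "nat \<Rightarrow> 'a::field list set \<Rightarrow> ('a list \<Rightarrow> 'a poly) \<Rightarrow> bool" where
  "rat_poly N S P \<longleftrightarrow> (\<forall>j. rat_fun N S (\<lambda>v. coeff (P v) j))"

lemma rat_polyD: "rat_poly N S P \<Longrightarrow> rat_fun N S (\<lambda>v. coeff (P v) j)"
  by (simp add: rat_poly_def)

lemma rat_poly_const: "rat_poly N S (\<lambda>_. Q)"
  by (simp add: rat_poly_def rat_fun_const)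

lemma rat_poly_add: "rat_poly N S P \<Longrightarrow> rat_poly N S Q \<Longrightarrow> rat_poly N S (\<lambda>v. P v + Q v)"
  by (simp add: rat_poly_def rat_fun_add)

lemma rat_poly_diff: "rat_poly N S P \<Longrightarrow> rat_poly N S Q \<Longrightarrow> rat_poly N S (\<lambda>v. P v - Q v)"
  by (simp add: rat_poly_def rat_fun_diff)

lemma rat_poly_minus: "rat_poly N S P \<Longrightarrow> rat_poly N S (\<lambda>v. - P v)"
  by (simp add: rat_poly_def rat_fun_minus)

lemma rat_poly_mult:
  assumes "rat_poly N S P" "rat_poly N S Q" shows "rat_poly N S (\<lambda>v. P v * Q v)"
  unfolding rat_poly_def coeff_mult
  by (intro allI rat_fun_sum rat_fun_mult rat_polyD assms)

lemma rat_poly_smult: "rat_fun N S a \<Longrightarrow> rat_poly N S P \<Longrightarrow> rat_poly N S (\<lambda>v. smult (a v) (P v))"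
  by (simp add: rat_poly_def rat_fun_mult)

lemma rat_poly_pderiv: "rat_poly N S P \<Longrightarrow> rat_poly N S (\<lambda>v. pderiv (P v))"
  by (simp add: rat_poly_def coeff_pderiv rat_fun_mult rat_fun_const)

lemma rat_poly_sum_monom:
  assumes "\<And>i. i < n \<Longrightarrow> rat_fun N S (a i)"
  shows "rat_poly N S (\<lambda>v. \<Sum>i<n. monom (a i v) i)"
proof -
  have "rat_fun N S (\<lambda>v. coeff (\<Sum>i<n. monom (a i v) i) j)" for j
    by (cases "j < n") (use assms in \<open>simp_all add: coeff_sum coeff_monom rat_fun_const\<close>)
  then show ?thesis by (simp add: rat_poly_def)
qed

lemma rat_poly_residue_part:
  "0 < p \<Longrightarrow> rat_poly N S P \<Longrightarrow> rat_poly N S (\<lambda>v. residue_part p r (P v))"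
  by (simp add: rat_poly_def coeff_residue_part)

lemma rat_poly_interleave:
  assumes "2 \<le> p" "\<epsilon> \<le> 1" "rat_poly N S P" "rat_poly N S Q"
  shows "rat_poly N S (\<lambda>v. interleave p \<epsilon> (P v) (Q v))"
proof -
  have "rat_fun N S (\<lambda>v. if b then coeff (R v) j else 0)" if "rat_poly N S R" for b j R
    using rat_polyD[OF that] rat_fun_const by (cases b) auto
  then show ?thesis
    using assms unfolding rat_poly_def[of _ _ "\<lambda>v. interleave p \<epsilon> (P v) (Q v)"]
    by (simp add: coeff_interleave rat_fun_add)
qed

lemma coeff_sum_monom: "coeff (\<Sum>i<n. monom (a i) i) j = (if j < n then a j else 0)"
  for a :: "nat \<Rightarrow> 'a::comm_monoid_add"
  by (simp add: coeff_sum coeff_monom)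

lemma sum_monom_coeff:
  fixes q :: "'a::comm_monoid_add poly"
  assumes "\<And>j. n \<le> j \<Longrightarrow> coeff q j = 0"
  shows "(\<Sum>i<n. monom (coeff q i) i) = q"
  by (rule poly_eqI) (use assms in \<open>simp add: coeff_sum_monom not_less\<close>)

lemma dvd_coeff_zero_imp_0:
  fixes u x :: "'a::field poly"
  assumes "u dvd x" "degree u = m" "\<And>j. m \<le> j \<Longrightarrow> coeff x j = 0" shows "x = 0"
proof (rule ccontr)
  assume x: "x \<noteq> 0"
  then have "m \<le> degree x" using dvd_imp_degree_le[OF assms(1)] assms(2) by simp
  then show False using assms(3) x by (metis leading_coeff_0_iff)
qed

lemma bezout_dvd:
  fixes u w x y z :: "'a::field poly"
  assumes "y * u - x * w = 1" "u dvd z * w" shows "u dvd z"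
proof -
  have "z = u * (z * y) - x * (z * w)"
    using arg_cong[OF assms(1), of "\<lambda>q. z * q"] by (simp add: algebra_simps)
  then show ?thesis using assms(2) by (metis dvd_diff dvd_mult dvd_triv_left)
qed

lemma degree_eq_degree_div:
  fixes x u :: "'a::field poly"
  assumes "u \<noteq> 0" "degree u \<le> degree x"
  shows "degree x = degree (x div u) + degree u"
proof -
  have x: "x = x div u * u + x mod u" by simp
  have r: "x mod u = 0 \<or> degree (x mod u) < degree u" using degree_mod_less[OF assms(1)] .
  show ?thesis
  proof (cases "x div u = 0")
    case True
    then have "x mod u = x" using x by simp
    then show ?thesis using r assms(2) True by auto
  next
    case False
    then have deg: "degree (x div u * u) = degree (x div u) + degree u"
      using assms(1) by (simp add: degree_mult_eq)
    show ?thesis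
    proof (cases "x mod u = 0")
      case True
      then have "x = x div u * u" using x by simp
      then show ?thesis using deg by simp
    next
      case False
      then have "degree (x div u * u + x mod u) = degree (x div u * u)"
        using r deg by (intro degree_add_eq_left) simp
      then show ?thesis using deg x by simp
    qed
  qed
qed

text \<open>Parameters replace division: \<open>\<epsilon>\<close> is the residue of
  \<open>d\<close> modulo \<open>p\<close>, \<open>k\<close> is \<open>e / p\<close>, and
  \<open>m\<close> is the quotient of \<open>d - e\<close> by \<open>p\<close>, which may be
  0.\<close>

locale wild_ramification =
  fixes p \<epsilon> m k :: nat and c :: "'a::alg_closed_field option"
  assumes char: "CHAR('a) = p" and p_prime: "prime p" and eps: "\<epsilon> \<le> 1" and k_pos: "0 < k"
begin

definition d where "d = p * (m + k) + \<epsilon>"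
definition e where "e = p * k"
definition N where "N = 2 * m + \<epsilon> + k"

lemma p2: "2 \<le> p" using p_prime prime_ge_2_nat by blast
lemma p0: "0 < p" using p2 by simp
lemma e_pos: "0 < e" using p0 k_pos by (simp add: e_def)
lemma e_le_d: "e \<le> d" by (simp add: e_def d_def algebra_simps)
lemma d_pos: "0 < d" using e_pos e_le_d by simp
lemma d_minus_e: "d - e = p * m + \<epsilon>" by (simp add: e_def d_def algebra_simps)
lemma N_pos: "0 < N" using k_pos by (simp add: N_def)

text \<open>Layout of a parameter list: the \<open>m\<close> lower coefficients of the monic
  \<open>u\<close>, then the \<open>m + \<epsilon>\<close> coefficients of \<open>w\<close>, then
  the coefficients 1 to \<open>k\<close> of \<open>g\<close>.\<close>

definition uP :: "'a list \<Rightarrow> 'a poly" where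
  "uP y = monom 1 m + (\<Sum>i<m. monom (y ! i) i)"

definition wP :: "'a list \<Rightarrow> 'a poly" where
  "wP y = (\<Sum>i<m + \<epsilon>. monom (y ! (m + i)) i)"

definition gP :: "'a list \<Rightarrow> 'a poly" where
  "gP y = monom 1 1 * (\<Sum>i<k. monom (y ! (2 * m + \<epsilon> + i)) i)"

text \<open>Combinations of these \<open>2 * m + 1\<close> polynomials of degree at most
  \<open>2 * m\<close> are the expressions \<open>Y * u - X * w\<close> with
  \<open>deg X < m\<close>. Taking \<open>m + 1\<close> multiples of \<open>u\<close> keeps the
  constant 1 in the span also for \<open>m = 0\<close>.\<close>

definition basis :: "'a list \<Rightarrow> nat \<Rightarrow> 'a poly" where
  "basis y i = (if i < m + 1 then monom 1 i * uP y else - monom 1 (i - (m + 1)) * wP y)"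

text \<open>The determinant expresses coprimality of \<open>u\<close> and \<open>w\<close>, and the
  last coordinate is the top coefficient of \<open>g\<close>, so that \<open>g\<close> has degree
  exactly \<open>k\<close>. A single nonvanishing condition makes openness immediate.\<close>

definition V :: "'a list set" where
  "V = {y. length y = N \<and> det (coeff_mat (2 * m + 1) (basis y)) * y ! (N - 1) \<noteq> 0}"

lemma coeff_uP: "coeff (uP y) j = (if j = m then 1 else if j < m then y ! j else 0)"
  by (simp add: uP_def coeff_sum_monom coeff_monom)

lemma coeff_wP: "coeff (wP y) j = (if j < m + \<epsilon> then y ! (m + j) else 0)"
  by (simp add: wP_def coeff_sum_monom)

lemma coeff_gP: "coeff (gP y) j = (if 0 < j \<and> j \<le> k then y ! (2 * m + \<epsilon> + (j - 1)) else 0)"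
  by (auto simp: gP_def coeff_sum_monom coeff_monom_mult)

lemma degree_uP: "degree (uP y) = m"
  by (rule antisym) (auto intro!: degree_le le_degree simp: coeff_uP)

lemma uP_nonzero: "uP y \<noteq> 0"
  using coeff_uP[of y m] by auto

lemma lead_coeff_uP: "lead_coeff (uP y) = 1"
  by (simp add: degree_uP coeff_uP)

lemma degree_gP: "y \<in> V \<Longrightarrow> degree (gP y) = k" "y \<in> V \<Longrightarrow> coeff (gP y) k \<noteq> 0"
proof -
  assume y: "y \<in> V"
  have "2 * m + \<epsilon> + (k - 1) = N - 1" using k_pos by (simp add: N_def)
  then show ne: "coeff (gP y) k \<noteq> 0" using y k_pos by (simp add: coeff_gP V_def)
  show "degree (gP y) = k"
    by (rule antisym) (use ne in \<open>auto intro!: degree_le le_degree simp: coeff_gP\<close>)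
qed

lemma rat_uP: "rat_poly N S uP"
proof -
  have "rat_poly N S (\<lambda>y. monom 1 m + (\<Sum>i<m. monom (y ! i) i))"
    by (intro rat_poly_add rat_poly_const rat_poly_sum_monom rat_fun_nth) (simp add: N_def)
  then show ?thesis by (simp add: uP_def[abs_def])
qed

lemma rat_wP: "rat_poly N S wP"
  unfolding wP_def[abs_def] by (intro rat_poly_sum_monom rat_fun_nth) (simp add: N_def)

lemma rat_gP: "rat_poly N S gP"
  unfolding gP_def[abs_def]
  by (intro rat_poly_mult rat_poly_const rat_poly_sum_monom rat_fun_nth) (simp add: N_def)

lemma rat_basis: "rat_poly N S (\<lambda>y. basis y i)"
  by (cases "i < m + 1")
     (simp_all add: basis_def rat_poly_mult rat_poly_const rat_uP rat_wP rat_poly_minus)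

lemma coeff_basis_0: "i < 2 * m + 1 \<Longrightarrow> 2 * m + 1 \<le> j \<Longrightarrow> coeff (basis y i) j = 0"
  using eps by (auto simp: basis_def coeff_monom_mult coeff_uP coeff_wP)

lemma sum_basis:
  "(\<Sum>i<2 * m + 1. smult (a i) (basis y i)) =
    (\<Sum>i<m + 1. monom (a i) i) * uP y - (\<Sum>i<m. monom (a (m + 1 + i)) i) * wP y"
proof -
  have "(\<Sum>i<2 * m + 1. smult (a i) (basis y i)) = (\<Sum>i<m + 1 + m. smult (a i) (basis y i))"
    by (simp add: mult_2)
  also have "\<dots> = (\<Sum>i<m + 1. smult (a i) (basis y i)) +
      (\<Sum>i<m. smult (a (m + 1 + i)) (basis y (m + 1 + i)))"
    by (rule sum_lessThan_add)
  also have "(\<Sum>i<m + 1. smult (a i) (basis y i)) = (\<Sum>i<m + 1. monom (a i) i) * uP y"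
    unfolding sum_distrib_right
    by (rule sum.cong) (auto simp: basis_def smult_monom mult_smult_left[symmetric] simp del: mult_smult_left)
  also have "(\<Sum>i<m. smult (a (m + 1 + i)) (basis y (m + 1 + i))) =
      - ((\<Sum>i<m. monom (a (m + 1 + i)) i) * wP y)"
    unfolding sum_distrib_right sum_negf[symmetric]
    by (rule sum.cong) (auto simp: basis_def smult_monom mult_smult_left[symmetric] simp del: mult_smult_left)
  finally show ?thesis by simp
qed

text \<open>From \<open>Y * u = X * w\<close> and coprimality, \<open>u\<close> divides
  \<open>X\<close>, which has no coefficients from degree \<open>m\<close> on; hence
  \<open>X\<close>, and then \<open>Y\<close>, vanishes.\<close>

lemma bezout_imp_independent:
  assumes "y' * uP y - x' * wP y = 1" "(\<Sum>i<2 * m + 1. smult (a i) (basis y i)) = 0"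
    and "i < 2 * m + 1"
  shows "a i = 0"
proof -
  define Y where "Y = (\<Sum>i<m + 1. monom (a i) i)"
  define X where "X = (\<Sum>i<m. monom (a (m + 1 + i)) i)"
  have eq: "Y * uP y = X * wP y" using assms(2) unfolding sum_basis X_def Y_def by simp
  have "uP y dvd X" by (rule bezout_dvd[OF assms(1)]) (use eq in \<open>metis dvd_triv_right\<close>)
  then have X: "X = 0"
    by (rule dvd_coeff_zero_imp_0[OF _ degree_uP]) (simp add: X_def coeff_sum_monom)
  then have Y: "Y = 0" using eq uP_nonzero by simp
  show ?thesis
  proof (cases "i < m + 1")
    case True then show ?thesis using arg_cong[OF Y, of "\<lambda>q. coeff q i"]
      unfolding Y_def coeff_sum_monom by simp
  next
    case False
    then obtain j where j: "i = m + 1 + j" using le_Suc_ex not_less by blast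
    then show ?thesis using assms(3) arg_cong[OF X, of "\<lambda>q. coeff q j"]
      unfolding X_def coeff_sum_monom by simp
  qed
qed

lemma bezout_imp_V:
  assumes "y' * uP y - x' * wP y = 1" "length y = N" "y ! (N - 1) \<noteq> 0"
  shows "y \<in> V"
proof -
  have "det (coeff_mat (2 * m + 1) (basis y)) \<noteq> 0"
    using det_coeff_mat_nonzero_iff[of "2 * m + 1" "basis y"] coeff_basis_0
      bezout_imp_independent[OF assms(1)] by blast
  then show ?thesis using assms by (simp add: V_def)
qed

lemma openin_V: "openin (zariski N) V"
  unfolding V_def
  by (intro openin_rat_fun_nonzero rat_fun_mult rat_fun_det_coeff_mat rat_polyD[OF rat_basis] rat_fun_nth)
     (use N_pos in simp)

lemma V_nonempty: "V \<noteq> {}"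
proof -
  \<comment> \<open>For \<open>m > 0\<close>, entry \<open>m\<close> is the constant coefficient of
    \<open>w\<close>, which makes \<open>w = 1\<close>; for \<open>m = 0\<close> already
    \<open>u = 1\<close>. Entry \<open>N - 1\<close> is the top coefficient of
    \<open>g\<close>.\<close>
  define y :: "'a list" where "y = (replicate N 0)[m := 1, N - 1 := 1]"
  have y: "length y = N" "y ! (N - 1) \<noteq> 0"
    using N_pos by (auto simp: y_def)
  have yn: "y ! i = (if i = m \<or> i = N - 1 then 1 else 0)" if "i < N" for i
    using that by (auto simp: y_def nth_list_update)
  have "\<exists>y' x'. y' * uP y - x' * wP y = 1"
  proof (cases "m = 0")
    case True
    then have "uP y = 1" unfolding uP_def by simp
    then show ?thesis by (intro exI[of _ 1] exI[of _ 0]) simp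
  next
    case False
    have "wP y = 1"
      by (rule poly_eqI) (use False k_pos in \<open>auto simp: coeff_wP yn N_def\<close>)
    then show ?thesis by (intro exI[of _ 0] exI[of _ "- 1"]) simp
  qed
  then show ?thesis using bezout_imp_V y by blast
qed

text \<open>On \<open>V\<close> the solution is unique by independence, so the choice is harmless
  and Cramer's rule shows its coordinates to be rational.\<close>

definition sol :: "'a list \<Rightarrow> nat \<Rightarrow> 'a" where
  "sol y = (SOME a. (\<Sum>i<2 * m + 1. smult (a i) (basis y i)) = 1)"

definition xP :: "'a list \<Rightarrow> 'a poly" where "xP y = (\<Sum>i<m. monom (sol y (m + 1 + i)) i)"
definition yP :: "'a list \<Rightarrow> 'a poly" where "yP y = (\<Sum>i<m + 1. monom (sol y i) i)"

lemma sum_sol: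
  assumes "y \<in> V" shows "(\<Sum>i<2 * m + 1. smult (sol y i) (basis y i)) = 1"
proof -
  have "det (coeff_mat (2 * m + 1) (basis y)) \<noteq> 0" using assms by (auto simp: V_def)
  then obtain a where "(\<Sum>i<2 * m + 1. smult (a i) (basis y i)) = 1"
    by (rule det_coeff_mat_solvable[of "2 * m + 1" "basis y" 1]) (auto simp: coeff_basis_0)
  then show ?thesis unfolding sol_def
    by (rule someI[of "\<lambda>a. (\<Sum>i<2 * m + 1. smult (a i) (basis y i)) = 1"])
qed

lemma bezout: "y \<in> V \<Longrightarrow> yP y * uP y - xP y * wP y = 1"
  using sum_sol[of y] unfolding sum_basis by (simp add: xP_def yP_def)

lemma rat_sol:
  assumes "i < 2 * m + 1" shows "rat_fun N V (\<lambda>y. sol y i)"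
proof (rule rat_fun_basis_coordinates[where n = "2 * m + 1" and P = basis and Q = "\<lambda>_. 1"])
  fix y a j assume "y \<in> V" "(\<Sum>i<2 * m + 1. smult (a i) (basis y i)) = 0" "j < 2 * m + 1"
  then show "a j = 0" using bezout_imp_independent[OF bezout] by blast
qed (use assms in \<open>simp_all only: coeff_basis_0 rat_polyD[OF rat_basis] rat_fun_const sum_sol\<close>)

lemma rat_xP: "rat_poly N V xP"
  unfolding xP_def[abs_def] by (intro rat_poly_sum_monom rat_sol) simp

lemma rat_yP: "rat_poly N V yP"
  unfolding yP_def[abs_def] by (intro rat_poly_sum_monom rat_sol) simp

text \<open>The general Bezout solution is \<open>(x + g * u, y + g * w)\<close> with
  \<open>(x, y)\<close> reduced. A constant term of \<open>g\<close> would only add a multiple of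
  \<open>fB y\<close>, which postcomposition removes.\<close>

definition fA :: "'a list \<Rightarrow> 'a poly" where
  "fA y = interleave p \<epsilon> (xP y + gP y * uP y) (yP y + gP y * wP y)"

definition fB :: "'a list \<Rightarrow> 'a poly" where
  "fB y = interleave p \<epsilon> (uP y) (wP y)"

lemma rat_fA: "rat_poly N V fA"
  unfolding fA_def[abs_def]
  by (intro rat_poly_interleave[OF p2 eps] rat_poly_add rat_poly_mult rat_xP rat_yP rat_uP rat_wP rat_gP)

lemma rat_fB: "rat_poly N V fB"
  unfolding fB_def[abs_def] by (intro rat_poly_interleave[OF p2 eps] rat_uP rat_wP)

lemma degree_fB: "degree (fB y) = d - e" "coeff (fB y) (d - e) = 1"
  using degree_interleave[OF p2 eps degree_uP uP_nonzero, of "wP y" y] lead_coeff_uP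
  unfolding fB_def d_minus_e by (auto simp: coeff_wP degree_uP)

text \<open>The product \<open>gP y * uP y\<close> of degree \<open>m + k\<close> dominates
  \<open>xP y\<close>, whose degree is below \<open>m + k\<close>, and supplies the leading
  coefficient.\<close>

lemma degree_fA:
  assumes y: "y \<in> V" shows "degree (fA y) = d" "coeff (fA y) d \<noteq> 0"
proof -
  have gu: "degree (gP y * uP y) = m + k"
    using degree_gP[OF y] degree_uP[of y] uP_nonzero[of y]
    by (subst degree_mult_eq) auto
  have "degree (xP y) < m + k"
  proof (cases "xP y = 0")
    case False
    then have "degree (xP y) < m" by (metis xP_def coeff_sum_monom leading_coeff_0_iff)
    then show ?thesis by simp
  qed (use k_pos in simp)
  then have deg: "degree (xP y + gP y * uP y) = m + k"
    using gu by (subst degree_add_eq_right) auto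
  have ne: "xP y + gP y * uP y \<noteq> 0" using deg k_pos by auto
  have w: "coeff (yP y + gP y * wP y) j = 0" if j: "m + k + \<epsilon> \<le> j" for j
  proof -
    have "coeff (yP y) j = 0" using j k_pos by (simp add: yP_def coeff_sum_monom)
    moreover have "coeff (gP y * wP y) j = 0"
    proof (cases "wP y = 0")
      case False
      then have "degree (wP y) < m + \<epsilon>" by (metis coeff_wP leading_coeff_0_iff)
      then show ?thesis using degree_mult_le[of "gP y" "wP y"] degree_gP[OF y] j
        by (intro coeff_eq_0) simp
    qed simp
    ultimately show ?thesis by simp
  qed
  show "degree (fA y) = d"
    unfolding fA_def d_def by (rule degree_interleave(1)[OF p2 eps deg ne w])
  have "coeff (fA y) d = lead_coeff (xP y + gP y * uP y)"
    unfolding fA_def d_def by (rule degree_interleave(2)[OF p2 eps deg ne w])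
  then show "coeff (fA y) d \<noteq> 0" using ne leading_coeff_0_iff by metis
qed

lemma wronskian_f:
  assumes "y \<in> V" shows "wronskian (fA y) (fB y) = [:(- 1) ^ \<epsilon>:]"
proof -
  have "(yP y + gP y * wP y) * uP y - (xP y + gP y * uP y) * wP y = 1"
    using bezout[OF assms] by (simp add: algebra_simps)
  then show ?thesis unfolding fA_def fB_def wronskian_interleave[OF char p0 eps]
    by (simp add: one_pCons)
qed

lemma ram_pair_f: "y \<in> V \<Longrightarrow> ram_pair d e None (fA y) (fB y)"
  by (rule ram_pair_of_wronskian[OF wronskian_f _ degree_fA(1) degree_fB(1) e_pos e_le_d]) simp_all

text \<open>Coefficients at \<open>d\<close> and \<open>d - e\<close> show that the matrix is upper
  triangular with \<open>t = 1\<close>; the Wronskians give \<open>a = 1\<close>. Then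
  \<open>u\<close> divides the difference of the two reduced solutions, which is therefore 0, and
  the remaining \<open>b\<close> is a constant term, excluded in \<open>g\<close>.\<close>

lemma f_inj:
  assumes y: "y \<in> V" "y' \<in> V" and eqv: "gl2_equiv (fA y, fB y) (fA y', fB y')"
  shows "y = y'"
proof -
  obtain a b s t where *: "fA y' = smult a (fA y) + smult b (fB y)"
    "fB y' = smult s (fA y) + smult t (fB y)"
    using eqv unfolding gl2_equiv_def by auto
  have Bd: "coeff (fB z) d = 0" for z
    using degree_fB(1) e_pos e_le_d by (intro coeff_eq_0) simp
  have "s = 0" using arg_cong[OF *(2), of "\<lambda>q. coeff q d"] Bd degree_fA(2)[OF y(1)] by simp
  then have "t = 1" using arg_cong[OF *(2), of "\<lambda>q. coeff q (d - e)"] degree_fB(2) by simp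
  then have B: "fB y' = fB y" using * \<open>s = 0\<close> by simp
  then have u: "uP y' = uP y" and w: "wP y' = wP y"
    using residue_part_interleave[OF p2 eps] unfolding fB_def by metis+
  have "wronskian (fA y') (fB y') = smult a (wronskian (fA y) (fB y))"
    unfolding *(1) B
    by (simp add: wronskian_def pderiv_add pderiv_smult smult_diff_right algebra_simps)
  then have "a = 1" using wronskian_f y by simp
  then have "residue_part p \<epsilon> (fA y') = residue_part p \<epsilon> (interleave p \<epsilon>
      (xP y + gP y * uP y + smult b (uP y)) (yP y + gP y * wP y + smult b (wP y)))"
    using *(1) by (simp add: fA_def fB_def interleave_add interleave_smult)
  then have X: "xP y' + gP y' * uP y = xP y + gP y * uP y + smult b (uP y)"
    unfolding fA_def residue_part_interleave[OF p2 eps] u .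
  then have D: "xP y' - xP y = uP y * (gP y + [:b:] - gP y')" by (simp add: algebra_simps)
  have "xP y' - xP y = 0"
    by (rule dvd_coeff_zero_imp_0[OF dvdI[OF D] degree_uP]) (simp add: xP_def coeff_sum_monom)
  then have "gP y + [:b:] - gP y' = 0" using D uP_nonzero[of y] by simp
  then have g: "gP y' = gP y + [:b:]" by (simp only: right_minus_eq)
  have "b = 0" using arg_cong[OF g, of "\<lambda>q. coeff q 0"] by (simp add: coeff_gP)
  then have g: "gP y' = gP y" using g by simp
  have len: "length y = N" "length y' = N" using y by (auto simp: V_def)
  show "y = y'"
  proof (rule nth_equalityI)
    fix i assume "i < length y"
    then have i: "i < N" using len by simp
    consider "i < m" | "m \<le> i" "i < 2 * m + \<epsilon>" | "2 * m + \<epsilon> \<le> i" by linarith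
    then show "y ! i = y' ! i"
    proof cases
      case 1 then show ?thesis using arg_cong[OF u, of "\<lambda>q. coeff q i"] by (simp add: coeff_uP)
    next
      case 2
      then obtain j where "i = m + j" using le_Suc_ex by blast
      then show ?thesis using 2 arg_cong[OF w, of "\<lambda>q. coeff q j"] by (simp add: coeff_wP)
    next
      case 3
      then obtain j where "i = 2 * m + \<epsilon> + j" using le_Suc_ex by blast
      then show ?thesis using i arg_cong[OF g, of "\<lambda>q. coeff q (Suc j)"]
        by (simp add: coeff_gP N_def)
    qed
  qed (use len in simp)
qed

text \<open>Postcomposition that moves the value at infinity to infinity: the coefficient at
  \<open>d\<close> cancels, and the degree falls to \<open>d - e\<close>.\<close>

definition reduced :: "'a poly \<Rightarrow> 'a poly \<Rightarrow> 'a poly" where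
  "reduced A B = B - smult (coeff B d / coeff A d) A"

definition lead_reduced :: "'a poly \<Rightarrow> 'a poly \<Rightarrow> 'a" where
  "lead_reduced A B = coeff (reduced A B) (d - e)"

text \<open>Chosen so that, once \<open>reduced A B\<close> is divided by its leading coefficient,
  the Wronskian becomes \<open>(- 1) ^ \<epsilon>\<close>, that is,
  \<open>y * u - x * w = 1\<close>.\<close>

definition scale :: "'a poly \<Rightarrow> 'a poly \<Rightarrow> 'a" where
  "scale A B = (- 1) ^ \<epsilon> * lead_reduced A B / coeff (wronskian A B) 0"

definition u_of :: "'a poly \<Rightarrow> 'a poly \<Rightarrow> 'a poly" where
  "u_of A B = smult (1 / lead_reduced A B) (residue_part p \<epsilon> (reduced A B))"

definition w_of :: "'a poly \<Rightarrow> 'a poly \<Rightarrow> 'a poly" where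
  "w_of A B = smult (1 / lead_reduced A B) (residue_part p (1 - \<epsilon>) (reduced A B))"

definition x_of :: "'a poly \<Rightarrow> 'a poly \<Rightarrow> 'a poly" where
  "x_of A B = smult (scale A B) (residue_part p \<epsilon> A)"

definition y_of :: "'a poly \<Rightarrow> 'a poly \<Rightarrow> 'a poly" where
  "y_of A B = smult (scale A B) (residue_part p (1 - \<epsilon>) A)"

text \<open>Division by \<open>u\<close> separates the reduced Bezout solution (the remainder) from
  \<open>g\<close> plus a constant (the quotient); \<open>normal_form\<close> drops that constant by
  starting at \<open>Suc i\<close>.\<close>

definition q_of :: "'a poly \<Rightarrow> 'a poly \<Rightarrow> 'a poly" where
  "q_of A B = x_of A B div u_of A B"

definition normal_form :: "'a poly \<Rightarrow> 'a poly \<Rightarrow> 'a list" where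
  "normal_form A B = map (coeff (u_of A B)) [0..<m] @ map (coeff (w_of A B)) [0..<m + \<epsilon>] @
     map (\<lambda>i. coeff (q_of A B) (Suc i)) [0..<k]"

lemma normal_form_coords:
  assumes "ram_pair d e None A B" "coeff A d \<noteq> 0"
  shows "degree (reduced A B) = d - e" "lead_reduced A B \<noteq> 0"
    "degree (u_of A B) = m" "coeff (u_of A B) m = 1" "\<And>j. m + \<epsilon> \<le> j \<Longrightarrow> coeff (w_of A B) j = 0"
    "y_of A B * u_of A B - x_of A B * w_of A B = 1" "scale A B \<noteq> 0"
    "interleave p \<epsilon> (u_of A B) (w_of A B) = smult (1 / lead_reduced A B) (reduced A B)"
    "interleave p \<epsilon> (x_of A B) (y_of A B) = smult (scale A B) A"
    "degree (x_of A B) = m + k"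
proof -
  define C where "C = reduced A B"
  define l where "l = lead_reduced A B"
  have deg: "degree A \<le> d" "degree B \<le> d" using assms(1) by (auto simp: ram_pair_def)
  have dA: "degree A = d" using deg le_degree[OF assms(2)] by simp
  \<comment> \<open>At infinity the fibre form is a multiple of the reduced denominator, so the
    ramification index fixes the degree of the latter.\<close>
  have "fibre_poly d A B None = smult (- coeff A d) C"
    using assms(2) by (simp add: fibre_poly_def eval_pt_def C_def reduced_def smult_diff_right)
  then have "d - degree C = e"
    using assms unfolding ram_pair_def by (auto simp: zero_mult_def dest!: spec[of _ None])
  then show dC: "degree (reduced A B) = d - e" using e_pos unfolding C_def by linarith
  obtain w0 where w0: "w0 \<noteq> 0" "wronskian A B = [:w0:]"
    using wronskian_of_ram_pair[OF assms(1) d_pos] by blast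
  \<comment> \<open>Subtracting a multiple of \<open>A\<close> from \<open>B\<close> leaves the
    Wronskian unchanged.\<close>
  have WC: "wronskian A C = [:w0:]"
    using w0(2) by (simp add: C_def reduced_def wronskian_def pderiv_diff pderiv_smult algebra_simps)
  have "C \<noteq> 0" using WC w0(1) by (auto simp: wronskian_def)
  then show l: "lead_reduced A B \<noteq> 0"
    using dC unfolding lead_reduced_def C_def by (metis leading_coeff_0_iff)
  have sc: "scale A B = (- 1) ^ \<epsilon> * l / w0" by (simp add: scale_def w0 l_def)
  then show s: "scale A B \<noteq> 0" using l w0 by (simp add: l_def)
  have AA: "pderiv (pderiv A) = 0" and CC: "pderiv (pderiv C) = 0"
    using wronskian_const_imp_second_deriv_0[OF WC w0(1)] by auto
  show iC: "interleave p \<epsilon> (u_of A B) (w_of A B) = smult (1 / lead_reduced A B) (reduced A B)"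
    unfolding u_of_def w_of_def interleave_smult
    using interleave_residue_parts[OF char p_prime eps CC] by (simp add: C_def)
  show iA: "interleave p \<epsilon> (x_of A B) (y_of A B) = smult (scale A B) A"
    unfolding x_of_def y_of_def interleave_smult
    using interleave_residue_parts[OF char p_prime eps AA] by simp
  have C_le: "degree C \<le> p * m + \<epsilon>" using dC d_minus_e by (simp add: C_def)
  have A_le: "degree A \<le> p * (m + k) + \<epsilon>" using dA by (simp add: d_def)
  show um: "coeff (u_of A B) m = 1"
    using l p0 by (simp add: u_of_def coeff_residue_part lead_reduced_def d_minus_e)
  have "coeff (u_of A B) j = 0" if "m < j" for j
    using coeff_residue_part_eq_0(1)[OF p2 eps C_le that] by (simp add: u_of_def C_def)
  then show "degree (u_of A B) = m"
    using um by (intro antisym degree_le le_degree) auto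
  show "coeff (w_of A B) j = 0" if "m + \<epsilon> \<le> j" for j
    using coeff_residue_part_eq_0(2)[OF p2 eps C_le that] by (simp add: w_of_def C_def)
  have "coeff (x_of A B) j = 0" if "m + k < j" for j
    using coeff_residue_part_eq_0(1)[OF p2 eps A_le that] by (simp add: x_of_def)
  moreover have "coeff (x_of A B) (m + k) \<noteq> 0"
    using s assms(2) p0 by (simp add: x_of_def coeff_residue_part d_def)
  ultimately show "degree (x_of A B) = m + k" by (intro antisym degree_le le_degree) auto
  have "wronskian (smult (scale A B) A) (smult (1 / l) C) = smult (scale A B / l) (wronskian A C)"
    by (simp add: wronskian_def pderiv_smult smult_diff_right)
  also have "\<dots> = [:(- 1) ^ \<epsilon>:]" unfolding WC sc using w0(1) l by (simp add: l_def)
  finally have "smult ((- 1) ^ \<epsilon>) (expand p (y_of A B * u_of A B - x_of A B * w_of A B)) =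
      smult ((- 1) ^ \<epsilon>) (expand p [:1:])"
    using wronskian_interleave[OF char p0 eps, of "x_of A B" "y_of A B" "u_of A B" "w_of A B"]
    unfolding iA iC by (simp add: l_def C_def)
  then have "expand p (y_of A B * u_of A B - x_of A B * w_of A B) = expand p [:1:]"
    by (rule smult_cancel[rotated]) simp
  then have "y_of A B * u_of A B - x_of A B * w_of A B = [:1:]" by (rule expand_inj[OF p0])
  then show "y_of A B * u_of A B - x_of A B * w_of A B = 1" by (simp add: one_pCons)
qed

lemma length_normal_form: "length (normal_form A B) = N"
  by (simp add: normal_form_def N_def)

text \<open>The remainder of \<open>x_of A B\<close> modulo \<open>u_of A B\<close> is the reduced
  Bezout solution, and the quotient without its constant coefficient is \<open>g\<close>. The
  dropped constant is absorbed by subtracting a multiple of the denominator from the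
  numerator.\<close>

lemma normal_form_correct:
  assumes "ram_pair d e None A B" "coeff A d \<noteq> 0"
  shows "normal_form A B \<in> V"
    "gl2_equiv (A, B) (fA (normal_form A B), fB (normal_form A B))"
proof -
  note nc = normal_form_coords[OF assms]
  define y where "y = normal_form A B"
  define u where "u = u_of A B"
  define w where "w = w_of A B"
  define X where "X = x_of A B"
  define Y where "Y = y_of A B"
  define q where "q = q_of A B"
  define r where "r = X mod u"
  have len: "length y = N" by (simp add: y_def length_normal_form)
  have nth1: "y ! i = coeff u i" if "i < m" for i
    using that by (simp add: y_def normal_form_def nth_append u_def)
  have nth2: "y ! (m + i) = coeff w i" if "i < m + \<epsilon>" for i
    using that by (simp add: y_def normal_form_def nth_append w_def)
  have nth3: "y ! (2 * m + \<epsilon> + i) = coeff q (Suc i)" if "i < k" for i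
    using that by (simp add: y_def normal_form_def nth_append q_def)
  have u0: "u \<noteq> 0" using nc(4) by (auto simp: u_def)
  have uy: "uP y = u"
  proof (rule poly_eqI)
    fix j show "coeff (uP y) j = coeff u j"
      using nc(3,4) nth1[of j] by (cases j m rule: linorder_cases) (auto simp: coeff_uP u_def coeff_eq_0)
  qed
  have wy: "wP y = w"
  proof (rule poly_eqI)
    fix j show "coeff (wP y) j = coeff w j"
      using nc(5)[of j] nth2[of j] by (auto simp: coeff_wP w_def)
  qed
  have X: "X = q * u + r" by (simp add: q_def q_of_def X_def u_def r_def)
  have r: "coeff r j = 0" if "m \<le> j" for j
  proof (cases "r = 0")
    case False
    then have "degree r < m" using degree_mod_less[OF u0, of X] nc(3) by (simp add: r_def u_def)
    then show ?thesis using that by (intro coeff_eq_0) simp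
  qed simp
  have degX: "degree X = m + k" using nc(10) by (simp add: X_def)
  have degq: "degree q = k"
    using degree_eq_degree_div[OF u0, of X] degX nc(3) by (simp add: q_def q_of_def X_def u_def)
  then have q0: "q \<noteq> 0" using k_pos by auto
  have gy: "gP y = q - [:coeff q 0:]"
  proof (rule poly_eqI)
    fix j show "coeff (gP y) j = coeff (q - [:coeff q 0:]) j"
    proof (cases j)
      case (Suc i)
      then show ?thesis using nth3[of i] degq by (auto simp: coeff_gP coeff_eq_0)
    qed (simp add: coeff_gP)
  qed
  have bez: "Y * u - X * w = 1" using nc(6) by (simp add: Y_def u_def X_def w_def)
  have "y ! (N - 1) = coeff q k" using nth3[of "k - 1"] k_pos by (simp add: N_def)
  then have last: "y ! (N - 1) \<noteq> 0" using degq q0 by (metis leading_coeff_0_iff)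
  show V: "normal_form A B \<in> V"
    using bezout_imp_V[OF _ len last] bez uy wy unfolding y_def by blast
  then have yV: "y \<in> V" by (simp add: y_def)
  have bez': "yP y * u - xP y * w = 1" using bezout[OF yV] uy wy by simp
  \<comment> \<open>Two Bezout solutions for the same \<open>u\<close> and \<open>w\<close> are
    compared: after reduction modulo \<open>u\<close> their \<open>x\<close> parts must
    agree.\<close>
  have diff: "(r - xP y) * w = u * (Y - q * w - yP y)"
  proof -
    have "(r - xP y) * w = X * w - q * u * w - xP y * w" by (simp add: X algebra_simps)
    also have "X * w = Y * u - 1" using bez by (simp add: algebra_simps)
    also have "xP y * w = yP y * u - 1" using bez' by (simp add: algebra_simps)
    finally show ?thesis by (simp add: algebra_simps)
  qed
  have "u dvd r - xP y" by (rule bezout_dvd[OF bez]) (simp add: diff)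
  then have "r - xP y = 0"
    by (rule dvd_coeff_zero_imp_0[of _ _ m]) (use nc(3) r in \<open>auto simp: u_def xP_def coeff_sum_monom\<close>)
  then have xy: "xP y = r" by simp
  then have yy: "yP y = Y - q * w" using diff u0 by (simp add: xy)
  have "xP y + gP y * uP y = X + smult (- coeff q 0) u"
    unfolding xy gy uy X by (simp add: algebra_simps)
  moreover have "yP y + gP y * wP y = Y + smult (- coeff q 0) w"
    unfolding yy gy wy by (simp add: algebra_simps)
  ultimately have "fA y = interleave p \<epsilon> X Y + smult (- coeff q 0) (interleave p \<epsilon> u w)"
    unfolding fA_def interleave_smult[symmetric] interleave_add[symmetric] by simp
  then have fA: "fA y = smult (scale A B) A + smult (- coeff q 0 / lead_reduced A B) (reduced A B)"
    using nc(8,9) by (simp add: X_def Y_def u_def w_def)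
  have fB: "fB y = smult (1 / lead_reduced A B) (reduced A B)"
    unfolding fB_def uy wy using nc(8) by (simp add: u_def w_def)
  define t where "t = coeff B d / coeff A d"
  define l where "l = lead_reduced A B"
  define s where "s = scale A B"
  define h where "h = coeff q 0"
  have l0: "l \<noteq> 0" "s \<noteq> 0" using nc(2,7) by (auto simp: l_def s_def)
  \<comment> \<open>Determinant of the matrix taking \<open>(A, B)\<close> to the normal form: a
    shear by \<open>t\<close>, the scalings \<open>s\<close> and \<open>1 / l\<close>, and a shear
    by \<open>h\<close>.\<close>
  have "(s + h / l * t) * (1 / l) - (- h / l) * (- t / l) = s / l" using l0 by (simp add: field_simps)
  then have "(s + h / l * t) * (1 / l) - (- h / l) * (- t / l) \<noteq> 0" using l0 by simp
  moreover have "fA y = smult (s + h / l * t) A + smult (- h / l) B"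
    unfolding fA reduced_def by (simp add: t_def l_def s_def h_def smult_diff_right smult_add_left)
  moreover have "fB y = smult (- t / l) A + smult (1 / l) B"
    unfolding fB reduced_def by (simp add: t_def l_def smult_diff_right mult.commute)
  ultimately show "gl2_equiv (A, B) (fA (normal_form A B), fB (normal_form A B))"
    unfolding gl2_equiv_def y_def[symmetric] fst_conv snd_conv by blast
qed

text \<open>Only the quotient is not visibly a field expression in the coefficients. Division with
  remainder \<open>x = r + q * u\<close> is read as a linear system for the coefficients of
  \<open>r\<close> and \<open>q\<close>, and Cramer's rule applies.\<close>

lemma rat_normal_form:
  assumes ram: "\<And>v. v \<in> S \<Longrightarrow> ram_pair d e None (A v) (B v)"
    and nz: "\<And>v. v \<in> S \<Longrightarrow> coeff (A v) d \<noteq> 0"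
    and A: "rat_poly M S A" and B: "rat_poly M S B" and i: "i < N"
  shows "rat_fun M S (\<lambda>v. normal_form (A v) (B v) ! i)"
proof -
  note nc = normal_form_coords[OF ram nz]
  have red: "rat_poly M S (\<lambda>v. reduced (A v) (B v))"
    unfolding reduced_def
    by (intro rat_poly_diff rat_poly_smult rat_fun_divide rat_polyD A B nz)
  have lead: "rat_fun M S (\<lambda>v. lead_reduced (A v) (B v))"
    unfolding lead_reduced_def by (rule rat_polyD[OF red])
  have wr: "rat_poly M S (\<lambda>v. wronskian (A v) (B v))"
    unfolding wronskian_def by (intro rat_poly_diff rat_poly_mult rat_poly_pderiv A B)
  have "coeff (wronskian (A v) (B v)) 0 \<noteq> 0" if "v \<in> S" for v
    using wronskian_of_ram_pair[OF ram[OF that] d_pos] by (metis coeff_pCons_0)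
  then have sc: "rat_fun M S (\<lambda>v. scale (A v) (B v))"
    unfolding scale_def by (intro rat_fun_divide rat_fun_mult rat_fun_const lead rat_polyD[OF wr])
  have u: "rat_poly M S (\<lambda>v. u_of (A v) (B v))" and w: "rat_poly M S (\<lambda>v. w_of (A v) (B v))"
    unfolding u_of_def w_of_def
    by (intro rat_poly_smult rat_fun_divide rat_fun_const lead rat_poly_residue_part[OF p0] red nc(2); assumption)+
  have x: "rat_poly M S (\<lambda>v. x_of (A v) (B v))"
    unfolding x_of_def by (intro rat_poly_smult sc rat_poly_residue_part[OF p0] A)
  have q: "rat_fun M S (\<lambda>v. coeff (q_of (A v) (B v)) j)" if j: "j < k + 1" for j
  proof -
    \<comment> \<open>The monomials of degree below \<open>m\<close>, then the shifts of
      \<open>u\<close> by 0 to \<open>k\<close>: in all \<open>m + k + 1\<close> polynomials of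
      degree at most \<open>m + k\<close>, independent because \<open>u\<close> has degree
      \<open>m\<close>.\<close>
    define P where "P v i = (if i < m then monom 1 i else monom 1 (i - m) * u_of (A v) (B v))" for v i
    define a where "a v i = (if i < m then coeff (x_of (A v) (B v) mod u_of (A v) (B v)) i
      else coeff (q_of (A v) (B v)) (i - m))" for v i
    have split: "(\<Sum>i<m + (k + 1). smult (b i) (P v i)) =
        (\<Sum>i<m. monom (b i) i) + (\<Sum>i<k + 1. monom (b (m + i)) i) * u_of (A v) (B v)" for b v
      unfolding sum_lessThan_add[of _ m "k + 1"] sum_distrib_right
      by (intro arg_cong2[of _ _ _ _ "(+)"] sum.cong refl)
         (auto simp: P_def smult_monom mult_smult_left[symmetric] simp del: mult_smult_left)
    have "rat_fun M S (\<lambda>v. a v (m + j))"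
    proof (rule rat_fun_basis_coordinates[where n = "m + (k + 1)" and P = P and
          Q = "\<lambda>v. x_of (A v) (B v)"])
      fix v i l assume v: "v \<in> S" and "i < m + (k + 1)" "m + (k + 1) \<le> l"
      then show "coeff (P v i) l = 0"
        using nc(3)[OF v v] by (auto simp: P_def coeff_monom coeff_monom_mult intro!: coeff_eq_0)
    next
      fix i l
      show "rat_fun M S (\<lambda>v. coeff (P v i) l)"
        using rat_polyD[OF rat_poly_mult[OF rat_poly_const u]]
        by (cases "i < m") (simp_all add: P_def rat_fun_const)
    next
      fix v assume v: "v \<in> S"
      let ?u = "u_of (A v) (B v)" and ?x = "x_of (A v) (B v)"
      have u0: "?u \<noteq> 0" using nc(4)[OF v v] by auto
      have 1: "(\<Sum>i<m. monom (a v i) i) = ?x mod ?u"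
      proof -
        have "(\<Sum>i<m. monom (a v i) i) = (\<Sum>i<m. monom (coeff (?x mod ?u) i) i)"
          by (intro sum.cong) (auto simp: a_def)
        also have "\<dots> = ?x mod ?u"
        proof (rule sum_monom_coeff)
          fix l assume "m \<le> l"
          then show "coeff (?x mod ?u) l = 0"
            using degree_mod_less[OF u0, of ?x] nc(3)[OF v v]
            by (cases "?x mod ?u = 0") (simp, intro coeff_eq_0, linarith)
        qed
        finally show ?thesis .
      qed
      have "degree (q_of (A v) (B v)) \<le> k"
        using degree_eq_degree_div[OF u0, of ?x] nc(3,10)[OF v v] by (simp add: q_of_def)
      then have "(\<Sum>i<k + 1. monom (coeff (q_of (A v) (B v)) i) i) = q_of (A v) (B v)"
        by (intro sum_monom_coeff coeff_eq_0) simp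
      then have 2: "(\<Sum>i<k + 1. monom (a v (m + i)) i) = q_of (A v) (B v)"
        by (simp add: a_def)
      show "(\<Sum>i<m + (k + 1). smult (a v i) (P v i)) = ?x"
        unfolding split 1 2 by (simp add: q_of_def)
    next
      fix v b i assume v: "v \<in> S" and 0: "(\<Sum>i<m + (k + 1). smult (b i) (P v i)) = 0"
        and i: "i < m + (k + 1)"
      let ?u = "u_of (A v) (B v)"
      have u0: "?u \<noteq> 0" using nc(4)[OF v v] by auto
      define r where "r = (\<Sum>i<m. monom (b i) i)"
      define s where "s = (\<Sum>i<k + 1. monom (b (m + i)) i)"
      have eq: "r + s * ?u = 0" using 0 unfolding split r_def s_def .
      have "r - ?u * (- s) = r + s * ?u" by (simp add: mult.commute)
      then have "r = ?u * (- s)" unfolding eq by (simp only: right_minus_eq)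
      then have "?u dvd r" by (rule dvdI)
      then have r: "r = 0"
        by (rule dvd_coeff_zero_imp_0[OF _ nc(3)[OF v v]]) (simp add: r_def coeff_sum_monom)
      then have s: "s = 0" using eq u0 by simp
      show "b i = 0"
      proof (cases "i < m")
        case True
        then show ?thesis using arg_cong[OF r, of "\<lambda>q. coeff q i"] by (simp add: r_def coeff_sum_monom)
      next
        case False
        then obtain j where "i = m + j" using le_Suc_ex not_less by blast
        then show ?thesis using i arg_cong[OF s, of "\<lambda>q. coeff q j"]
          unfolding s_def coeff_sum_monom by simp
      qed
    qed (use rat_polyD[OF x] j in auto)
    then show ?thesis by (simp add: a_def)
  qed
  consider "i < m" | "m \<le> i" "i < 2 * m + \<epsilon>" | "2 * m + \<epsilon> \<le> i" by linarith
  then show ?thesis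
  proof cases
    case 1 then show ?thesis using rat_polyD[OF u] by (simp add: normal_form_def nth_append)
  next
    case 2
    then obtain j where j: "i = m + j" using le_Suc_ex by blast
    then have "j < m + \<epsilon>" using 2 by simp
    then have "normal_form (A v) (B v) ! i = coeff (w_of (A v) (B v)) j" for v
      by (simp add: j normal_form_def nth_append)
    then show ?thesis using rat_polyD[OF w] by simp
  next
    case 3
    then have "normal_form (A v) (B v) ! i = coeff (q_of (A v) (B v)) (Suc (i - (2 * m + \<epsilon>)))" for v
      using i by (auto simp: normal_form_def nth_append N_def mult_2 add.assoc)
    moreover have "Suc (i - (2 * m + \<epsilon>)) < k + 1" using 3 i by (simp add: N_def)
    ultimately show ?thesis using q by simp
  qed
qed

end

section \<open>Homeomorphism with the parameter space\<close>

lemma openin_subtopology_rat_fun_nonzero: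
  assumes "rat_fun N S f" "\<And>x. x \<in> S \<Longrightarrow> length x = N"
  shows "openin (subtopology (zariski N) S) {x \<in> S. f x \<noteq> 0}"
proof -
  obtain p q where pq: "poly_fun N p" "\<forall>x\<in>S. q x \<noteq> 0 \<and> f x = p x / q x"
    using assms(1) unfolding rat_fun_def by blast
  have "f x \<noteq> 0 \<longleftrightarrow> p x \<noteq> 0" if "x \<in> S" for x using pq(2) that by auto
  then have "{x \<in> S. f x \<noteq> 0} = {x. length x = N \<and> p x \<noteq> 0} \<inter> S"
    using assms(2) by blast
  then show ?thesis using openin_zariski_basic[OF pq(1)] by (auto simp: openin_subtopology)
qed

text \<open>Postcomposition with \<open>- 1 / z\<close> leaves every fibre form unchanged. It
  reduces the chart where only the denominator has degree \<open>d\<close> to the other one.\<close>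

lemma ram_pair_swap:
  assumes "ram_pair d e c A B" shows "ram_pair d e c B (- A)"
proof -
  have "fibre_poly d B (- A) x = fibre_poly d A B x" for x
    by (cases x) (simp_all add: fibre_poly_def eval_pt_def)
  moreover have "no_syzygy d B (- A)"
    unfolding no_syzygy_def
  proof (intro allI impI)
    fix u w assume u: "\<forall>k\<ge>d. coeff u k = 0" and w: "\<forall>k\<ge>d. coeff w k = 0" and "u * B + w * - A = 0"
    then have "(- w) * A + u * B = 0" by simp
    moreover have "\<forall>k\<ge>d. coeff (- w) k = 0" using w by simp
    ultimately show "u = 0 \<and> w = 0" using assms u unfolding ram_pair_def no_syzygy_def
      by (metis neg_equal_0_iff_equal)
  qed
  ultimately show ?thesis using assms by (simp add: ram_pair_def)
qed

lemma gl2_equiv_swap: "gl2_equiv (A, B) (B, - A)"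
  unfolding gl2_equiv_def
  by (rule exI[of _ 0], rule exI[of _ 1], rule exI[of _ "- 1"], rule exI[of _ 0]) simp

lemma gl2_equiv_refl: "gl2_equiv P P"
  unfolding gl2_equiv_def
  by (rule exI[of _ 1], rule exI[of _ 0], rule exI[of _ 0], rule exI[of _ 1]) simp

lemma gl2_equiv_to_infinity_iff:
  assumes "degree A \<le> d" "degree B \<le> d" "degree A' \<le> d" "degree B' \<le> d"
  shows "gl2_equiv (to_infinity d c A, to_infinity d c B) (to_infinity d c A', to_infinity d c B') \<longleftrightarrow>
    gl2_equiv (A, B) (A', B')"
proof
  assume "gl2_equiv (A, B) (A', B')"
  then show "gl2_equiv (to_infinity d c A, to_infinity d c B) (to_infinity d c A', to_infinity d c B')"
    unfolding gl2_equiv_def fst_conv snd_conv using to_infinity_linear by metis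
next
  assume "gl2_equiv (to_infinity d c A, to_infinity d c B) (to_infinity d c A', to_infinity d c B')"
  then obtain r s t u where *: "r * u - s * t \<noteq> 0"
    "to_infinity d c A' = smult r (to_infinity d c A) + smult s (to_infinity d c B)"
    "to_infinity d c B' = smult t (to_infinity d c A) + smult u (to_infinity d c B)"
    unfolding gl2_equiv_def fst_conv snd_conv by blast
  have "A' = smult r A + smult s B" "B' = smult t A + smult u B"
    using arg_cong[OF *(2), of "from_infinity d c"] arg_cong[OF *(3), of "from_infinity d c"] assms
    by (simp_all add: from_infinity_linear from_to_infinity)
  then show "gl2_equiv (A, B) (A', B')" unfolding gl2_equiv_def fst_conv snd_conv using *(1) by blast
qed

context wild_ramification
begin

definition f :: "'a list \<Rightarrow> 'a list" where
  "f y = coeff_list d (from_infinity d c (fA y)) (from_infinity d c (fB y))"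

definition numer :: "'a list \<Rightarrow> 'a poly" where "numer v = to_infinity d c (polyA d v)"
definition denom :: "'a list \<Rightarrow> 'a poly" where "denom v = to_infinity d c (polyB d v)"

text \<open>Characterized by its unique equivalent normal form rather than by a formula, so that the
  expressions on the two charts agree automatically on the overlap.\<close>

definition g :: "'a list \<Rightarrow> 'a list" where
  "g v = (THE y. y \<in> V \<and> gl2_equiv (numer v, denom v) (fA y, fB y))"

abbreviation "U \<equiv> U_cone d e c"

lemma length_U: "v \<in> U \<Longrightarrow> length v = 2 * d + 2"
  using U_cone_iff[OF d_pos] by blast

lemma length_V: "y \<in> V \<Longrightarrow> length y = N"
  by (simp add: V_def)

lemma ram_pair_numer_denom: "v \<in> U \<Longrightarrow> ram_pair d e None (numer v) (denom v)"
  unfolding numer_def denom_def using U_cone_iff[OF d_pos] ram_pair_to_infinity d_pos by blast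

lemma degree_f: "y \<in> V \<Longrightarrow> degree (fA y) \<le> d" "degree (fB y) \<le> d"
  using degree_fA degree_fB by auto

lemma numer_denom_f: "y \<in> V \<Longrightarrow> numer (f y) = fA y" "y \<in> V \<Longrightarrow> denom (f y) = fB y"
  by (simp_all add: numer_def denom_def f_def degree_from_infinity degree_f to_from_infinity)

lemma f_in_U: "y \<in> V \<Longrightarrow> f y \<in> U"
  using ram_pair_from_infinity[OF ram_pair_f d_pos]
  by (simp add: U_cone_iff[OF d_pos] f_def degree_from_infinity degree_f)

lemma g_unique: "y \<in> V \<Longrightarrow> gl2_equiv (numer v, denom v) (fA y, fB y) \<Longrightarrow> g v = y"
  unfolding g_def
  by (rule the_equality) (use f_inj gl2_equiv_sym gl2_equiv_trans in blast)+

lemma g_f: "y \<in> V \<Longrightarrow> g (f y) = y"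
  by (rule g_unique) (simp_all add: numer_denom_f gl2_equiv_refl)

text \<open>Otherwise infinity would be a common zero of the two forms; hence the two charts cover
  \<open>U\<close>.\<close>

lemma leading_coeff_nonzero:
  assumes "v \<in> U" shows "coeff (numer v) d \<noteq> 0 \<or> coeff (denom v) d \<noteq> 0"
  using fibre_poly_nonzero[of d "numer v" "denom v" None] ram_pair_numer_denom[OF assms] d_pos
  by (auto simp: ram_pair_def fibre_poly_def eval_pt_def)

lemma g_chart1:
  assumes "v \<in> U" "coeff (numer v) d \<noteq> 0" shows "g v = normal_form (numer v) (denom v)"
  using normal_form_correct[OF ram_pair_numer_denom[OF assms(1)] assms(2)] by (intro g_unique)

lemma g_chart2:
  assumes "v \<in> U" "coeff (denom v) d \<noteq> 0" shows "g v = normal_form (denom v) (- numer v)"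
  using normal_form_correct[OF ram_pair_swap[OF ram_pair_numer_denom[OF assms(1)]] assms(2)]
    gl2_equiv_swap gl2_equiv_trans by (intro g_unique) blast+

lemma g_correct:
  assumes "v \<in> U"
  shows "g v \<in> V" "gl2_equiv (numer v, denom v) (fA (g v), fB (g v))"
proof -
  have "\<exists>y\<in>V. gl2_equiv (numer v, denom v) (fA y, fB y)"
    using leading_coeff_nonzero[OF assms] normal_form_correct[OF ram_pair_numer_denom[OF assms]]
      normal_form_correct[OF ram_pair_swap[OF ram_pair_numer_denom[OF assms]]]
      gl2_equiv_swap gl2_equiv_trans by blast
  then show "g v \<in> V" "gl2_equiv (numer v, denom v) (fA (g v), fB (g v))"
    using g_unique by auto
qed

lemma rat_numer: "rat_poly (2 * d + 2) S numer" and rat_denom: "rat_poly (2 * d + 2) S denom"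
proof -
  have "rat_fun (2 * d + 2) S (\<lambda>v. coeff (numer v) j)" for j
  proof (cases "j \<le> d")
    case True
    then show ?thesis unfolding numer_def
      by (intro rat_fun_to_infinity) (simp_all add: coeff_polyA rat_fun_nth)
  next
    case False
    then have "coeff (numer v) j = 0" for v
      unfolding numer_def using degree_to_infinity[OF degree_polyA, of d c v] by (intro coeff_eq_0) simp
    then show ?thesis by (simp add: rat_fun_const)
  qed
  then show "rat_poly (2 * d + 2) S numer" by (simp add: rat_poly_def)
  have "rat_fun (2 * d + 2) S (\<lambda>v. coeff (denom v) j)" for j
  proof (cases "j \<le> d")
    case True
    then show ?thesis unfolding denom_def
      by (intro rat_fun_to_infinity) (simp_all add: coeff_polyB rat_fun_nth)
  next
    case False
    then have "coeff (denom v) j = 0" for v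
      unfolding denom_def using degree_to_infinity[OF degree_polyB, of d c v] by (intro coeff_eq_0) simp
    then show ?thesis by (simp add: rat_fun_const)
  qed
  then show "rat_poly (2 * d + 2) S denom" by (simp add: rat_poly_def)
qed

lemma continuous_f:
  "continuous_map (subtopology (zariski N) V) (subtopology (zariski (2 * d + 2)) U) f"
proof (rule continuous_map_into_subtopology)
  show "f \<in> topspace (subtopology (zariski N) V) \<rightarrow> U" using f_in_U by auto
  show "continuous_map (subtopology (zariski N) V) (zariski (2 * d + 2)) f"
  proof (rule continuous_map_rat_fun)
    show "length x = N" if "x \<in> V" for x using that by (rule length_V)
    show "length (f x) = 2 * d + 2" for x by (simp add: f_def)
    fix i assume i: "i < 2 * d + 2"
    have A: "rat_fun N V (\<lambda>y. coeff (from_infinity d c (fA y)) j)" if "j \<le> d" for j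
      using rat_fun_from_infinity[OF rat_polyD[OF rat_fA] that] .
    have B: "rat_fun N V (\<lambda>y. coeff (from_infinity d c (fB y)) j)" if "j \<le> d" for j
      using rat_fun_from_infinity[OF rat_polyD[OF rat_fB] that] .
    show "rat_fun N V (\<lambda>y. f y ! i)"
      by (cases "i \<le> d") (use i in \<open>simp_all add: f_def nth_coeff_list A B\<close>)
  qed
qed

text \<open>Continuity is local on the source: \<open>U\<close> is covered by the open sets where
  the numerator or the denominator has a nonzero coefficient at \<open>d\<close>, and on each of
  them \<open>g\<close> is a rational map.\<close>

lemma continuous_g:
  "continuous_map (subtopology (zariski (2 * d + 2)) U) (subtopology (zariski N) V) g"
proof (rule continuous_map_into_subtopology)
  have topsp: "topspace (subtopology (zariski (2 * d + 2)) U) = U" using length_U by auto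
  show "g \<in> topspace (subtopology (zariski (2 * d + 2)) U) \<rightarrow> V" using g_correct by auto
  define T where "T b = {v \<in> U. coeff (if b then numer v else denom v) d \<noteq> 0}" for b
  show "continuous_map (subtopology (zariski (2 * d + 2)) U) (zariski N) g"
  proof (rule pasting_lemma[where I = UNIV and T = T and f = "\<lambda>_. g"])
    fix b
    have "rat_fun (2 * d + 2) U (\<lambda>v. coeff (if b then numer v else denom v) d)"
      using rat_polyD[OF rat_numer] rat_polyD[OF rat_denom] by (cases b) auto
    then show "openin (subtopology (zariski (2 * d + 2)) U) (T b)"
      unfolding T_def by (rule openin_subtopology_rat_fun_nonzero) (rule length_U)
    have "T b \<subseteq> U" by (auto simp: T_def)
    then have sub: "subtopology (subtopology (zariski (2 * d + 2)) U) (T b) =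
        subtopology (zariski (2 * d + 2)) (T b)"
      by (simp add: subtopology_subtopology Int_absorb1)
    show "continuous_map (subtopology (subtopology (zariski (2 * d + 2)) U) (T b)) (zariski N) g"
      unfolding sub
    proof (rule continuous_map_rat_fun)
      show "length v = 2 * d + 2" if "v \<in> T b" for v using that length_U by (simp add: T_def)
      show "length (g v) = N" if "v \<in> T b" for v using that g_correct length_V by (simp add: T_def)
      fix i assume i: "i < N"
      show "rat_fun (2 * d + 2) (T b) (\<lambda>v. g v ! i)"
      proof (cases b)
        case True
        have "rat_fun (2 * d + 2) (T b) (\<lambda>v. normal_form (numer v) (denom v) ! i)"
          by (rule rat_normal_form[OF _ _ rat_numer rat_denom i])
             (use True in \<open>auto simp: T_def ram_pair_numer_denom\<close>)
        then show ?thesis by (rule rat_fun_cong) (use True in \<open>auto simp: T_def g_chart1\<close>)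
      next
        case False
        have "rat_fun (2 * d + 2) (T b) (\<lambda>v. normal_form (denom v) (- numer v) ! i)"
          by (rule rat_normal_form[OF _ _ rat_denom rat_poly_minus[OF rat_numer] i])
             (use False in \<open>auto simp: T_def ram_pair_numer_denom ram_pair_swap\<close>)
        then show ?thesis by (rule rat_fun_cong) (use False in \<open>auto simp: T_def g_chart2\<close>)
      qed
    qed
  next
    fix v assume "v \<in> topspace (subtopology (zariski (2 * d + 2)) U)"
    then show "\<exists>b. b \<in> UNIV \<and> v \<in> T b \<and> g v = g v"
      using leading_coeff_nonzero[of v] topsp by (cases "coeff (numer v) d = 0") (auto simp: T_def)
  qed simp
qed

lemma sl2_proj_equiv_iff_g:
  assumes "v \<in> U" "v' \<in> U" shows "sl2_proj_equiv d v v' \<longleftrightarrow> g v = g v'"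
proof -
  have "sl2_proj_equiv d v v' \<longleftrightarrow> gl2_equiv (numer v, denom v) (numer v', denom v')"
    unfolding numer_def denom_def
    using sl2_proj_equiv_iff[OF length_U length_U] assms
    by (simp add: gl2_equiv_to_infinity_iff degree_polyA degree_polyB)
  also have "\<dots> \<longleftrightarrow> g v = g v'"
  proof
    assume "gl2_equiv (numer v, denom v) (numer v', denom v')"
    then have "gl2_equiv (numer v, denom v) (fA (g v'), fB (g v'))"
      using g_correct(2)[OF assms(2)] gl2_equiv_trans by blast
    then show "g v = g v'" using g_unique g_correct(1)[OF assms(2)] by blast
  next
    assume "g v = g v'"
    then show "gl2_equiv (numer v, denom v) (numer v', denom v')"
      using g_correct(2)[OF assms(1)] g_correct(2)[OF assms(2)] gl2_equiv_sym gl2_equiv_trans by metis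
  qed
  finally show ?thesis .
qed

lemma U_nonempty: "U \<noteq> {}"
  using V_nonempty f_in_U by blast

lemma krull_dim_quotient: "krull_dim (SL2_quot_U d e c) = enat N"
proof -
  have "subtopology (zariski N) V homeomorphic_space SL2_quot_U d e c"
    unfolding SL2_quot_U_def
    by (rule orbit_space_homeomorphic[OF continuous_g continuous_f])
       (auto simp: g_f sl2_proj_equiv_iff_g)
  then have "krull_dim (SL2_quot_U d e c) = krull_dim (subtopology (zariski N) V)"
    using krull_dim_homeomorphic_space by metis
  also obtain y where "y \<in> V" using V_nonempty by blast
  then have "krull_dim (subtopology (zariski N) V) = enat N"
    by (rule krull_dim_open[OF infinite_alg_closed_UNIV openin_V])
  finally show ?thesis .
qed

end

theorem theorem1p6:
  fixes c :: "'a::alg_closed_field option" and p d e :: nat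
  assumes "CHAR('a) = p" and "p > 0"
    and "d > 1" and "e > 1"
    and "d mod p = 0 \<or> d mod p = 1"
    and "p dvd e" and "e \<le> d"
  shows "U_cone d e c \<noteq> {} \<and>
         krull_dim (SL2_quot_U d e c) =
           enat (if p dvd d then (2 * d - e) div p else 1 + (2 * d - 2 - e) div p)"
proof -
  have prime: "prime p" using prime_CHAR_semidom[where ?'a = 'a] assms(1,2) by simp
  then have p2: "2 \<le> p" by (rule prime_ge_2_nat)
  define \<epsilon> where "\<epsilon> = d mod p"
  have eps: "\<epsilon> \<le> 1" using assms(5) by (auto simp: \<epsilon>_def)
  define n where "n = d div p"
  have d: "d = p * n + \<epsilon>" by (simp add: n_def \<epsilon>_def)
  obtain k where k: "e = p * k" using assms(6) by (rule dvdE)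
  have k_pos: "0 < k" using k assms(4) by (cases k) auto
  \<comment> \<open>Since \<open>e\<close> is a multiple of \<open>p\<close> and the remainder
    \<open>\<epsilon>\<close> is below \<open>p\<close>, the bound \<open>e \<le> d\<close> passes
    to the quotients.\<close>
  have "k \<le> n"
  proof (rule ccontr)
    assume "\<not> k \<le> n"
    then have "p * (n + 1) \<le> p * k" by (intro mult_le_mono2) simp
    then show False using assms(7) d k eps p2 by simp
  qed
  then obtain m where n: "n = m + k" using le_Suc_ex by (metis add.commute)
  interpret W: wild_ramification p \<epsilon> m k c
    by unfold_locales (use assms(1) prime eps k_pos in auto)
  have d': "W.d = d" using d n by (simp add: W.d_def)
  have e': "W.e = e" using k by (simp add: W.e_def)
  \<comment> \<open>In both cases the numerator on the right equals \<open>p * (2 * m + k)\<close>;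
    the extra 1 of the second case is \<open>\<epsilon>\<close>.\<close>
  have "W.N = (if p dvd d then (2 * d - e) div p else 1 + (2 * d - 2 - e) div p)"
  proof (cases "\<epsilon> = 0")
    case True
    then have "p dvd d" by (simp add: d)
    moreover have "2 * d - e = p * (2 * m + k)" using True by (simp add: d k n algebra_simps)
    ultimately show ?thesis unfolding W.N_def using True p2 by simp
  next
    case False
    then have 1: "\<epsilon> = 1" using eps by simp
    have "\<not> p dvd d" using False by (simp add: \<epsilon>_def dvd_eq_mod_eq_0)
    moreover have "2 * d - 2 - e = p * (2 * m + k)" using 1 by (simp add: d k n algebra_simps)
    ultimately show ?thesis unfolding W.N_def using 1 p2 by simp
  qed
  then show ?thesis using W.U_nonempty W.krull_dim_quotient unfolding d' e' by simp
qed

end
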